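(* Let $d\in\mathbb{N}$, let $\Omega\subset\mathbb{R}^d$ be open and bounded, and let $\bar\varphi\in C^1(\mathbb{R}^d)$ satisfy $\nabla\bar\varphi\neq 0$ on $\{\bar\varphi=0\}\cap\overline{\Omega}$. Let $\alpha>0$ and $p\in(1,d/\alpha]$ be given such that $p\ge\frac{2d}{d-1+2\alpha}$ and $\alpha>\frac1p$. Then there exists a constant $c>0$ such that $$\|v\|_{L^\infty(\Omega)}\int_\Omega|\bar\varphi v|\,d\lambda^d\ge c\,\|v\|_{L^{\alpha,p}(\mathbb{R}^d)^*}^2$$ holds for all $v\in L^\infty(\Omega)$.
   Context: All spaces are real; $\lambda^d$ is Lebesgue measure and $\{\bar\varphi=0\}=\{x\in\mathbb{R}^d:\bar\varphi(x)=0\}$. With the Fourier transform $(\mathcal{F}f)(\xi)=\int_{\mathbb{R}^d}f(x)e^{-i\xi\cdot x}\,dx$, the Bessel kernel $g_\alpha\in L^1(\mathbb{R}^d)$, $\alpha>0$, is the function with $(\mathcal{F}g_\alpha)(\xi)=(1+|\xi|^2)^{-\alpha/2}$. For $\alpha>0$, $p\in(1,\infty)$, the Bessel potential space is $L^{\alpha,p}(\mathbb{R}^d)=\{g_\alpha*f:f\in L^p(\mathbb{R}^d)\}$ with norm $\|g_\alpha*f\|_{L^{\alpha,p}(\mathbb{R}^d)}=\|f\|_{L^p(\mathbb{R}^d)}$; $L^{\alpha,p}(\mathbb{R}^d)^*$ is its topological dual. The space $C_c^\infty(\mathbb{R}^d)$ is dense in $L^{\alpha,p}(\mathbb{R}^d)$.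 A function $v\in L^\infty(\Omega)$ is extended by zero to $\mathbb{R}^d$ and identified with the functional $\varphi\mapsto\int_\Omega v\varphi\,d\lambda^d$, $\varphi\in C_c^\infty(\mathbb{R}^d)$ (extended continuously to $L^{\alpha,p}(\mathbb{R}^d)$). *)

theory Defs
  imports "HOL-Probability.Essential_Supremum"
begin

text \<open>
  The space \<open>\<real>\<^sup>d\<close> is an arbitrary \<open>'a::euclidean_space\<close> with \<open>d = DIM('a)\<close>. Elements of
  Lebesgue and Bessel potential spaces are represented by functions; two functions that agree
  almost everywhere represent the same element.
\<close>

definition Lp_space :: "real \<Rightarrow> ('a::euclidean_space \<Rightarrow> real) set" where
  "Lp_space p = {f \<in> borel_measurable lebesgue. integrable lebesgue (\<lambda>x. \<bar>f x\<bar> powr p)}"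

definition Lp_norm :: "real \<Rightarrow> ('a::euclidean_space \<Rightarrow> real) \<Rightarrow> real" where
  "Lp_norm p f = (LINT x|lebesgue. \<bar>f x\<bar> powr p) powr (1 / p)"

definition Linf_ess :: "'a::euclidean_space set \<Rightarrow> ('a \<Rightarrow> real) \<Rightarrow> ennreal" where
  "Linf_ess \<Omega> v = esssup (lebesgue_on \<Omega>) (\<lambda>x. ennreal \<bar>v x\<bar>)"

definition Linf_space :: "'a::euclidean_space set \<Rightarrow> ('a \<Rightarrow> real) set" where
  "Linf_space \<Omega> = {v \<in> borel_measurable (lebesgue_on \<Omega>). Linf_ess \<Omega> v < \<infinity>}"

definition Linf_norm :: "'a::euclidean_space set \<Rightarrow> ('a \<Rightarrow> real) \<Rightarrow> real" where
  "Linf_norm \<Omega> v = enn2real (Linf_ess \<Omega> v)"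

definition fourier :: "('a::euclidean_space \<Rightarrow> real) \<Rightarrow> 'a \<Rightarrow> complex" where
  "fourier f \<xi> = (LINT x|lebesgue. complex_of_real (f x) * exp (- \<i> * complex_of_real (\<xi> \<bullet> x)))"

text \<open>
  The Bessel kernel is determined by its Fourier transform up to equality almost everywhere;
  nothing below depends on the representative.
\<close>

definition bessel_kernel :: "real \<Rightarrow> 'a::euclidean_space \<Rightarrow> real" where
  "bessel_kernel \<alpha> = (SOME g. integrable lebesgue g \<and>
     (\<forall>\<xi>. fourier g \<xi> = complex_of_real ((1 + (norm \<xi>)\<^sup>2) powr (- \<alpha> / 2))))"

definition convol :: "('a::euclidean_space \<Rightarrow> real) \<Rightarrow> ('a \<Rightarrow> real) \<Rightarrow> 'a \<Rightarrow> real" where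
  "convol g f x = (LINT y|lebesgue. g (x - y) * f y)"

definition bessel_density :: "real \<Rightarrow> real \<Rightarrow> ('a::euclidean_space \<Rightarrow> real) \<Rightarrow> ('a \<Rightarrow> real) \<Rightarrow> bool" where
  "bessel_density \<alpha> p u f \<longleftrightarrow>
     f \<in> Lp_space p \<and> (AE x in lebesgue. u x = convol (bessel_kernel \<alpha>) f x)"

definition bessel_space :: "real \<Rightarrow> real \<Rightarrow> ('a::euclidean_space \<Rightarrow> real) set" where
  "bessel_space \<alpha> p = {u \<in> borel_measurable lebesgue. \<exists>f. bessel_density \<alpha> p u f}"

text \<open>Convolution with the Bessel kernel is injective on \<open>L\<^sup>p\<close>, so the norm does not depend on
  the choice of the density.\<close>

definition bessel_norm :: "real \<Rightarrow> real \<Rightarrow> ('a::euclidean_space \<Rightarrow> real) \<Rightarrow> real" where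
  "bessel_norm \<alpha> p u = Lp_norm p (SOME f. bessel_density \<alpha> p u f)"

text \<open>Boundedness forces a functional to take the same value on functions that agree almost
  everywhere. Its values outside the space are irrelevant.\<close>

definition bessel_dual :: "real \<Rightarrow> real \<Rightarrow> (('a::euclidean_space \<Rightarrow> real) \<Rightarrow> real) set" where
  "bessel_dual \<alpha> p = {T.
     (\<forall>u \<in> bessel_space \<alpha> p. \<forall>w \<in> bessel_space \<alpha> p. T (\<lambda>x. u x + w x) = T u + T w) \<and>
     (\<forall>u \<in> bessel_space \<alpha> p. \<forall>a. T (\<lambda>x. a * u x) = a * T u) \<and>
     (\<exists>C. \<forall>u \<in> bessel_space \<alpha> p. \<bar>T u\<bar> \<le> C * bessel_norm \<alpha> p u)}"

definition bessel_dual_norm :: "real \<Rightarrow> real \<Rightarrow> (('a::euclidean_space \<Rightarrow> real) \<Rightarrow> real) \<Rightarrow> real" where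
  "bessel_dual_norm \<alpha> p T = (SUP u \<in> {u \<in> bessel_space \<alpha> p. bessel_norm \<alpha> p u \<le> 1}. \<bar>T u\<bar>)"

fun Ck :: "nat \<Rightarrow> ('a::euclidean_space \<Rightarrow> real) \<Rightarrow> bool" where
  "Ck 0 f \<longleftrightarrow> continuous_on UNIV f"
| "Ck (Suc k) f \<longleftrightarrow> (\<forall>x. f differentiable (at x)) \<and>
     (\<forall>b\<in>Basis. Ck k (\<lambda>x. frechet_derivative f (at x) b))"

definition test_function :: "('a::euclidean_space \<Rightarrow> real) \<Rightarrow> bool" where
  "test_function \<psi> \<longleftrightarrow> (\<forall>k. Ck k \<psi>) \<and> compact (closure {x. \<psi> x \<noteq> 0})"

text \<open>
  The functional \<open>T\<close> is the element of the dual space with which \<open>v\<close>, extended by zero outside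
  \<open>\<Omega>\<close>, is identified: the continuous extension of \<open>\<psi> \<mapsto> \<integral>\<^sub>\<Omega> v \<psi>\<close>. Test functions are dense in
  the Bessel potential space, so for given \<open>v\<close> there is at most one such element of the dual.
\<close>

definition identified_with ::
  "real \<Rightarrow> real \<Rightarrow> 'a::euclidean_space set \<Rightarrow> ('a \<Rightarrow> real) \<Rightarrow> (('a \<Rightarrow> real) \<Rightarrow> real) \<Rightarrow> bool" where
  "identified_with \<alpha> p \<Omega> v T \<longleftrightarrow> T \<in> bessel_dual \<alpha> p \<and>
     (\<forall>\<psi>. test_function \<psi> \<longrightarrow> T \<psi> = (LINT x:\<Omega>|lebesgue. v x * \<psi> x))"

end

theory Submission
  imports Defs "HOL-Probability.Characteristic_Functions"
begin

text \<open>
  Let \<open>d\<close> be the dimension, \<open>M\<close> the supremum norm of \<open>v\<close> and \<open>A = \<integral> \<bar>\<phi> v\<bar>\<close>. An element of the unit ball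
  of the Bessel potential space is \<open>g * f\<close> with the Bessel kernel \<open>g\<close> and a density \<open>f\<close> of \<open>L\<^sup>p\<close> norm at
  most one. The kernel \<open>g\<close> is bounded by a multiple of \<open>k z = norm z powr - (d - \<beta>)\<close> for all \<open>\<beta> \<le> \<alpha>\<close> with
  \<open>\<beta> < d\<close>. The claim is therefore the inequality \<open>\<integral> \<bar>v\<bar> (k * \<bar>f\<bar>) \<le> K (M A) powr (1 / 2)\<close>, which is
  \<open>weighted_potential_estimate\<close>. Since \<open>\<bar>v\<bar> (k * \<bar>f\<bar>)\<close> is at most
  \<open>l \<bar>\<phi> v\<bar> + M (k * \<bar>f\<bar> - l \<bar>\<phi>\<bar>)\<^sup>+\<close> for every \<open>l > 0\<close>, it follows by optimisation over \<open>l\<close> once the integral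
  of the positive part over \<open>\<Omega>\<close> is known to be at most a constant times \<open>1 / l\<close>.

  The hypothesis \<open>p \<ge> 2 d / (d - 1 + 2 \<alpha>)\<close> says that traces of \<open>g * f\<close> on hypersurfaces are square
  integrable. In the case of equality a uniform bound of these traces on the level sets of \<open>\<phi>\<close> loses
  a logarithm when the levels are summed. The proof avoids traces. At a point \<open>x\<close> on the level
  \<open>s = max \<bar>\<phi> x\<bar> 1\<close> it chooses a radius \<open>R\<close> such that \<open>s = R powr - (d / p - \<beta>)\<close>. Then all contributions to
  \<open>(k * \<bar>f\<bar>) x\<close> add up to at most a multiple of \<open>s\<close>, except those of the points \<open>y\<close> in the ball of radius
  \<open>R\<close> around \<open>x\<close> where \<open>\<bar>f y\<bar> > R powr - (d / p)\<close> (\<open>riesz_potential_split\<close>). The first part is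
  absorbed by \<open>\<phi>\<close>. The second part is integrated over \<open>x\<close> first. Close to the zero set of \<open>\<phi>\<close> some
  partial derivative of \<open>\<phi>\<close> is bounded away from zero, so integration along that coordinate becomes
  integration over the levels \<open>s\<close> and the other coordinates contribute an integral in dimension
  \<open>d - 1\<close> (\<open>layer_estimate\<close>). The lower bound for \<open>\<bar>f y\<bar>\<close> cuts the integral over \<open>s\<close> off at a level
  depending on \<open>\<bar>f y\<bar>\<close>, and what remains is at most a multiple of \<open>\<bar>f y\<bar> powr p\<close> (\<open>local_estimate\<close>). Away
  from the zero set a small linear function below \<open>\<bar>\<phi>\<bar>\<close> takes the place of \<open>\<phi>\<close>, and compactness of the
  closure of \<open>\<Omega>\<close> leaves finitely many pieces.

  The rest of the proof makes the Bessel potential space accessible. The kernel is given by its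
  Fourier transform only. The mixture of heat kernels with a gamma density has this Fourier transform
  (\<open>heat_mixture_fourier\<close>) and the required upper bound (\<open>heat_mixture_bound\<close>), and it is the kernel
  by \<open>fourier_unique\<close>. The norm of a potential is the norm of a chosen density. Any density yields the
  upper bound for the functional, but the supremum that defines the dual norm is meaningful only if
  the unit ball is nonempty. This holds because zero is the only density of the potential zero
  (\<open>heat_mixture_convolution_injective\<close>): applied to heat averages, a vanishing convolution with the
  mixture becomes a vanishing fractional integral in the time variable, and fractional integrals of
  order \<open>a\<close> are raised to an integer order, where differentiation is possible.
\<close>

section \<open>Integrals of powers of the norm\<close>

text \<open>
  The value at zero is infinite, unlike that of \<open>powr\<close>. This makes pointwise comparisons with products
  of such factors true everywhere and not only outside the coordinate hyperplanes.
\<close>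

definition power_singularity :: "real \<Rightarrow> real \<Rightarrow> ennreal" where
  "power_singularity \<beta> t = (if t = 0 then top else ennreal (\<bar>t\<bar> powr - \<beta>))"

lemma power_singularity_measurable [measurable]: "power_singularity \<beta> \<in> borel_measurable borel"
  unfolding power_singularity_def[abs_def] by measurable

lemma nn_integral_even:
  fixes h :: "real \<Rightarrow> ennreal"
  assumes [measurable]: "h \<in> borel_measurable borel" and "\<And>t. h (- t) = h t"
  shows "(\<integral>\<^sup>+t. h t \<partial>lborel) = 2 * (\<integral>\<^sup>+t. h t * indicator {0..} t \<partial>lborel)"
proof -
  have "(\<integral>\<^sup>+t. h t \<partial>lborel) = (\<integral>\<^sup>+t. h t * indicator {0..} t + h t * indicator {..0} t \<partial>lborel)"
    by (rule nn_integral_cong_AE, rule AE_mp[OF AE_lborel_singleton[of 0]], rule AE_I2)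
       (auto split: split_indicator)
  also have "\<dots> = (\<integral>\<^sup>+t. h t * indicator {0..} t \<partial>lborel) + (\<integral>\<^sup>+t. h t * indicator {..0} t \<partial>lborel)"
    by (rule nn_integral_add) auto
  also have "(\<integral>\<^sup>+t. h t * indicator {..0} t \<partial>lborel) = (\<integral>\<^sup>+t. h t * indicator {0..} t \<partial>lborel)"
    by (subst nn_integral_real_affine[of _ "-1" 0])
       (auto intro!: nn_integral_cong simp: assms split: split_indicator)
  finally show ?thesis by (simp add: mult_2)
qed

lemma nn_integral_singularity_inner:
  assumes "0 \<le> \<beta>" "\<beta> < 1" "0 \<le> r"
  shows "(\<integral>\<^sup>+t. power_singularity \<beta> (t - y) * indicator {t. \<bar>t - y\<bar> < r} t \<partial>lborel) \<le> ennreal (2 / (1 - \<beta>) * r powr (1 - \<beta>))"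
proof -
  have "(\<integral>\<^sup>+t. power_singularity \<beta> (t - y) * indicator {t. \<bar>t - y\<bar> < r} t \<partial>lborel)
    = (\<integral>\<^sup>+t. power_singularity \<beta> t * indicator {t. \<bar>t\<bar> < r} t \<partial>lborel)"
    by (subst nn_integral_real_affine[of _ 1 y]) (auto split: split_indicator intro!: nn_integral_cong)
  also have "\<dots> = 2 * (\<integral>\<^sup>+t. power_singularity \<beta> t * indicator {t. \<bar>t\<bar> < r} t * indicator {0..} t \<partial>lborel)"
    by (rule nn_integral_even) (auto simp: power_singularity_def split: split_indicator)
  also have "(\<integral>\<^sup>+t. power_singularity \<beta> t * indicator {t. \<bar>t\<bar> < r} t * indicator {0..} t \<partial>lborel)
    \<le> (\<integral>\<^sup>+t. ennreal (t powr (- \<beta>)) * indicator {0..r} t \<partial>lborel)"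
    by (rule nn_integral_mono_AE, rule AE_mp[OF AE_lborel_singleton[of 0]], rule AE_I2)
       (auto simp: power_singularity_def split: split_indicator)
  also have "\<dots> = ennreal (r powr (- \<beta> + 1) / (- \<beta> + 1))"
    using nn_integral_has_integral_lebesgue'[OF _ has_integral_powr_from_0[of "-\<beta>" r]] assms
    by simp
  finally have "(\<integral>\<^sup>+t. power_singularity \<beta> (t - y) * indicator {t. \<bar>t - y\<bar> < r} t \<partial>lborel)
     \<le> ennreal 2 * ennreal (r powr (- \<beta> + 1) / (- \<beta> + 1))"
    by (simp add: mult_left_mono)
  also have "\<dots> = ennreal (2 / (1 - \<beta>) * r powr (1 - \<beta>))"
    using assms by (subst ennreal_mult'[symmetric]) simp_all
  finally show ?thesis .
qed

lemma nn_integral_powr_outer: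
  assumes "1 < \<beta>" "0 < r"
  shows "(\<integral>\<^sup>+t. ennreal ((r + \<bar>t\<bar>) powr - \<beta>) \<partial>lborel) \<le> ennreal (2 / (\<beta> - 1) * r powr (1 - \<beta>))"
proof -
  have "(\<integral>\<^sup>+t. ennreal ((r + \<bar>t\<bar>) powr - \<beta>) \<partial>lborel)
     = 2 * (\<integral>\<^sup>+t. ennreal ((r + \<bar>t\<bar>) powr - \<beta>) * indicator {0..} t \<partial>lborel)"
    by (rule nn_integral_even) auto
  also have "(\<integral>\<^sup>+t. ennreal ((r + \<bar>t\<bar>) powr - \<beta>) * indicator {0..} t \<partial>lborel)
     = (\<integral>\<^sup>+t. ennreal (t powr - \<beta>) * indicator {r..} t \<partial>lborel)"
    by (subst (2) nn_integral_real_affine[of _ 1 r]) (auto split: split_indicator intro!: nn_integral_cong)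
  also have "\<dots> = ennreal (- (r powr (- \<beta> + 1)) / (- \<beta> + 1))"
    using nn_integral_has_integral_lebesgue'[OF _ has_integral_powr_to_inf[of "-\<beta>" r]] assms
    by simp
  finally show ?thesis
    using assms by (auto simp: ennreal_mult'[symmetric] field_simps minus_divide_right
        ennreal_numeral[symmetric] simp del: ennreal_numeral)
qed

lemma prod_mono_ennreal:
  fixes f g :: "'i \<Rightarrow> ennreal"
  assumes "\<And>i. i \<in> I \<Longrightarrow> f i \<le> g i"
  shows "prod f I \<le> prod g I"
  using assms by (induction I rule: infinite_finite_induct) (auto intro!: mult_mono)

text \<open>
  A negative power of the norm splits into equal powers of the coordinates because no coordinate
  exceeds the norm. With it, integrals of powers of the norm reduce to integrals over the real line
  without polar coordinates.
\<close>

lemma powr_le_prod_singularity: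
  assumes "finite I" "I \<noteq> {}" "0 \<le> \<eta>" "\<And>i. i \<in> I \<Longrightarrow> \<bar>z i\<bar> \<le> r"
  shows "ennreal (r powr - \<eta>) \<le> (\<Prod>i\<in>I. power_singularity (\<eta> / card I) (z i))"
proof -
  have "ennreal (r powr - \<eta>) = ennreal (\<Prod>i\<in>I. r powr - (\<eta> / card I))"
    using assms by (cases "r = 0") (simp_all add: powr_power card_gt_0_iff)
  also have "\<dots> = (\<Prod>i\<in>I. ennreal (r powr - (\<eta> / card I)))"
    by (rule prod_ennreal[symmetric]) simp
  also have "\<dots> \<le> (\<Prod>i\<in>I. power_singularity (\<eta> / card I) (z i))"
    using assms by (intro prod_mono_ennreal) (auto simp: power_singularity_def intro!: ennreal_leI powr_mono2')
  finally show ?thesis .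
qed

lemma power_mult_powr_quotient:
  assumes "0 < (n::nat)"
  shows "(K * r powr (1 - \<beta> / n)) ^ n = K ^ n * r powr (real n - \<beta>)"
proof -
  have "(1 - \<beta> / n) * n = real n - \<beta>"
    using assms by (simp add: field_simps)
  then show ?thesis
    using assms powr_power[of r "1 - \<beta> / n" n]
    by (cases "r = 0") (simp_all add: power_mult_distrib mult.commute)
qed

lemma nn_integral_norm_powr_inner:
  assumes "0 \<le> \<beta>" "\<beta> < real DIM('a::euclidean_space)"
  obtains C where "0 \<le> C" "\<And>r y::'a. 0 \<le> r \<Longrightarrow> (\<integral>\<^sup>+x. ennreal (norm (y - x) powr - \<beta>) * indicator {x. norm (y - x) < r} x \<partial>lborel)
     \<le> ennreal (C * r powr (real DIM('a) - \<beta>))"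
proof
  define n where "n = DIM('a)"
  have n: "0 < n" by (simp add: n_def)
  define C where "C = (2 / (1 - \<beta> / n)) ^ n"
  show "0 \<le> C" using assms by (simp add: C_def n_def field_simps)
  fix r :: real and y :: 'a assume r: "0 \<le> r"
  have "(\<integral>\<^sup>+x. ennreal (norm (y - x) powr - \<beta>) * indicator {x. norm (y - x) < r} x \<partial>lborel)
    \<le> (\<integral>\<^sup>+x. (\<Prod>b\<in>Basis. power_singularity (\<beta> / n) (x \<bullet> b - y \<bullet> b) * indicator {t. \<bar>t - y \<bullet> b\<bar> < r} (x \<bullet> b)) \<partial>lborel)"
  proof (rule nn_integral_mono)
    fix x :: 'a
    have le: "\<bar>x \<bullet> b - y \<bullet> b\<bar> \<le> norm (y - x)" if "b \<in> Basis" for b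
      using Basis_le_norm[OF that, of "x - y"] by (simp add: inner_diff_left norm_minus_commute)
    show "ennreal (norm (y - x) powr - \<beta>) * indicator {x. norm (y - x) < r} x
       \<le> (\<Prod>b\<in>(Basis::'a set). power_singularity (\<beta> / n) (x \<bullet> b - y \<bullet> b) * indicator {t. \<bar>t - y \<bullet> b\<bar> < r} (x \<bullet> b))"
    proof (cases "norm (y - x) < r")
      case True
      then have "(\<Prod>b\<in>Basis. power_singularity (\<beta> / n) (x \<bullet> b - y \<bullet> b) * indicator {t. \<bar>t - y \<bullet> b\<bar> < r} (x \<bullet> b))
         = (\<Prod>b\<in>Basis. power_singularity (\<beta> / n) (x \<bullet> b - y \<bullet> b))"
        using le by (intro prod.cong) (force simp: indicator_def)+
      then show ?thesis
        using powr_le_prod_singularity[of "Basis :: 'a set" \<beta> "\<lambda>b. x \<bullet> b - y \<bullet> b" "norm (y - x)"] le True assms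
        by (simp add: n_def)
    qed simp
  qed
  also have "\<dots> = (\<Prod>b\<in>(Basis::'a set). \<integral>\<^sup>+t. power_singularity (\<beta> / n) (t - y \<bullet> b) * indicator {t. \<bar>t - y \<bullet> b\<bar> < r} t \<partial>lborel)"
    by (rule nn_integral_lborel_prod) auto
  also have "\<dots> \<le> (\<Prod>b\<in>(Basis::'a set). ennreal (2 / (1 - \<beta> / n) * r powr (1 - \<beta> / n)))"
    using assms r by (intro prod_mono_ennreal nn_integral_singularity_inner) (auto simp: n_def)
  also have "\<dots> = ennreal ((2 / (1 - \<beta> / n) * r powr (1 - \<beta> / n)) ^ n)"
    using assms by (simp add: n_def ennreal_power)
  also have "\<dots> = ennreal (C * r powr (real DIM('a) - \<beta>))"
    using power_mult_powr_quotient[OF n, of "2 / (1 - \<beta> / n)" r \<beta>] by (simp only: C_def n_def)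
  finally show "(\<integral>\<^sup>+x. ennreal (norm (y - x) powr - \<beta>) * indicator {x. norm (y - x) < r} x \<partial>lborel)
     \<le> ennreal (C * r powr (real DIM('a) - \<beta>))" .
qed

text \<open>
  Outside the ball of radius \<open>r\<close> every \<open>r + \<bar>x \<bullet> b\<bar>\<close> is at most twice the norm, so the integrand is
  bounded by a product of functions of the coordinates that are integrable on the whole line.
\<close>

lemma nn_integral_norm_powr_outer:
  assumes "real DIM('a::euclidean_space) < \<beta>"
  obtains C where "0 \<le> C" "\<And>r y::'a. 0 < r \<Longrightarrow> (\<integral>\<^sup>+x. ennreal (norm (y - x) powr - \<beta>) * indicator {x. r \<le> norm (y - x)} x \<partial>lborel)
     \<le> ennreal (C * r powr (real DIM('a) - \<beta>))"
proof
  define n where "n = DIM('a)"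
  have n: "0 < n" by (simp add: n_def)
  define C where "C = 2 powr \<beta> * (2 / (\<beta> / n - 1)) ^ n"
  have bn: "1 < \<beta> / n" using assms n by (simp add: n_def field_simps)
  show "0 \<le> C" using bn by (simp add: C_def)
  fix r :: real and y :: 'a assume r: "0 < r"
  have "(\<integral>\<^sup>+x. ennreal (norm (y - x) powr - \<beta>) * indicator {x. r \<le> norm (y - x)} x \<partial>lborel)
    = (\<integral>\<^sup>+x. ennreal (norm (x::'a) powr - \<beta>) * indicator {x. r \<le> norm x} x \<partial>lborel)"
  proof -
    have "(\<integral>\<^sup>+x. ennreal (norm (y - x) powr - \<beta>) * indicator {x. r \<le> norm (y - x)} x \<partial>lborel)
      = (\<integral>\<^sup>+x. ennreal (norm (y - x) powr - \<beta>) * indicator {x. r \<le> norm (y - x)} x \<partial>distr lborel borel (\<lambda>x. y + x))"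
      by (subst lborel_distr_plus) simp
    also have "\<dots> = (\<integral>\<^sup>+x. ennreal (norm (x::'a) powr - \<beta>) * indicator {x. r \<le> norm x} x \<partial>lborel)"
      by (subst nn_integral_distr) (auto intro!: nn_integral_cong simp: indicator_def)
    finally show ?thesis .
  qed
  also have "\<dots> \<le> (\<integral>\<^sup>+x. ennreal (2 powr \<beta>) * (\<Prod>b\<in>(Basis::'a set). ennreal ((r + \<bar>x \<bullet> b\<bar>) powr - (\<beta> / n))) \<partial>lborel)"
  proof (rule nn_integral_mono)
    fix x :: 'a
    show "ennreal (norm x powr - \<beta>) * indicator {x. r \<le> norm x} x \<le> 
       ennreal (2 powr \<beta>) * (\<Prod>b\<in>(Basis::'a set). ennreal ((r + \<bar>x \<bullet> b\<bar>) powr - (\<beta> / n)))"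
    proof (cases "r \<le> norm x")
      case True
      have "norm x powr - \<beta> = 2 powr \<beta> * (2 * norm x) powr - \<beta>"
        by (simp add: powr_mult powr_minus field_simps)
      also have "(2 * norm x) powr - \<beta> = (\<Prod>b\<in>(Basis::'a set). (2 * norm x) powr - (\<beta> / n))"
        using n True r power_mult_powr_quotient[OF n, of 1 "2 * norm x" "n + \<beta>"]
        by (simp add: n_def add_divide_distrib)
      also have "\<dots> \<le> (\<Prod>b\<in>(Basis::'a set). (r + \<bar>x \<bullet> b\<bar>) powr - (\<beta> / n))"
      proof (intro prod_mono conjI powr_mono2')
        fix b :: 'a assume "b \<in> Basis"
        then have "\<bar>x \<bullet> b\<bar> \<le> norm x" by (rule Basis_le_norm)
        then show "r + \<bar>x \<bullet> b\<bar> \<le> 2 * norm x" using True by simp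
      qed (use r bn in auto)
      finally have "norm x powr - \<beta> \<le> 2 powr \<beta> * (\<Prod>b\<in>(Basis::'a set). (r + \<bar>x \<bullet> b\<bar>) powr - (\<beta> / n))"
        by simp
      then show ?thesis using True
        by (simp add: prod_ennreal ennreal_mult'[symmetric] ennreal_leI)
    qed simp
  qed
  also have "\<dots> = ennreal (2 powr \<beta>) * (\<Prod>b\<in>(Basis::'a set). \<integral>\<^sup>+t. ennreal ((r + \<bar>t\<bar>) powr - (\<beta> / n)) \<partial>lborel)"
    by (subst nn_integral_cmult, simp, subst nn_integral_lborel_prod) auto
  also have "\<dots> \<le> ennreal (2 powr \<beta>) * (\<Prod>b\<in>(Basis::'a set). ennreal (2 / (\<beta> / n - 1) * r powr (1 - \<beta> / n)))"
    using bn r by (intro mult_left_mono prod_mono_ennreal nn_integral_powr_outer) auto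
  also have "\<dots> = ennreal (2 powr \<beta>) * ennreal ((2 / (\<beta> / n - 1) * r powr (1 - \<beta> / n)) ^ n)"
    using bn by (simp add: n_def ennreal_power)
  also have "\<dots> = ennreal (C * r powr (real DIM('a) - \<beta>))"
    using power_mult_powr_quotient[OF n, of "2 / (\<beta> / n - 1)" r \<beta>] bn
    by (simp add: C_def n_def ennreal_mult'[symmetric] mult.assoc del: times_divide_eq_left times_divide_eq_right)
  finally show "(\<integral>\<^sup>+x. ennreal (norm (y - x) powr - \<beta>) * indicator {x. r \<le> norm (y - x)} x \<partial>lborel)
     \<le> ennreal (C * r powr (real DIM('a) - \<beta>))" .
qed

section \<open>Slicing transversally to a hypersurface\<close>

lemma nn_integral_lborel_slice:
  fixes F :: "'a::euclidean_space \<Rightarrow> ennreal"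
  assumes [measurable]: "F \<in> borel_measurable borel" and b: "b \<in> Basis"
  shows "(\<integral>\<^sup>+x. F x \<partial>lborel) =
    (\<integral>\<^sup>+z. (\<integral>\<^sup>+t. F ((\<Sum>i\<in>Basis - {b}. z i *\<^sub>R i) + t *\<^sub>R b) \<partial>lborel) \<partial>(\<Pi>\<^sub>M i\<in>Basis - {b}. lborel))"
proof -
  interpret product_sigma_finite "\<lambda>_::'a. lborel::real measure" by standard
  have B: "Basis = insert b (Basis - {b})" using b by auto
  have [measurable]: "(\<lambda>f. \<Sum>i\<in>Basis. f i *\<^sub>R i) \<in> borel_measurable (\<Pi>\<^sub>M b\<in>(Basis::'a set). lborel::real measure)"
    by measurable
  have *: "(\<Sum>i\<in>Basis. (z(b := t)) i *\<^sub>R i) = (\<Sum>i\<in>Basis - {b}. z i *\<^sub>R i) + t *\<^sub>R b" for z :: "'a \<Rightarrow> real" and t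
  proof -
    have "(\<Sum>i\<in>Basis. (z(b := t)) i *\<^sub>R i) = t *\<^sub>R b + (\<Sum>i\<in>Basis - {b}. (z(b := t)) i *\<^sub>R i)"
      using b by (subst sum.remove[of _ b]) auto
    also have "(\<Sum>i\<in>Basis - {b}. (z(b := t)) i *\<^sub>R i) = (\<Sum>i\<in>Basis - {b}. z i *\<^sub>R i)"
      by (intro sum.cong) auto
    finally show ?thesis by simp
  qed
  have "(\<integral>\<^sup>+x. F x \<partial>lborel) = (\<integral>\<^sup>+f. F (\<Sum>i\<in>Basis. f i *\<^sub>R i) \<partial>(\<Pi>\<^sub>M b\<in>Basis. lborel))"
    by (subst lborel_eq, subst nn_integral_distr) auto
  also have "\<dots> = (\<integral>\<^sup>+f. F (\<Sum>i\<in>Basis. f i *\<^sub>R i) \<partial>(\<Pi>\<^sub>M b\<in>insert b (Basis - {b}). lborel))"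
    using B by simp
  also have "\<dots> = (\<integral>\<^sup>+z. (\<integral>\<^sup>+t. F (\<Sum>i\<in>Basis. (z(b := t)) i *\<^sub>R i) \<partial>lborel) \<partial>(\<Pi>\<^sub>M i\<in>Basis - {b}. lborel))"
    by (rule product_nn_integral_insert) (use B in auto)
  finally show ?thesis by (simp only: *)
qed

text \<open>
  On each line in direction \<open>b\<close> the weight \<open>\<bar>\<psi>\<bar>\<close> grows at least linearly away from one point \<open>\<tau>\<close> of
  the line. As \<open>W\<close> and \<open>\<rho>\<close> decrease, \<open>\<bar>\<psi>\<bar>\<close> may be replaced by \<open>c \<bar>t - \<tau>\<bar>\<close>, and \<open>\<tau>\<close> disappears by translation
  before the remaining \<open>d - 1\<close> coordinates are integrated.
\<close>

lemma layer_estimate: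
  fixes U :: "'a::euclidean_space set" and \<psi> :: "'a \<Rightarrow> real" and W \<rho> :: "real \<Rightarrow> real"
  assumes b: "b \<in> Basis" and dim: "2 \<le> DIM('a)" and c: "0 < c"
    and [measurable]: "U \<in> sets borel" "\<psi> \<in> borel_measurable borel"
    and trans: "\<And>x. \<exists>\<tau>. \<forall>t. x + t *\<^sub>R b \<in> U \<longrightarrow> c * \<bar>t - \<tau>\<bar> \<le> \<bar>\<psi> (x + t *\<^sub>R b)\<bar>"
    and W: "antimono W" "\<And>s. 0 \<le> W s" and \<rho>: "antimono \<rho>" "\<And>s. 0 \<le> \<rho> s"
    and [measurable]: "W \<in> borel_measurable borel" "\<rho> \<in> borel_measurable borel"
    and \<eta>: "0 \<le> \<eta>" "\<eta> < real DIM('a) - 1"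
  shows "(\<integral>\<^sup>+x. ennreal (W \<bar>\<psi> x\<bar> * norm (x - y) powr - \<eta>) *
             indicator {x. x \<in> U \<and> norm (x - y) < \<rho> \<bar>\<psi> x\<bar>} x \<partial>lborel)
    \<le> ennreal ((2 / (1 - \<eta> / (real DIM('a) - 1))) ^ (DIM('a) - 1) / c) *
        (\<integral>\<^sup>+t. ennreal (W \<bar>t\<bar> * \<rho> \<bar>t\<bar> powr (real DIM('a) - 1 - \<eta>)) \<partial>lborel)"
proof -
  interpret product_sigma_finite "\<lambda>_::'a. lborel::real measure" by standard
  interpret PS: pair_sigma_finite "\<Pi>\<^sub>M i\<in>Basis - {b}. (lborel::real measure)" "lborel :: real measure"
    by (intro pair_sigma_finite.intro sigma_finite) (auto simp: lborel.sigma_finite_measure_axioms)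
  define J where "J = Basis - {b}"
  define n where "n = DIM('a) - 1"
  have n: "n = card J" "0 < n" "real n = real DIM('a) - 1"
    using dim b by (auto simp: n_def J_def card_Diff_singleton of_nat_diff)
  have [simp]: "finite J" by (simp add: J_def)
  define e where "e = \<eta> / n"
  have e: "0 \<le> e" "e < 1" using \<eta> n by (auto simp: e_def field_simps)
  define H where "H z t = ennreal (W (c * \<bar>t\<bar>)) * 
      (\<Prod>i\<in>J. power_singularity e (z i - y \<bullet> i) * indicator {s. \<bar>s - y \<bullet> i\<bar> < \<rho> (c * \<bar>t\<bar>)} (z i))" for z :: "'a \<Rightarrow> real" and t
  have [measurable]: "case_prod H \<in> borel_measurable ((\<Pi>\<^sub>M i\<in>J. lborel) \<Otimes>\<^sub>M lborel)"
    unfolding H_def by measurable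
  define F where "F x = ennreal (W \<bar>\<psi> x\<bar> * norm (x - y) powr - \<eta>) * 
      indicator {x. x \<in> U \<and> norm (x - y) < \<rho> \<bar>\<psi> x\<bar>} x" for x
  have F_le: "(\<integral>\<^sup>+t. F ((\<Sum>i\<in>J. z i *\<^sub>R i) + t *\<^sub>R b) \<partial>lborel) \<le> (\<integral>\<^sup>+t. H z t \<partial>lborel)" if z: "z \<in> space (\<Pi>\<^sub>M i\<in>J. lborel)" for z
  proof -
    define x where "x = (\<Sum>i\<in>J. z i *\<^sub>R i)"
    from trans[of x] obtain \<tau> where \<tau>: "\<And>t. x + t *\<^sub>R b \<in> U \<Longrightarrow> c * \<bar>t - \<tau>\<bar> \<le> \<bar>\<psi> (x + t *\<^sub>R b)\<bar>" by blast
    have "F (x + t *\<^sub>R b) \<le> H z (t - \<tau>)" for t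
    proof (cases "x + t *\<^sub>R b \<in> U \<and> norm (x + t *\<^sub>R b - y) < \<rho> \<bar>\<psi> (x + t *\<^sub>R b)\<bar>")
      case True
      let ?r = "norm (x + t *\<^sub>R b - y)"
      have s: "c * \<bar>t - \<tau>\<bar> \<le> \<bar>\<psi> (x + t *\<^sub>R b)\<bar>" using \<tau> True by blast
      have coord: "\<bar>z i - y \<bullet> i\<bar> \<le> ?r" if i: "i \<in> J" for i
      proof -
        have "x \<bullet> i = z i" using i unfolding x_def J_def by (subst inner_sum_left_Basis[symmetric])
            (auto simp: inner_sum_left inner_Basis if_distrib sum.delta cong: if_cong)
        moreover have "b \<bullet> i = 0" using i b by (auto simp: J_def inner_Basis)
        ultimately show ?thesis 
          using Basis_le_norm[of i "x + t *\<^sub>R b - y"] i by (simp add: inner_diff_left inner_add_left J_def)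
      qed
      have "ennreal (W \<bar>\<psi> (x + t *\<^sub>R b)\<bar> * ?r powr - \<eta>) \<le> ennreal (W (c * \<bar>t - \<tau>\<bar>)) * ennreal (?r powr - \<eta>)"
        using W s by (auto simp: ennreal_mult'[symmetric] intro!: ennreal_leI mult_right_mono dest: antimonoD)
      also have "ennreal (?r powr - \<eta>) \<le> (\<Prod>i\<in>J. power_singularity e (z i - y \<bullet> i))"
        unfolding e_def n using n \<eta> coord by (intro powr_le_prod_singularity) auto
      also have "\<dots> = (\<Prod>i\<in>J. power_singularity e (z i - y \<bullet> i) * indicator {s. \<bar>s - y \<bullet> i\<bar> < \<rho> (c * \<bar>t - \<tau>\<bar>)} (z i))"
      proof (intro prod.cong refl)
        fix i assume "i \<in> J"
        then have "\<bar>z i - y \<bullet> i\<bar> < \<rho> (c * \<bar>t - \<tau>\<bar>)"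
          using coord True antimonoD[OF \<rho>(1) s] by fastforce
        then show "power_singularity e (z i - y \<bullet> i) = power_singularity e (z i - y \<bullet> i) * indicator {s. \<bar>s - y \<bullet> i\<bar> < \<rho> (c * \<bar>t - \<tau>\<bar>)} (z i)"
          by simp
      qed
      finally show ?thesis using True by (simp add: F_def H_def mult_left_mono)
    qed (auto simp: F_def)
    then have "(\<integral>\<^sup>+t. F (x + t *\<^sub>R b) \<partial>lborel) \<le> (\<integral>\<^sup>+t. H z (t - \<tau>) \<partial>lborel)"
      by (intro nn_integral_mono)
    also have "\<dots> = (\<integral>\<^sup>+t. H z t \<partial>lborel)"
      using z by (subst nn_integral_real_affine[of "H z" 1 "- \<tau>"]) (auto intro: measurable_Pair2)
    finally show ?thesis by (simp add: x_def)
  qed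
  have "(\<integral>\<^sup>+x. F x \<partial>lborel) = (\<integral>\<^sup>+z. (\<integral>\<^sup>+t. F ((\<Sum>i\<in>J. z i *\<^sub>R i) + t *\<^sub>R b) \<partial>lborel) \<partial>(\<Pi>\<^sub>M i\<in>J. lborel))"
    unfolding J_def by (rule nn_integral_lborel_slice[OF _ b]) (auto simp: F_def[abs_def])
  also have "\<dots> \<le> (\<integral>\<^sup>+z. (\<integral>\<^sup>+t. H z t \<partial>lborel) \<partial>(\<Pi>\<^sub>M i\<in>J. lborel))"
    by (intro nn_integral_mono F_le)
  also have "\<dots> = (\<integral>\<^sup>+t. (\<integral>\<^sup>+z. H z t \<partial>(\<Pi>\<^sub>M i\<in>J. lborel)) \<partial>lborel)"
    using PS.Fubini'[of H] by (simp add: J_def[symmetric])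
  also have "\<dots> \<le> (\<integral>\<^sup>+t. ennreal ((2 / (1 - e)) ^ n) * ennreal (W (c * \<bar>t\<bar>) * \<rho> (c * \<bar>t\<bar>) powr (real DIM('a) - 1 - \<eta>)) \<partial>lborel)"
  proof (rule nn_integral_mono)
    fix t :: real
    let ?r = "\<rho> (c * \<bar>t\<bar>)"
    have "(\<integral>\<^sup>+z. H z t \<partial>(\<Pi>\<^sub>M i\<in>J. lborel)) = ennreal (W (c * \<bar>t\<bar>)) * 
      (\<Prod>i\<in>J. \<integral>\<^sup>+s. power_singularity e (s - y \<bullet> i) * indicator {s. \<bar>s - y \<bullet> i\<bar> < ?r} s \<partial>lborel)"
      unfolding H_def by (subst nn_integral_cmult, measurable, subst product_nn_integral_prod) auto
    also have "\<dots> \<le> ennreal (W (c * \<bar>t\<bar>)) * (\<Prod>i\<in>J. ennreal (2 / (1 - e) * ?r powr (1 - e)))"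
      using e \<rho> by (intro mult_left_mono prod_mono_ennreal nn_integral_singularity_inner) auto
    also have "(\<Prod>i\<in>J. ennreal (2 / (1 - e) * ?r powr (1 - e))) = ennreal ((2 / (1 - e) * ?r powr (1 - e)) ^ n)"
      using e by (simp add: n ennreal_power)
    also have "(2 / (1 - e) * ?r powr (1 - e)) ^ n = (2 / (1 - e)) ^ n * ?r powr (real DIM('a) - 1 - \<eta>)"
      unfolding e_def n(3)[symmetric] by (rule power_mult_powr_quotient[OF n(2)])
    finally show "(\<integral>\<^sup>+z. H z t \<partial>(\<Pi>\<^sub>M i\<in>J. lborel)) \<le> ennreal ((2 / (1 - e)) ^ n) * ennreal (W (c * \<bar>t\<bar>) * ?r powr (real DIM('a) - 1 - \<eta>))"
      using e W(2) by (simp add: ennreal_mult'[symmetric] ac_simps)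
  qed
  also have "\<dots> = ennreal ((2 / (1 - e)) ^ n) * (\<integral>\<^sup>+t. ennreal (W (c * \<bar>t\<bar>) * \<rho> (c * \<bar>t\<bar>) powr (real DIM('a) - 1 - \<eta>)) \<partial>lborel)"
    by (rule nn_integral_cmult) measurable
  also have "(\<integral>\<^sup>+t. ennreal (W (c * \<bar>t\<bar>) * \<rho> (c * \<bar>t\<bar>) powr (real DIM('a) - 1 - \<eta>)) \<partial>lborel)
     = ennreal (1 / c) * (\<integral>\<^sup>+t. ennreal (W \<bar>t\<bar> * \<rho> \<bar>t\<bar> powr (real DIM('a) - 1 - \<eta>)) \<partial>lborel)"
    using c by (subst nn_integral_real_affine[of _ "1 / c" 0]) (auto simp: abs_mult)
  finally show ?thesis
    using c e unfolding F_def[symmetric]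
    by (simp add: n(3)[symmetric] n_def[symmetric, unfolded One_nat_def] e_def[symmetric] mult.assoc[symmetric] ennreal_mult'[symmetric])
qed

section \<open>A pointwise splitting of the Riesz potential\<close>

text \<open>
  The first term dominates where \<open>f\<close> exceeds \<open>(k / S) powr (1 / (p - 1))\<close> and the second one elsewhere.
\<close>

lemma young_threshold:
  fixes k f S p :: real
  assumes p: "1 < p" and "0 \<le> k" "0 \<le> f" and S: "0 < S"
  shows "k * f \<le> S * f powr p + k powr (p / (p - 1)) * S powr (1 - p / (p - 1))"
proof (cases "k = 0 \<or> f = 0")
  case False
  then have kf: "0 < k" "0 < f" using assms by auto
  define e where "e = 1 / (p - 1)"
  have e: "0 < e" "p / (p - 1) = 1 + e" "e * (p - 1) = 1" using p by (auto simp: e_def field_simps)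
  show ?thesis
  proof (cases "f \<le> (k / S) powr e")
    case True
    have "k * f \<le> k * (k / S) powr e" using True kf by simp
    also have "\<dots> = k powr (p / (p - 1)) * S powr (1 - p / (p - 1))"
      unfolding e(2) using kf S by (simp add: powr_add powr_divide powr_minus field_simps)
    finally show ?thesis using kf S by (smt (verit) mult_nonneg_nonneg powr_ge_zero)
  next
    case False
    have "k / S = ((k / S) powr e) powr (p - 1)" using kf S e by (simp add: powr_powr)
    also have "\<dots> \<le> f powr (p - 1)" using False p by (intro powr_mono2) auto
    finally have "k * f \<le> S * (f powr (p - 1) * f)" using kf S by (simp add: field_simps)
    also have "f powr (p - 1) * f = f powr p" using kf by (simp add: powr_diff)
    finally show ?thesis using kf S by (smt (verit) mult_nonneg_nonneg powr_ge_zero)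
  qed
qed (use assms in auto)

text \<open>
  Below the height \<open>R powr (\<zeta> - D) * r powr - \<zeta>\<close> the factor \<open>f\<close> is replaced by that height. Above it, \<open>f\<close>
  is multiplied by a power of its quotient by the height, which exceeds one. Since \<open>r < R\<close>, the
  height is at least \<open>R powr - D\<close>, and this gives the condition on \<open>f\<close>.
\<close>

lemma near_threshold:
  fixes r R f D \<gamma> \<zeta> a :: real
  assumes r: "0 < r" "r < R" and f: "0 \<le> f" and \<zeta>: "0 \<le> \<zeta>" and a: "1 \<le> a"
  shows "r powr - \<gamma> * f \<le> R powr (\<zeta> - D) * r powr - (\<gamma> + \<zeta>) + 
     r powr - (\<gamma> - \<zeta> * (a - 1)) * f powr a * R powr ((D - \<zeta>) * (a - 1)) * (if R powr - D < f then 1 else 0)"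
proof -
  define m where "m = R powr (\<zeta> - D) * r powr - \<zeta>"
  have R: "0 < R" using r by simp
  have m: "0 < m" using r by (simp add: m_def)
  show ?thesis
  proof (cases "f \<le> m")
    case True
    have "r powr - \<gamma> * f \<le> r powr - \<gamma> * m" using True by (intro mult_left_mono) auto
    also have "\<dots> = R powr (\<zeta> - D) * r powr - (\<gamma> + \<zeta>)"
      by (simp add: m_def mult.left_commute powr_add[symmetric])
    finally show ?thesis using f by (smt (verit) mult_nonneg_nonneg powr_ge_zero)
  next
    case False
    have "R powr - D = R powr (\<zeta> - D) * R powr - \<zeta>" using R by (simp add: powr_add[symmetric])
    also have "\<dots> \<le> m" unfolding m_def using r \<zeta> by (intro mult_left_mono powr_mono2') auto
    finally have gt: "R powr - D < f" using False by simp
    have "1 \<le> (f / m) powr (a - 1)" using False m a by (intro ge_one_powr_ge_zero) auto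
    then have "r powr - \<gamma> * f * 1 \<le> r powr - \<gamma> * f * (f / m) powr (a - 1)"
      using f by (intro mult_left_mono) auto
    also have "(f / m) powr (a - 1) = f powr (a - 1) * R powr ((D - \<zeta>) * (a - 1)) * r powr (\<zeta> * (a - 1))"
    proof -
      have "m powr - (a - 1) = R powr ((\<zeta> - D) * - (a - 1)) * r powr (- \<zeta> * - (a - 1))"
        using r by (simp only: m_def powr_mult powr_powr powr_ge_zero)
      also have "(\<zeta> - D) * - (a - 1) = (D - \<zeta>) * (a - 1)" by (simp add: algebra_simps)
      also have "- \<zeta> * - (a - 1) = \<zeta> * (a - 1)" by (simp add: algebra_simps)
      finally have "m powr - (a - 1) = R powr ((D - \<zeta>) * (a - 1)) * r powr (\<zeta> * (a - 1))" .
      moreover have "(f / m) powr (a - 1) = f powr (a - 1) * m powr - (a - 1)"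
        using f m by (simp only: powr_divide order_less_imp_le) (simp only: powr_minus divide_inverse)
      ultimately show ?thesis by (simp only: mult.assoc)
    qed
    also have "r powr - \<gamma> * f * (f powr (a - 1) * R powr ((D - \<zeta>) * (a - 1)) * r powr (\<zeta> * (a - 1)))
      = (r powr - \<gamma> * r powr (\<zeta> * (a - 1))) * (f powr 1 * f powr (a - 1)) * R powr ((D - \<zeta>) * (a - 1))"
      using f by simp
    also have "\<dots> = r powr - (\<gamma> - \<zeta> * (a - 1)) * f powr a * R powr ((D - \<zeta>) * (a - 1))"
      unfolding powr_add[symmetric] by simp
    finally show ?thesis using gt by (simp add: add_increasing)
  qed
qed

definition riesz_potential :: "real \<Rightarrow> ('a::euclidean_space \<Rightarrow> real) \<Rightarrow> 'a \<Rightarrow> ennreal" where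
  "riesz_potential \<gamma> f x = (\<integral>\<^sup>+y. ennreal (norm (x - y) powr - \<gamma> * f y) \<partial>lborel)"

lemma riesz_potential_measurable [measurable]:
  assumes [measurable]: "f \<in> borel_measurable borel"
  shows "riesz_potential \<gamma> f \<in> borel_measurable borel"
  unfolding riesz_potential_def[abs_def] by measurable

text \<open>
  The three kinds of contributions that add up to a multiple of \<open>R powr - (d / p - \<alpha>)\<close> are the points
  \<open>y\<close> outside the ball, where the \<open>L\<^sup>p\<close> norm of \<open>f\<close> is played against the kernel, and the points inside
  with small \<open>f y\<close>. The exponent \<open>\<zeta> < \<alpha>\<close> keeps the second kernel integrable. It lowers the singularity
  of what remains from \<open>d - \<alpha>\<close> to \<open>d - \<alpha> - \<zeta> * (a - 1)\<close>, which is to be less than \<open>d - 1\<close> so that it can be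
  integrated over a hypersurface.
\<close>

lemma riesz_potential_split:
  fixes p \<alpha> \<zeta> a :: real
  defines "d \<equiv> real DIM('a::euclidean_space)"
  assumes p: "1 < p" and \<alpha>: "\<alpha> < d / p" and \<zeta>: "0 < \<zeta>" "\<zeta> < \<alpha>" and a: "1 \<le> a"
  obtains C where "0 < C"
    "\<And>(f::'a \<Rightarrow> real) R x. \<lbrakk>f \<in> borel_measurable borel; \<And>y. 0 \<le> f y; (\<integral>\<^sup>+y. ennreal (f y powr p) \<partial>lborel) \<le> 1; 0 < R\<rbrakk> \<Longrightarrow>
      riesz_potential (d - \<alpha>) f x \<le> ennreal (C * R powr - (d / p - \<alpha>)) +
        (\<integral>\<^sup>+y. ennreal (norm (x - y) powr - (d - \<alpha> - \<zeta> * (a - 1)) * f y powr a * R powr ((d / p - \<zeta>) * (a - 1)))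
           * indicator {y. norm (x - y) < R \<and> R powr - (d / p) < f y} y \<partial>lborel)"
proof -
  define q where "q = p / (p - 1)"
  have dp: "d / p < d" using p by (simp add: d_def field_simps)
  have q: "0 < q" "q - 1 = q / p" using p by (auto simp: q_def field_simps)
  have gq: "(d - \<alpha>) * q = d + q * (d / p - \<alpha>)"
    using p unfolding q_def by (simp add: field_simps)
  have "d < (d - \<alpha>) * q" unfolding gq using q \<alpha> by simp
  then obtain C1 where C1: "0 \<le> C1" "\<And>r y::'a. 0 < r \<Longrightarrow>
      (\<integral>\<^sup>+x. ennreal (norm (y - x) powr - ((d - \<alpha>) * q)) * indicator {x. r \<le> norm (y - x)} x \<partial>lborel)
     \<le> ennreal (C1 * r powr (d - (d - \<alpha>) * q))"
    unfolding d_def by (rule nn_integral_norm_powr_outer) blast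
  have "0 \<le> d - \<alpha> + \<zeta>" "d - \<alpha> + \<zeta> < d" using dp \<alpha> \<zeta> by auto
  then obtain C2 where C2: "0 \<le> C2" "\<And>r y::'a. 0 \<le> r \<Longrightarrow>
      (\<integral>\<^sup>+x. ennreal (norm (y - x) powr - (d - \<alpha> + \<zeta>)) * indicator {x. norm (y - x) < r} x \<partial>lborel)
     \<le> ennreal (C2 * r powr (d - (d - \<alpha> + \<zeta>)))"
    unfolding d_def by (rule nn_integral_norm_powr_inner) blast
  show thesis
  proof (rule that[of "1 + C1 + C2"])
    show "0 < 1 + C1 + C2" using C1 C2 by simp
    fix f :: "'a \<Rightarrow> real" and R :: real and x :: 'a
    assume [measurable]: "f \<in> borel_measurable borel" and f: "\<And>y. 0 \<le> f y"
      and norm: "(\<integral>\<^sup>+y. ennreal (f y powr p) \<partial>lborel) \<le> 1" and R: "0 < R"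
    define S where "S = R powr - (d / p - \<alpha>)"
    have S: "0 < S" using R by (simp add: S_def)
    define B where "B y = ennreal (norm (x - y) powr - (d - \<alpha> - \<zeta> * (a - 1)) * f y powr a * R powr ((d / p - \<zeta>) * (a - 1)))
           * indicator {y. norm (x - y) < R \<and> R powr - (d / p) < f y} y" for y
    have [measurable]: "B \<in> borel_measurable borel" unfolding B_def by measurable
    let ?A1 = "\<lambda>y. ennreal (f y powr p)"
    let ?A2 = "\<lambda>y. ennreal (norm (x - y) powr - ((d - \<alpha>) * q)) * indicator {y. R \<le> norm (x - y)} y"
    let ?A3 = "\<lambda>y. ennreal (norm (x - y) powr - (d - \<alpha> + \<zeta>)) * indicator {y. norm (x - y) < R} y"
    have pw: "ennreal (norm (x - y) powr - (d - \<alpha>) * f y) \<le> 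
        ennreal S * ?A1 y + ennreal (S powr (1 - q)) * ?A2 y + ennreal (R powr (\<zeta> - d / p)) * ?A3 y + B y" for y
    proof (cases "R \<le> norm (x - y)")
      case True
      have "norm (x - y) powr - (d - \<alpha>) * f y \<le> S * f y powr p + (norm (x - y) powr - (d - \<alpha>)) powr q * S powr (1 - q)"
        unfolding q_def using f S p by (intro young_threshold) auto
      also have "(norm (x - y) powr - (d - \<alpha>)) powr q = norm (x - y) powr - ((d - \<alpha>) * q)"
        by (simp only: powr_powr minus_mult_left)
      finally have "ennreal (norm (x - y) powr - (d - \<alpha>) * f y) \<le> ennreal S * ?A1 y + ennreal (S powr (1 - q)) * ?A2 y"
        using S True by (simp add: ennreal_mult'[symmetric] ennreal_plus[symmetric] mult.commute ennreal_leI del: ennreal_plus)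
      then show ?thesis using True by (simp add: B_def)
    next
      case False
      show ?thesis
      proof (cases "x = y")
        case F: False
        have "norm (x - y) powr - (d - \<alpha>) * f y \<le> R powr (\<zeta> - d / p) * norm (x - y) powr - (d - \<alpha> + \<zeta>) + 
           norm (x - y) powr - (d - \<alpha> - \<zeta> * (a - 1)) * f y powr a * R powr ((d / p - \<zeta>) * (a - 1)) 
            * (if R powr - (d / p) < f y then 1 else 0)"
          using False F f \<zeta> a by (intro near_threshold) auto
        then have "ennreal (norm (x - y) powr - (d - \<alpha>) * f y) \<le> ennreal (R powr (\<zeta> - d / p)) * ?A3 y + B y"
          using False by (auto simp: B_def ennreal_mult'[symmetric] ennreal_plus[symmetric] ennreal_leI simp del: ennreal_plus split: if_splits)
        then show ?thesis by (simp add: add_increasing add.assoc)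
      qed simp
    qed
    have "riesz_potential (d - \<alpha>) f x \<le> 
      (\<integral>\<^sup>+y. ennreal S * ?A1 y + ennreal (S powr (1 - q)) * ?A2 y + ennreal (R powr (\<zeta> - d / p)) * ?A3 y + B y \<partial>lborel)"
      unfolding riesz_potential_def by (intro nn_integral_mono pw)
    also have "\<dots> = ennreal S * (\<integral>\<^sup>+y. ?A1 y \<partial>lborel) + ennreal (S powr (1 - q)) * (\<integral>\<^sup>+y. ?A2 y \<partial>lborel)
         + ennreal (R powr (\<zeta> - d / p)) * (\<integral>\<^sup>+y. ?A3 y \<partial>lborel) + (\<integral>\<^sup>+y. B y \<partial>lborel)"
      by (simp add: nn_integral_add nn_integral_cmult)
    also have "\<dots> \<le> ennreal S * 1 + ennreal (S powr (1 - q)) * ennreal (C1 * R powr (d - (d - \<alpha>) * q))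
         + ennreal (R powr (\<zeta> - d / p)) * ennreal (C2 * R powr (d - (d - \<alpha> + \<zeta>))) + (\<integral>\<^sup>+y. B y \<partial>lborel)"
      using R by (intro add_mono mult_left_mono norm C1 C2) auto
    also have "ennreal (S powr (1 - q)) * ennreal (C1 * R powr (d - (d - \<alpha>) * q)) = ennreal (C1 * S)"
    proof -
      have "S powr (1 - q) * R powr (d - (d - \<alpha>) * q) = R powr (- (d / p - \<alpha>) * (1 - q) + (d - (d - \<alpha>) * q))"
        by (simp only: S_def powr_powr powr_add[symmetric])
      also have "- (d / p - \<alpha>) * (1 - q) + (d - (d - \<alpha>) * q) = - (d / p - \<alpha>)"
      proof -
        have "- D * (1 - q) + (d - (d + q * D)) = - D" for D by (simp add: algebra_simps)
        then show ?thesis unfolding gq .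
      qed
      finally show ?thesis using C1(1) by (simp add: S_def ennreal_mult[symmetric] ac_simps)
    qed
    also have "ennreal (R powr (\<zeta> - d / p)) * ennreal (C2 * R powr (d - (d - \<alpha> + \<zeta>))) = ennreal (C2 * S)"
      by (simp add: S_def ennreal_mult'[symmetric] mult.left_commute[of _ C2] powr_add[symmetric])
    also have "ennreal S * 1 + ennreal (C1 * S) + ennreal (C2 * S) = ennreal ((1 + C1 + C2) * S)"
      using S C1 C2 by (simp add: ennreal_plus[symmetric] ring_distribs del: ennreal_plus)
    finally show "riesz_potential (d - \<alpha>) f x \<le> ennreal ((1 + C1 + C2) * R powr - (d / p - \<alpha>)) +
        (\<integral>\<^sup>+y. ennreal (norm (x - y) powr - (d - \<alpha> - \<zeta> * (a - 1)) * f y powr a * R powr ((d / p - \<zeta>) * (a - 1)))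
           * indicator {y. norm (x - y) < R \<and> R powr - (d / p) < f y} y \<partial>lborel)"
      by (simp add: B_def S_def)
  qed
qed

section \<open>The estimate near a transversal hypersurface\<close>

text \<open>
  The parameters are chosen as follows. The requirement that the singularity left by
  \<open>riesz_potential_split\<close> is integrable in dimension \<open>d - 1\<close> means \<open>\<zeta> * (a - 1) > 1 - \<alpha>\<close>, which is possible
  with \<open>\<zeta> < \<alpha>\<close> and \<open>a < p\<close> because \<open>\<alpha> * p > 1\<close>. The trace condition is equivalent to
  \<open>\<beta> \<le> (E + (d - 1 - \<eta>)) / \<delta>\<close>, where the right-hand side is the decay rate in the level \<open>s\<close>
  after integration over the other coordinates, and \<open>\<beta> < 1\<close> is the rate for which the integral up to the
  cut-off level is a multiple of \<open>f y powr (p - a)\<close>.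
\<close>

lemma local_estimate:
  fixes p \<alpha> :: real
  defines "d \<equiv> real DIM('a::euclidean_space)"
  assumes dim: "2 \<le> DIM('a)" and p: "1 < p" and \<alpha>: "1 / p < \<alpha>" "\<alpha> < d / p"
    and trace: "2 * d \<le> p * (d - 1 + 2 * \<alpha>)"
  obtains C D where "0 < C" "0 \<le> D"
    "\<And>(U::'a set) \<psi> b c x0 f. \<lbrakk>b \<in> Basis; 0 < c; U \<in> sets borel; U \<subseteq> ball x0 1; \<psi> \<in> borel_measurable borel;
       \<And>x. \<exists>\<tau>. \<forall>t. x + t *\<^sub>R b \<in> U \<longrightarrow> c * \<bar>t - \<tau>\<bar> \<le> \<bar>\<psi> (x + t *\<^sub>R b)\<bar>;
       f \<in> borel_measurable borel; \<And>y. 0 \<le> f y; (\<integral>\<^sup>+y. ennreal (f y powr p) \<partial>lborel) \<le> 1\<rbrakk> \<Longrightarrow>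
      (\<integral>\<^sup>+x. (riesz_potential (d - \<alpha>) f x - ennreal (C * \<bar>\<psi> x\<bar>)) * indicator U x \<partial>lborel)
      \<le> ennreal (D / c)"
proof -
  have d: "2 \<le> d" using dim by (simp add: d_def)
  have \<alpha>0: "0 < \<alpha>" using \<alpha>(1) p by (smt (verit) divide_pos_pos)
  have \<alpha>p: "1 < \<alpha> * p" "\<alpha> * p < d" using \<alpha> p by (auto simp: field_simps)
  define \<delta> where "\<delta> = d / p - \<alpha>"
  have \<delta>: "0 < \<delta>" using \<alpha> by (simp add: \<delta>_def)
  have "max 0 ((1 - \<alpha>) / (p - 1)) < \<alpha>" using \<alpha>0 \<alpha>p p by (simp add: field_simps)
  then obtain \<zeta> where \<zeta>: "0 < \<zeta>" "(1 - \<alpha>) / (p - 1) < \<zeta>" "\<zeta> < \<alpha>"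
    using dense by (metis max_less_iff_conj)
  have "1 + (1 - \<alpha>) / \<zeta> < p" using \<zeta> p by (simp add: field_simps)
  \<comment> \<open>The last two lower bounds for \<open>a\<close> ensure \<open>\<eta> < d - 1\<close> and \<open>0 \<le> \<beta>\<close>, in this order.\<close>
  then have "max 1 (max (1 + (1 - \<alpha>) / \<zeta>) (p - p * \<delta> / d)) < p" using p \<delta> d by simp
  then obtain a where a: "1 < a" "1 + (1 - \<alpha>) / \<zeta> < a" "p - p * \<delta> / d < a" "a < p"
    using dense by (metis max_less_iff_conj)
  define \<eta> where "\<eta> = d - \<alpha> - \<zeta> * (a - 1)"
  have \<eta>1: "\<eta> < d - 1" using a(2) \<zeta>(1) by (simp add: \<eta>_def field_simps)
  have "\<zeta> * (a - 1) \<le> \<alpha> * (p - 1)" using \<zeta> a \<alpha>0 by (intro mult_mono) auto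
  then have \<eta>0: "0 \<le> \<eta>" using \<alpha>p by (simp add: \<eta>_def algebra_simps)
  define \<beta> where "\<beta> = 1 - (p - a) * d / (p * \<delta>)"
  have "p - a \<le> p * \<delta> / d" using a(3) by simp
  then have "(p - a) * d \<le> p * \<delta>" using d by (simp add: pos_le_divide_eq)
  then have \<beta>: "0 \<le> \<beta>" "\<beta> < 1" using a(4) p d \<delta> by (simp_all add: \<beta>_def pos_divide_le_eq)
  define E where "E = (d / p - \<zeta>) * (a - 1)"
  have E: "0 \<le> E" using a \<zeta> \<alpha> by (simp add: E_def)
  have exponent: "\<beta> \<le> (E + (d - 1 - \<eta>)) / \<delta>"
  proof -
    have "\<beta> * \<delta> = \<delta> - (p - a) * d / p" using p \<delta> by (simp add: \<beta>_def field_simps)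
    also have "\<dots> \<le> E + (d - 1 - \<eta>)"
    proof -
      define Q where "Q = d / p"
      have "2 * Q \<le> d - 1 + 2 * \<alpha>" using trace p by (simp add: Q_def field_simps)
      moreover have "(p - a) * d / p = d - a * Q" using p by (simp add: Q_def field_simps)
      ultimately show ?thesis
        unfolding E_def \<eta>_def \<delta>_def Q_def[symmetric] by (simp add: algebra_simps)
    qed
    finally show ?thesis using \<delta> by (simp add: field_simps)
  qed
  obtain C where C: "0 < C" "\<And>(f::'a \<Rightarrow> real) R x. \<lbrakk>f \<in> borel_measurable borel; \<And>y. 0 \<le> f y; (\<integral>\<^sup>+y. ennreal (f y powr p) \<partial>lborel) \<le> 1; 0 < R\<rbrakk> \<Longrightarrow>
      riesz_potential (d - \<alpha>) f x \<le> ennreal (C * R powr - \<delta>) +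
        (\<integral>\<^sup>+y. ennreal (norm (x - y) powr - \<eta> * f y powr a * R powr E)
           * indicator {y. norm (x - y) < R \<and> R powr - (d / p) < f y} y \<partial>lborel)"
    unfolding d_def \<delta>_def \<eta>_def E_def
    by (rule riesz_potential_split[OF p \<alpha>(2)[unfolded d_def] \<zeta>(1,3) less_imp_le[OF a(1)]]) blast
  \<comment> \<open>Levels below one are treated like the level one. The error is \<open>C\<close> on the set where \<open>\<bar>\<psi>\<bar> < 1\<close>, whose
    measure is a multiple of \<open>1 / c\<close>.\<close>
  define R where "R s = max s 1 powr - (1 / \<delta>)" for s :: real
  have R: "0 < R s" "R s powr - \<delta> = max s 1" for s
    using \<delta> by (auto simp: R_def powr_powr)
  have R_anti: "antimono R" using \<delta> by (auto simp: antimono_def R_def intro!: powr_mono2')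
  define K where "K = (2 / (1 - \<eta> / (d - 1))) ^ (DIM('a) - 1)"
  have K: "0 \<le> K" using \<eta>1 d by (simp add: K_def field_simps)
  define K1 where "K1 = K * (2 / (1 - \<beta>))"
  define K0 where "K0 = C * (2 ^ (DIM('a) - 1) * 2)"
  show thesis
  proof (rule that[of C "K0 + K1"])
    show "0 < C" by fact
    show "0 \<le> K0 + K1" using K C \<beta> by (auto simp: K0_def K1_def)
    fix U :: "'a set" and \<psi> f :: "'a \<Rightarrow> real" and b x0 :: 'a and c :: real
    assume b: "b \<in> Basis" and c: "0 < c" and [measurable]: "U \<in> sets borel" and U: "U \<subseteq> ball x0 1"
      and [measurable]: "\<psi> \<in> borel_measurable borel"
      and trans: "\<And>x. \<exists>\<tau>. \<forall>t. x + t *\<^sub>R b \<in> U \<longrightarrow> c * \<bar>t - \<tau>\<bar> \<le> \<bar>\<psi> (x + t *\<^sub>R b)\<bar>"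
      and [measurable]: "f \<in> borel_measurable borel" and f: "\<And>y. 0 \<le> f y"
      and norm: "(\<integral>\<^sup>+y. ennreal (f y powr p) \<partial>lborel) \<le> 1"
    define P where "P = riesz_potential (d - \<alpha>) f"
    have [measurable]: "P \<in> borel_measurable borel" unfolding P_def by measurable
    have R_meas[measurable]: "R \<in> borel_measurable borel" unfolding R_def by measurable
    define B where "B x y = ennreal (norm (x - y) powr - \<eta> * f y powr a * R \<bar>\<psi> x\<bar> powr E)
           * indicator {y. norm (x - y) < R \<bar>\<psi> x\<bar> \<and> R \<bar>\<psi> x\<bar> powr - (d / p) < f y} y * indicator U x" for x y
    have [measurable]: "case_prod B \<in> borel_measurable (borel \<Otimes>\<^sub>M borel)"
      unfolding B_def by measurable
    have pw: "(P x - ennreal (C * \<bar>\<psi> x\<bar>)) * indicator U x \<le> ennreal C * indicator {x. x \<in> U \<and> \<bar>\<psi> x\<bar> < 1} x + (\<integral>\<^sup>+y. B x y \<partial>lborel)" for x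
    proof (cases "x \<in> U")
      case True
      have "P x \<le> ennreal (C * max \<bar>\<psi> x\<bar> 1) + (\<integral>\<^sup>+y. B x y \<partial>lborel)"
        using C(2)[of f "R \<bar>\<psi> x\<bar>" x] f norm R True by (simp add: P_def B_def)
      also have "ennreal (C * max \<bar>\<psi> x\<bar> 1) \<le> ennreal (C * \<bar>\<psi> x\<bar>) + ennreal C * indicator {x. x \<in> U \<and> \<bar>\<psi> x\<bar> < 1} x"
        using C(1) True by (auto simp: ennreal_plus[symmetric] indicator_def max_def intro!: ennreal_leI simp del: ennreal_plus)
      finally show ?thesis using True by (simp add: ennreal_minus_le_iff ac_simps)
    qed simp
    have small: "(\<integral>\<^sup>+x. indicator {x. x \<in> U \<and> \<bar>\<psi> x\<bar> < 1} x \<partial>lborel) \<le> ennreal (2 ^ (DIM('a) - 1) * 2 / c)"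
    proof -
      define W where "W s = (if s < 1 then 1 else 0 :: real)" for s :: real
      have "(\<integral>\<^sup>+x. indicator {x. x \<in> U \<and> \<bar>\<psi> x\<bar> < 1} x \<partial>lborel) \<le>
         (\<integral>\<^sup>+x. ennreal (W \<bar>\<psi> x\<bar> * norm (x - x0) powr - 0) * indicator {x. x \<in> U \<and> norm (x - x0) < 1} x \<partial>lborel)"
        by (rule nn_integral_mono_AE, rule AE_mp[OF AE_lborel_singleton[of x0]], rule AE_I2)
          (use U in \<open>auto simp: W_def indicator_def dist_norm norm_minus_commute subset_eq\<close>)
      also have "\<dots> \<le> ennreal ((2 / (1 - 0 / (real DIM('a) - 1))) ^ (DIM('a) - 1) / c) *
        (\<integral>\<^sup>+t. ennreal (W \<bar>t\<bar> * 1 powr (real DIM('a) - 1 - 0)) \<partial>lborel)"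
        using dim by (intro layer_estimate[OF b dim c _ _ trans]) (auto simp: W_def[abs_def] antimono_def)
      also have "(\<integral>\<^sup>+t. ennreal (W \<bar>t\<bar> * 1 powr (real DIM('a) - 1 - 0)) \<partial>lborel) = (\<integral>\<^sup>+t. indicator {-1<..<1::real} t \<partial>lborel)"
        by (intro nn_integral_cong) (auto simp: W_def indicator_def)
      also have "\<dots> = ennreal 2" by simp
      finally show ?thesis using c by (simp add: ennreal_mult'[symmetric] ac_simps del: ennreal_numeral)
    qed
    have large: "(\<integral>\<^sup>+x. B x y \<partial>lborel) \<le> ennreal (K1 / c) * ennreal (f y powr p)" for y
    proof -
      define W where "W s = R s powr E * (if R s powr - (d / p) < f y then 1 else 0)" for s
      have W_anti: "antimono W"
      proof (rule antimonoI)
        fix s t :: real assume "s \<le> t"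
        then have le: "R t \<le> R s" using R_anti by (auto dest: antimonoD)
        then have "R t powr E \<le> R s powr E"
          using E R(1)[of t] by (intro powr_mono2) auto
        moreover have "R s powr - (d / p) \<le> R t powr - (d / p)"
          using le R(1)[of t] d p by (intro powr_mono2') auto
        ultimately show "W t \<le> W s" by (auto simp: W_def)
      qed
      have "(\<integral>\<^sup>+x. B x y \<partial>lborel) = (\<integral>\<^sup>+x. ennreal (f y powr a) * (ennreal (W \<bar>\<psi> x\<bar> * norm (x - y) powr - \<eta>) *
             indicator {x. x \<in> U \<and> norm (x - y) < R \<bar>\<psi> x\<bar>} x) \<partial>lborel)"
        by (intro nn_integral_cong) (auto simp: B_def W_def ennreal_mult'[symmetric] ac_simps split: split_indicator)
      also have "\<dots> = ennreal (f y powr a) * (\<integral>\<^sup>+x. (ennreal (W \<bar>\<psi> x\<bar> * norm (x - y) powr - \<eta>) *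
             indicator {x. x \<in> U \<and> norm (x - y) < R \<bar>\<psi> x\<bar>} x) \<partial>lborel)"
        unfolding W_def by (intro nn_integral_cmult) measurable
      also have "(\<integral>\<^sup>+x. (ennreal (W \<bar>\<psi> x\<bar> * norm (x - y) powr - \<eta>) *
             indicator {x. x \<in> U \<and> norm (x - y) < R \<bar>\<psi> x\<bar>} x) \<partial>lborel) \<le> ennreal (K / c) *
        (\<integral>\<^sup>+t. ennreal (W \<bar>t\<bar> * R \<bar>t\<bar> powr (d - 1 - \<eta>)) \<partial>lborel)"
        unfolding K_def d_def using \<eta>0 \<eta>1 less_imp_le[OF R(1)] W_anti R_anti
        by (intro layer_estimate[OF b dim c _ _ trans]) (auto simp: W_def[abs_def] d_def)
      also have "(\<integral>\<^sup>+t. ennreal (W \<bar>t\<bar> * R \<bar>t\<bar> powr (d - 1 - \<eta>)) \<partial>lborel) \<le> ennreal (2 / (1 - \<beta>) * f y powr (p - a))"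
      proof -
        \<comment> \<open>If \<open>\<sigma> \<ge> 1\<close>, then \<open>\<sigma>\<close> is the level at which \<open>R \<sigma> powr - (d / p)\<close> reaches \<open>f y\<close>.\<close>
        define \<sigma> where "\<sigma> = f y powr (p * \<delta> / d)"
        have profile: "W \<bar>t\<bar> * R \<bar>t\<bar> powr (d - 1 - \<eta>) \<le> (if \<bar>t\<bar> < \<sigma> then \<bar>t\<bar> powr - \<beta> else 0)" if t: "t \<noteq> 0" for t
        proof (cases "R \<bar>t\<bar> powr - (d / p) < f y")
          case True
          let ?s = "max \<bar>t\<bar> 1"
          have "?s powr (1 / \<delta> * (d / p)) < f y" using True by (simp add: R_def powr_powr)
          then have "(?s powr (1 / \<delta> * (d / p))) powr (p * \<delta> / d) < \<sigma>"
            unfolding \<sigma>_def using \<delta> d p by (intro powr_less_mono2) auto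
          then have "?s < \<sigma>" using \<delta> d p by (simp add: powr_powr)
          then have lt: "\<bar>t\<bar> < \<sigma>" by simp
          have "R \<bar>t\<bar> powr E * R \<bar>t\<bar> powr (d - 1 - \<eta>) = ?s powr - ((E + (d - 1 - \<eta>)) / \<delta>)"
            by (simp add: R_def powr_powr powr_add[symmetric] add_divide_distrib diff_divide_distrib)
          also have "\<dots> \<le> ?s powr - \<beta>" using exponent by (intro powr_mono) auto
          also have "\<dots> \<le> \<bar>t\<bar> powr - \<beta>" using \<beta> t by (intro powr_mono2') auto
          finally show ?thesis using lt True by (simp add: W_def)
        qed (simp add: W_def)
        have pw: "ennreal (W \<bar>t\<bar> * R \<bar>t\<bar> powr (d - 1 - \<eta>)) \<le> power_singularity \<beta> (t - 0) * indicator {t. \<bar>t - 0\<bar> < \<sigma>} t"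
          if "t \<noteq> 0" for t
          using ennreal_leI[OF profile[OF that]] that by (cases "\<bar>t\<bar> < \<sigma>") (simp_all add: power_singularity_def)
        have "AE t in lborel. ennreal (W \<bar>t\<bar> * R \<bar>t\<bar> powr (d - 1 - \<eta>)) \<le> power_singularity \<beta> (t - 0) * indicator {t. \<bar>t - 0\<bar> < \<sigma>} t"
          by (rule AE_mp[OF AE_lborel_singleton[of 0]], rule AE_I2) (use pw in blast)
        then have "(\<integral>\<^sup>+t. ennreal (W \<bar>t\<bar> * R \<bar>t\<bar> powr (d - 1 - \<eta>)) \<partial>lborel) \<le>
          (\<integral>\<^sup>+t. power_singularity \<beta> (t - 0) * indicator {t. \<bar>t - 0\<bar> < \<sigma>} t \<partial>lborel)"
          by (rule nn_integral_mono_AE)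
        also have "\<dots> \<le> ennreal (2 / (1 - \<beta>) * \<sigma> powr (1 - \<beta>))"
          using \<beta> by (intro nn_integral_singularity_inner) (auto simp: \<sigma>_def)
        also have "\<sigma> powr (1 - \<beta>) = f y powr (p - a)"
          using \<delta> d p by (simp add: \<sigma>_def \<beta>_def powr_powr)
        finally show ?thesis .
      qed
      finally have "(\<integral>\<^sup>+x. B x y \<partial>lborel) \<le> ennreal (f y powr a) * (ennreal (K / c) * ennreal (2 / (1 - \<beta>) * f y powr (p - a)))"
        by (simp add: mult_left_mono)
      also have "\<dots> = ennreal (K1 / c) * ennreal (f y powr a * f y powr (p - a))"
        using K c \<beta> by (simp add: K1_def ennreal_mult'[symmetric] ac_simps)
      also have "f y powr a * f y powr (p - a) = f y powr p" by (simp add: powr_add[symmetric])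
      finally show ?thesis .
    qed
    have "(\<integral>\<^sup>+x. (P x - ennreal (C * \<bar>\<psi> x\<bar>)) * indicator U x \<partial>lborel) \<le>
       (\<integral>\<^sup>+x. ennreal C * indicator {x. x \<in> U \<and> \<bar>\<psi> x\<bar> < 1} x + (\<integral>\<^sup>+y. B x y \<partial>lborel) \<partial>lborel)"
      by (intro nn_integral_mono pw)
    also have "\<dots> = ennreal C * (\<integral>\<^sup>+x. indicator {x. x \<in> U \<and> \<bar>\<psi> x\<bar> < 1} x \<partial>lborel) + (\<integral>\<^sup>+x. (\<integral>\<^sup>+y. B x y \<partial>lborel) \<partial>lborel)"
      by (subst nn_integral_add, measurable, subst nn_integral_cmult) auto
    also have "(\<integral>\<^sup>+x. (\<integral>\<^sup>+y. B x y \<partial>lborel) \<partial>lborel) = (\<integral>\<^sup>+y. (\<integral>\<^sup>+x. B x y \<partial>lborel) \<partial>lborel)"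
      by (rule lborel_pair.Fubini'[symmetric]) measurable
    also have "\<dots> \<le> (\<integral>\<^sup>+y. ennreal (K1 / c) * ennreal (f y powr p) \<partial>lborel)"
      by (intro nn_integral_mono large)
    also have "\<dots> = ennreal (K1 / c) * (\<integral>\<^sup>+y. ennreal (f y powr p) \<partial>lborel)"
      by (intro nn_integral_cmult) measurable
    also have "\<dots> \<le> ennreal (K1 / c) * 1" by (intro mult_left_mono norm) auto
    also have "ennreal C * (\<integral>\<^sup>+x. indicator {x. x \<in> U \<and> \<bar>\<psi> x\<bar> < 1} x \<partial>lborel) \<le> ennreal C * ennreal (2 ^ (DIM('a) - 1) * 2 / c)"
      by (intro mult_left_mono small) auto
    also have "\<dots> = ennreal (K0 / c)" using C c by (simp add: K0_def ennreal_mult'[symmetric])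
    also have "ennreal (K0 / c) + ennreal (K1 / c) * 1 = ennreal ((K0 + K1) / c)"
      using K C c \<beta> by (simp add: K0_def K1_def add_divide_distrib ennreal_plus[symmetric] del: ennreal_plus)
    finally show "(\<integral>\<^sup>+x. (riesz_potential (d - \<alpha>) f x - ennreal (C * \<bar>\<psi> x\<bar>)) * indicator U x \<partial>lborel)
      \<le> ennreal ((K0 + K1) / c)"
      by (simp add: P_def add_right_mono)
  qed
qed

section \<open>The weighted estimate on a bounded set\<close>

text \<open>
  The point \<open>\<tau>\<close> minimises \<open>\<bar>\<psi>\<bar>\<close> on the part of the line inside the closed ball. The triangle inequality
  then costs a factor of two.
\<close>

lemma slab_nearest_point:
  fixes \<psi> :: "'a::euclidean_space \<Rightarrow> real"
  assumes b: "b \<in> Basis" and cont: "continuous_on UNIV \<psi>"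
    and slope: "\<And>x s t. \<lbrakk>x + s *\<^sub>R b \<in> cball x0 r; x + t *\<^sub>R b \<in> cball x0 r; s < t\<rbrakk> \<Longrightarrow> c * (t - s) \<le> \<bar>\<psi> (x + t *\<^sub>R b) - \<psi> (x + s *\<^sub>R b)\<bar>"
  shows "\<exists>\<tau>. \<forall>t. x + t *\<^sub>R b \<in> ball x0 r \<longrightarrow> c / 2 * \<bar>t - \<tau>\<bar> \<le> \<bar>\<psi> (x + t *\<^sub>R b)\<bar>"
proof -
  define T where "T = {t. x + t *\<^sub>R b \<in> cball x0 r}"
  show ?thesis
  proof (cases "T = {}")
    case True
    then show ?thesis using ball_subset_cball[of x0 r] unfolding T_def by blast
  next
    case False
    have "closed T"
    proof -
      have "closed ((\<lambda>t. x + t *\<^sub>R b) -` cball x0 r)" by (intro closed_vimage closed_cball continuous_intros)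
      then show ?thesis by (simp add: T_def vimage_def)
    qed
    moreover have "bounded T"
    proof (rule boundedI)
      fix t assume "t \<in> T"
      then have "norm (x + t *\<^sub>R b - x0) \<le> r" by (simp add: T_def dist_norm norm_minus_commute)
      moreover have "\<bar>t\<bar> = norm (t *\<^sub>R b)" using b by simp
      moreover have "norm (t *\<^sub>R b) \<le> norm (x + t *\<^sub>R b - x0) + norm (x0 - x)"
        using norm_triangle_ineq[of "x + t *\<^sub>R b - x0" "x0 - x"] by simp
      ultimately show "norm t \<le> r + norm (x0 - x)" unfolding real_norm_def by linarith
    qed
    ultimately have "compact T" by (simp add: compact_eq_bounded_closed)
    moreover have "continuous_on T (\<lambda>t. \<bar>\<psi> (x + t *\<^sub>R b)\<bar>)"
      by (intro continuous_intros continuous_on_compose2[OF cont]) auto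
    ultimately obtain \<tau> where \<tau>: "\<tau> \<in> T" "\<And>t. t \<in> T \<Longrightarrow> \<bar>\<psi> (x + \<tau> *\<^sub>R b)\<bar> \<le> \<bar>\<psi> (x + t *\<^sub>R b)\<bar>"
      using continuous_attains_inf[of T "\<lambda>t. \<bar>\<psi> (x + t *\<^sub>R b)\<bar>"] False by blast
    have "c / 2 * \<bar>t - \<tau>\<bar> \<le> \<bar>\<psi> (x + t *\<^sub>R b)\<bar>" if "x + t *\<^sub>R b \<in> ball x0 r" for t
    proof -
      have t: "t \<in> T" using that by (simp add: T_def)
      have "c * \<bar>t - \<tau>\<bar> \<le> \<bar>\<psi> (x + t *\<^sub>R b) - \<psi> (x + \<tau> *\<^sub>R b)\<bar>"
        using slope[of x t \<tau>] slope[of x \<tau> t] t \<tau>(1) unfolding T_def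
        by (cases t \<tau> rule: linorder_cases) (auto simp: abs_minus_commute)
      then show ?thesis using \<tau>(2)[OF t] by simp
    qed
    then show ?thesis by blast
  qed
qed

lemma GDERIV_imp_continuous_on:
  assumes "\<And>x. GDERIV \<phi> x :> D x" shows "continuous_on UNIV \<phi>"
  using assms by (auto simp: continuous_on_eq_continuous_at gderiv_def intro: has_derivative_continuous)

text \<open>
  Near a zero of \<open>\<phi>\<close> the function \<open>\<psi>\<close> is \<open>\<phi>\<close> itself, and \<open>b\<close> is a coordinate direction in which the
  gradient does not vanish. Near any other point \<open>\<psi>\<close> is a small multiple of a coordinate.
\<close>

lemma local_transversal_function:
  fixes \<phi> :: "'a::euclidean_space \<Rightarrow> real" and grad\<phi> :: "'a \<Rightarrow> 'a"
  assumes grad: "\<And>x. GDERIV \<phi> x :> grad\<phi> x" and cont: "continuous_on UNIV grad\<phi>"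
    and nondeg: "\<phi> x0 = 0 \<Longrightarrow> grad\<phi> x0 \<noteq> 0"
  obtains r \<psi> b c where "0 < r" "r < 1" "b \<in> Basis" "0 < c" "continuous_on UNIV \<psi>"
    "\<And>x. x \<in> ball x0 r \<Longrightarrow> \<bar>\<psi> x\<bar> \<le> \<bar>\<phi> x\<bar>"
    "\<And>x. \<exists>\<tau>. \<forall>t. x + t *\<^sub>R b \<in> ball x0 r \<longrightarrow> c * \<bar>t - \<tau>\<bar> \<le> \<bar>\<psi> (x + t *\<^sub>R b)\<bar>"
proof -
  have \<phi>_cont: "continuous_on UNIV \<phi>" using grad by (rule GDERIV_imp_continuous_on)
  show ?thesis
  proof (cases "\<phi> x0 = 0")
    case False
    define e where "e = \<bar>\<phi> x0\<bar> / 2"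
    have e: "0 < e" using False by (simp add: e_def)
    have "isCont \<phi> x0" using \<phi>_cont by (simp add: continuous_on_eq_continuous_at)
    then obtain \<delta> where \<delta>: "0 < \<delta>" "\<And>x. dist x x0 < \<delta> \<Longrightarrow> dist (\<phi> x) (\<phi> x0) < e"
      using e unfolding continuous_at_eps_delta by blast
    obtain b :: 'a where b: "b \<in> Basis" using nonempty_Basis by blast
    define r where "r = min \<delta> (1 / 2)"
    define \<psi> where "\<psi> x = e * ((x - x0) \<bullet> b)" for x
    have cont_\<psi>: "continuous_on UNIV \<psi>" unfolding \<psi>_def by (intro continuous_intros)
    show ?thesis
    proof (rule that[of r b "e / 2" \<psi>])
      show "0 < r" "r < 1" "0 < e / 2" using \<delta> e by (auto simp: r_def)
      show "b \<in> Basis" "continuous_on UNIV \<psi>" by fact+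
      fix x assume x: "x \<in> ball x0 r"
      have "\<bar>(x - x0) \<bullet> b\<bar> \<le> norm (x - x0)" using b by (rule Basis_le_norm)
      also have "\<dots> \<le> 1" using x by (simp add: dist_norm norm_minus_commute r_def)
      finally have "\<bar>\<psi> x\<bar> \<le> e" using e by (simp add: \<psi>_def abs_mult)
      moreover have "dist (\<phi> x) (\<phi> x0) < e" using x by (intro \<delta>) (simp add: dist_commute r_def)
      then have "e \<le> \<bar>\<phi> x\<bar>" unfolding e_def dist_real_def by linarith
      ultimately show "\<bar>\<psi> x\<bar> \<le> \<bar>\<phi> x\<bar>" by linarith
    next
      fix x
      show "\<exists>\<tau>. \<forall>t. x + t *\<^sub>R b \<in> ball x0 r \<longrightarrow> e / 2 * \<bar>t - \<tau>\<bar> \<le> \<bar>\<psi> (x + t *\<^sub>R b)\<bar>"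
      proof (rule slab_nearest_point[OF b cont_\<psi>])
        fix x :: 'a and s t :: real assume "s < t"
        have "\<psi> (x + t *\<^sub>R b) - \<psi> (x + s *\<^sub>R b) = e * (t - s)"
          using b by (simp add: \<psi>_def inner_diff_left inner_add_left algebra_simps)
        then show "e * (t - s) \<le> \<bar>\<psi> (x + t *\<^sub>R b) - \<psi> (x + s *\<^sub>R b)\<bar>" by simp
      qed
    qed
  next
    case True
    then obtain b where b: "b \<in> Basis" "grad\<phi> x0 \<bullet> b \<noteq> 0"
      using nondeg euclidean_all_zero_iff[of "grad\<phi> x0"] by blast
    define e where "e = \<bar>grad\<phi> x0 \<bullet> b\<bar> / 2"
    have e: "0 < e" using b by (simp add: e_def)
    have "continuous_on UNIV (\<lambda>x. grad\<phi> x \<bullet> b)" by (intro continuous_intros cont)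
    then have "isCont (\<lambda>x. grad\<phi> x \<bullet> b) x0" by (simp add: continuous_on_eq_continuous_at)
    then obtain \<delta> where \<delta>: "0 < \<delta>" "\<And>x. dist x x0 < \<delta> \<Longrightarrow> dist (grad\<phi> x \<bullet> b) (grad\<phi> x0 \<bullet> b) < e"
      using e unfolding continuous_at_eps_delta by blast
    define r where "r = min (\<delta> / 2) (1 / 2)"
    show ?thesis
    proof (rule that[of r b "e / 2" \<phi>])
      show "0 < r" "r < 1" "0 < e / 2" using \<delta> e by (auto simp: r_def)
      show "b \<in> Basis" "continuous_on UNIV \<phi>" by fact+
      fix x
      show "\<exists>\<tau>. \<forall>t. x + t *\<^sub>R b \<in> ball x0 r \<longrightarrow> e / 2 * \<bar>t - \<tau>\<bar> \<le> \<bar>\<phi> (x + t *\<^sub>R b)\<bar>"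
      proof (rule slab_nearest_point[OF b(1) \<phi>_cont])
        fix x :: 'a and s t :: real
        assume s: "x + s *\<^sub>R b \<in> cball x0 r" and t: "x + t *\<^sub>R b \<in> cball x0 r" and "s < t"
        have "((\<lambda>u. \<phi> (x + u *\<^sub>R b)) has_real_derivative (grad\<phi> (x + u *\<^sub>R b) \<bullet> b)) (at u)" for u
        proof -
          have 1: "((\<lambda>u. x + u *\<^sub>R b) has_derivative (\<lambda>h. h *\<^sub>R b)) (at u)"
            by (auto intro!: derivative_eq_intros)
          have "(\<phi> has_derivative (\<lambda>h. h \<bullet> grad\<phi> (x + u *\<^sub>R b))) (at (x + u *\<^sub>R b))"
            using grad by (simp add: gderiv_def)
          from has_derivative_compose[OF 1 this] show ?thesis
            unfolding has_field_derivative_def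
            by (rule has_derivative_eq_rhs) (simp add: fun_eq_iff inner_commute)
        qed
        from MVT2[OF \<open>s < t\<close> this] obtain u where u: "s < u" "u < t"
          "\<phi> (x + t *\<^sub>R b) - \<phi> (x + s *\<^sub>R b) = (t - s) * (grad\<phi> (x + u *\<^sub>R b) \<bullet> b)" by blast
        define l where "l = (u - s) / (t - s)"
        have "u - s = l * (t - s)" using \<open>s < t\<close> by (simp add: l_def)
        then have "u = s + l * (t - s)" by simp
        then have "u = (1 - l) * s + l * t" by (simp add: algebra_simps)
        moreover have "0 \<le> l" "l \<le> 1" using u(1,2) by (simp_all add: l_def)
        ultimately have l: "0 \<le> l" "l \<le> 1" "u = (1 - l) * s + l * t" by blast+
        have "(1 - l) *\<^sub>R (x + s *\<^sub>R b) + l *\<^sub>R (x + t *\<^sub>R b) \<in> cball x0 r"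
          using convexD_alt[OF convex_cball s t l(1,2)] .
        moreover have "(1 - l) *\<^sub>R (x + s *\<^sub>R b) + l *\<^sub>R (x + t *\<^sub>R b) = x + u *\<^sub>R b"
          unfolding l(3) by (simp add: algebra_simps)
        ultimately have "dist (x + u *\<^sub>R b) x0 < \<delta>" using \<delta>(1) by (auto simp: r_def dist_commute)
        from \<delta>(2)[OF this] have "e \<le> \<bar>grad\<phi> (x + u *\<^sub>R b) \<bullet> b\<bar>" unfolding e_def dist_real_def by linarith
        then have "(t - s) * e \<le> (t - s) * \<bar>grad\<phi> (x + u *\<^sub>R b) \<bullet> b\<bar>" using \<open>s < t\<close> by (intro mult_left_mono) auto
        then show "e * (t - s) \<le> \<bar>\<phi> (x + t *\<^sub>R b) - \<phi> (x + s *\<^sub>R b)\<bar>"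
          unfolding u(3) abs_mult using \<open>s < t\<close> by (simp add: mult.commute)
      qed
    qed auto
  qed
qed

text \<open>
  Minimise over \<open>l\<close>. Enlarging both coefficients slightly makes the minimum attained when one of them is
  zero.
\<close>

lemma ennreal_le_geometric_mean:
  fixes X :: ennreal
  assumes ab: "0 \<le> a" "0 \<le> b" and le: "\<And>l. 0 < l \<Longrightarrow> X \<le> ennreal (l * a + b / l)"
  shows "X \<le> ennreal (2 * sqrt (a * b))"
proof -
  have "X \<le> ennreal (2 * sqrt ((a + 1 / Suc n) * (b + 1 / Suc n)))" for n
  proof -
    define A B where "A = a + 1 / Suc n" and "B = b + 1 / Suc n"
    have AB: "0 < A" "0 < B" "a \<le> A" "b \<le> B" using ab by (auto simp: A_def B_def add_nonneg_pos)
    define l where "l = sqrt B / sqrt A"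
    have l: "0 < l" using AB by (simp add: l_def)
    have "l * a + b / l \<le> l * A + B / l" using AB l by (intro add_mono mult_left_mono divide_right_mono) auto
    also have "l * A = sqrt (A * B)"
    proof -
      have "l * A = sqrt B * (A / sqrt A)" by (simp add: l_def)
      then show ?thesis using AB by (simp add: real_div_sqrt real_sqrt_mult)
    qed
    also have "B / l = sqrt (A * B)"
    proof -
      have "B / l = (B / sqrt B) * sqrt A" by (simp add: l_def)
      then show ?thesis using AB by (simp add: real_div_sqrt real_sqrt_mult)
    qed
    finally have "ennreal (l * a + b / l) \<le> ennreal (2 * sqrt (A * B))" by (intro ennreal_leI) simp
    then show ?thesis unfolding A_def B_def using le[OF l] by (rule order_trans[rotated])
  qed
  moreover have "(\<lambda>n. ennreal (2 * sqrt ((a + 1 / Suc n) * (b + 1 / Suc n)))) \<longlonglongrightarrow> ennreal (2 * sqrt ((a + 0) * (b + 0)))"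
    by (intro tendsto_ennrealI tendsto_intros LIMSEQ_Suc lim_1_over_n)
  ultimately show ?thesis using LIMSEQ_le_const by fastforce
qed

text \<open>
  The local estimate is applied to \<open>l / C\<close> times the function \<open>\<psi>\<close> of each ball of a finite cover. Scaling
  \<open>\<psi>\<close> scales its slope \<open>c\<close>, hence the bound \<open>D / c\<close> turns into a multiple of \<open>1 / l\<close>.
\<close>

lemma weighted_potential_estimate:
  fixes \<Omega> :: "'a::euclidean_space set" and \<phi> :: "'a \<Rightarrow> real" and grad\<phi> :: "'a \<Rightarrow> 'a" and \<alpha> p :: real
  defines "d \<equiv> real DIM('a)"
  assumes \<Omega>: "bounded \<Omega>" and grad: "\<And>x. GDERIV \<phi> x :> grad\<phi> x" and cont: "continuous_on UNIV grad\<phi>"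
    and nondeg: "\<And>x. x \<in> closure \<Omega> \<Longrightarrow> \<phi> x = 0 \<Longrightarrow> grad\<phi> x \<noteq> 0"
    and dim: "2 \<le> DIM('a)" and p: "1 < p" and \<alpha>: "1 / p < \<alpha>" "\<alpha> < d / p"
    and trace: "2 * d \<le> p * (d - 1 + 2 * \<alpha>)"
  obtains K where "0 < K"
    "\<And>f V M A. \<lbrakk>f \<in> borel_measurable borel; \<And>y. 0 \<le> f y; (\<integral>\<^sup>+y. ennreal (f y powr p) \<partial>lborel) \<le> 1;
       V \<in> borel_measurable borel; \<And>x. 0 \<le> V x; \<And>x. V x \<le> M; \<And>x. x \<notin> \<Omega> \<Longrightarrow> V x = 0;
       0 \<le> A; (\<integral>\<^sup>+x. ennreal (V x * \<bar>\<phi> x\<bar>) \<partial>lborel) = ennreal A\<rbrakk> \<Longrightarrow>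
     (\<integral>\<^sup>+x. ennreal (V x) * riesz_potential (d - \<alpha>) f x \<partial>lborel)
       \<le> ennreal (K * sqrt (M * A))"
proof -
  obtain C D where C: "0 < C" and D: "0 \<le> D" and local:
    "\<And>(U::'a set) \<psi> b c x0 f. \<lbrakk>b \<in> Basis; 0 < c; U \<in> sets borel; U \<subseteq> ball x0 1; \<psi> \<in> borel_measurable borel;
       \<And>x. \<exists>\<tau>. \<forall>t. x + t *\<^sub>R b \<in> U \<longrightarrow> c * \<bar>t - \<tau>\<bar> \<le> \<bar>\<psi> (x + t *\<^sub>R b)\<bar>;
       f \<in> borel_measurable borel; \<And>y. 0 \<le> f y; (\<integral>\<^sup>+y. ennreal (f y powr p) \<partial>lborel) \<le> 1\<rbrakk> \<Longrightarrow>
      (\<integral>\<^sup>+x. (riesz_potential (d - \<alpha>) f x - ennreal (C * \<bar>\<psi> x\<bar>)) * indicator U x \<partial>lborel)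
      \<le> ennreal (D / c)"
    unfolding d_def
    by (rule local_estimate[OF dim p \<alpha>[unfolded d_def] trace[unfolded d_def]]) blast
  define good where "good x0 r \<psi> b c \<longleftrightarrow> 0 < r \<and> r < 1 \<and> b \<in> Basis \<and> 0 < c \<and> continuous_on UNIV \<psi> \<and>
      (\<forall>x\<in>ball x0 r. \<bar>\<psi> x\<bar> \<le> \<bar>\<phi> x\<bar>) \<and>
      (\<forall>x. \<exists>\<tau>. \<forall>t. x + t *\<^sub>R b \<in> ball x0 r \<longrightarrow> c * \<bar>t - \<tau>\<bar> \<le> \<bar>\<psi> (x + t *\<^sub>R b)\<bar>)"
    for x0 :: 'a and r :: real and \<psi> :: "'a \<Rightarrow> real" and b :: 'a and c :: real
  have "\<exists>r \<psi> b c. good x0 r \<psi> b c" if "x0 \<in> closure \<Omega>" for x0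
  proof -
    show ?thesis
    proof (rule local_transversal_function[OF grad cont nondeg[OF that]])
      fix r \<psi> b c
      assume "0 < r" "r < 1" "b \<in> Basis" "0 < c" "continuous_on UNIV \<psi>"
        and le: "\<And>x. x \<in> ball x0 r \<Longrightarrow> \<bar>\<psi> x\<bar> \<le> \<bar>\<phi> x\<bar>"
        and tr: "\<And>x. \<exists>\<tau>. \<forall>t. x + t *\<^sub>R b \<in> ball x0 r \<longrightarrow> c * \<bar>t - \<tau>\<bar> \<le> \<bar>\<psi> (x + t *\<^sub>R b)\<bar>"
      then have "good x0 r \<psi> b c" unfolding good_def by (intro conjI ballI allI le tr)
      then show ?thesis by blast
    qed
  qed
  then obtain r \<psi> b c where good: "\<And>x0. x0 \<in> closure \<Omega> \<Longrightarrow> good x0 (r x0) (\<psi> x0) (b x0) (c x0)"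
    by metis
  have r: "0 < r x0" "r x0 < 1" and b: "b x0 \<in> Basis" and c: "0 < c x0" and \<psi>: "continuous_on UNIV (\<psi> x0)"
    and \<psi>_le: "\<And>x. x \<in> ball x0 (r x0) \<Longrightarrow> \<bar>\<psi> x0 x\<bar> \<le> \<bar>\<phi> x\<bar>"
    and trans: "\<And>x. \<exists>\<tau>. \<forall>t. x + t *\<^sub>R b x0 \<in> ball x0 (r x0) \<longrightarrow> c x0 * \<bar>t - \<tau>\<bar> \<le> \<bar>\<psi> x0 (x + t *\<^sub>R b x0)\<bar>"
    if "x0 \<in> closure \<Omega>" for x0
    using good[OF that] unfolding good_def by blast+
  have "compact (closure \<Omega>)" using \<Omega> by (simp add: compact_closure)
  then obtain F where F: "F \<subseteq> closure \<Omega>" "finite F" "closure \<Omega> \<subseteq> (\<Union>x0\<in>F. ball x0 (r x0))"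
    by (rule compactE_image[where C="closure \<Omega>" and f="\<lambda>x0. ball x0 (r x0)"]) (use r in auto)
  define S where "S = (\<Sum>x0\<in>F. D * C / c x0)"
  define n where "n = real (card F)"
  have S: "0 \<le> S" unfolding S_def using F(1) c C D by (intro sum_nonneg divide_nonneg_pos) auto
  define K where "K = 2 * sqrt (n * S) + 1"
  have "0 < K" using S by (simp add: K_def n_def add_nonneg_pos)
  then show thesis
  proof (rule that)
    fix f V :: "'a \<Rightarrow> real" and M A :: real
    assume [measurable]: "f \<in> borel_measurable borel" and f: "\<And>y. 0 \<le> f y" "(\<integral>\<^sup>+y. ennreal (f y powr p) \<partial>lborel) \<le> 1"
      and [measurable]: "V \<in> borel_measurable borel" and V: "\<And>x. 0 \<le> V x" "\<And>x. V x \<le> M" "\<And>x. x \<notin> \<Omega> \<Longrightarrow> V x = 0"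
      and A: "0 \<le> A" "(\<integral>\<^sup>+x. ennreal (V x * \<bar>\<phi> x\<bar>) \<partial>lborel) = ennreal A"
    define P where "P = riesz_potential (d - \<alpha>) f"
    have [measurable]: "P \<in> borel_measurable borel" unfolding P_def by measurable
    have M: "0 \<le> M" using V(1,2)[of undefined] by linarith
    have bound: "(\<integral>\<^sup>+x. ennreal (V x) * P x \<partial>lborel) \<le> ennreal (l * (n * A) + (M * S) / l)" if l: "0 < l" for l
    proof -
      have piece: "(\<integral>\<^sup>+x. ennreal (V x) * P x * indicator (ball x0 (r x0)) x \<partial>lborel) \<le> ennreal (l * A + M * (D * C / c x0) / l)"
        if x0: "x0 \<in> F" for x0
      proof -
        note x0' = subsetD[OF F(1) x0]
        let ?U = "ball x0 (r x0)"
        have [measurable]: "\<psi> x0 \<in> borel_measurable borel" "?U \<in> sets borel"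
          using \<psi>[OF x0'] by (auto intro: borel_measurable_continuous_onI)
        have \<phi>_meas [measurable]: "\<phi> \<in> borel_measurable borel"
          using grad by (intro borel_measurable_continuous_onI GDERIV_imp_continuous_on)
        define \<psi>' where "\<psi>' x = l / C * \<psi> x0 x" for x
        have [measurable]: "\<psi>' \<in> borel_measurable borel" unfolding \<psi>'_def by measurable
        have C\<psi>: "C * \<bar>\<psi>' x\<bar> = l * \<bar>\<psi> x0 x\<bar>" for x using C l by (simp add: \<psi>'_def abs_mult)
        let ?Q = "\<lambda>x. (P x - ennreal (C * \<bar>\<psi>' x\<bar>)) * indicator ?U x"
        have Q: "(\<integral>\<^sup>+x. ?Q x \<partial>lborel) \<le> ennreal (D / (l / C * c x0))"
          unfolding P_def
        proof (rule local[where b="b x0" and ?x0.0=x0])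
          fix x
          obtain \<tau> where \<tau>: "\<And>t. x + t *\<^sub>R b x0 \<in> ?U \<Longrightarrow> c x0 * \<bar>t - \<tau>\<bar> \<le> \<bar>\<psi> x0 (x + t *\<^sub>R b x0)\<bar>"
            using trans[OF x0'] by blast
          have "l / C * c x0 * \<bar>t - \<tau>\<bar> \<le> \<bar>\<psi>' (x + t *\<^sub>R b x0)\<bar>" if "x + t *\<^sub>R b x0 \<in> ?U" for t
            using mult_left_mono[OF \<tau>[OF that], of "l / C"] l C by (simp add: \<psi>'_def abs_mult)
          then show "\<exists>\<tau>. \<forall>t. x + t *\<^sub>R b x0 \<in> ?U \<longrightarrow> l / C * c x0 * \<bar>t - \<tau>\<bar> \<le> \<bar>\<psi>' (x + t *\<^sub>R b x0)\<bar>" by blast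
        next
          show "b x0 \<in> Basis" "0 < l / C * c x0" using b[OF x0'] c[OF x0'] l C by simp_all
          show "?U \<subseteq> ball x0 1" using r(2)[OF x0'] by (intro subset_ball) simp
        qed (use f in simp_all)
        have "ennreal (V x) * P x * indicator ?U x \<le> ennreal l * ennreal (V x * \<bar>\<phi> x\<bar>) + ennreal M * ?Q x" for x
        proof (cases "x \<in> ?U")
          case True
          have "P x \<le> ennreal (C * \<bar>\<psi>' x\<bar>) + (P x - ennreal (C * \<bar>\<psi>' x\<bar>))"
            by (cases "ennreal (C * \<bar>\<psi>' x\<bar>) \<le> P x") (simp_all add: add_diff_inverse_ennreal add_increasing2 less_imp_le not_le)
          then have "ennreal (V x) * P x \<le> ennreal (V x) * ennreal (C * \<bar>\<psi>' x\<bar>) + ennreal (V x) * (P x - ennreal (C * \<bar>\<psi>' x\<bar>))"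
            by (metis distrib_left mult_left_mono zero_le)
          also have "\<dots> \<le> ennreal l * ennreal (V x * \<bar>\<phi> x\<bar>) + ennreal M * (P x - ennreal (C * \<bar>\<psi>' x\<bar>))"
          proof (intro add_mono mult_right_mono ennreal_leI V(2))
            have "V x * (l * \<bar>\<psi> x0 x\<bar>) \<le> V x * (l * \<bar>\<phi> x\<bar>)"
              using \<psi>_le[OF x0' True] l V(1) by (intro mult_left_mono) auto
            then show "ennreal (V x) * ennreal (C * \<bar>\<psi>' x\<bar>) \<le> ennreal l * ennreal (V x * \<bar>\<phi> x\<bar>)"
              unfolding C\<psi> using V(1) l by (simp add: ennreal_mult'[symmetric] ennreal_leI mult.left_commute)
          qed auto
          finally show ?thesis using True by simp
        qed simp
        then have "(\<integral>\<^sup>+x. ennreal (V x) * P x * indicator ?U x \<partial>lborel) \<le> (\<integral>\<^sup>+x. ennreal l * ennreal (V x * \<bar>\<phi> x\<bar>) + ennreal M * ?Q x \<partial>lborel)"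
          by (intro nn_integral_mono)
        also have "\<dots> = ennreal l * ennreal A + ennreal M * (\<integral>\<^sup>+x. ?Q x \<partial>lborel)"
          by (simp add: nn_integral_add nn_integral_cmult A(2))
        also have "\<dots> \<le> ennreal l * ennreal A + ennreal M * ennreal (D / (l / C * c x0))"
          by (intro add_mono mult_left_mono Q) auto
        also have "\<dots> = ennreal (l * A + M * (D * C / c x0) / l)"
        proof -
          have eq: "D / (l / C * c x0) = (D * C / c x0) / l" by simp
          have nn: "0 \<le> l" "0 \<le> D * C / c x0 / l" using l D C c[OF x0'] by simp_all
          have "ennreal l * ennreal A + ennreal M * ennreal Y = ennreal (l * A + M * Y)" if "0 \<le> Y" for Y
            using that nn(1) A(1) M by (simp add: ennreal_mult ennreal_plus)
          from this[OF nn(2)] show ?thesis unfolding eq times_divide_eq_right[symmetric, of M "D * C / c x0" l] .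
        qed
        finally show ?thesis .
      qed
      have "(\<integral>\<^sup>+x. ennreal (V x) * P x \<partial>lborel) \<le> (\<integral>\<^sup>+x. (\<Sum>x0\<in>F. ennreal (V x) * P x * indicator (ball x0 (r x0)) x) \<partial>lborel)"
      proof (rule nn_integral_mono)
        fix x
        show "ennreal (V x) * P x \<le> (\<Sum>x0\<in>F. ennreal (V x) * P x * indicator (ball x0 (r x0)) x)"
        proof (cases "x \<in> \<Omega>")
          case True
          then obtain x0 where x0: "x0 \<in> F" "x \<in> ball x0 (r x0)" using F(3) closure_subset by blast
          then have "ennreal (V x) * P x = ennreal (V x) * P x * indicator (ball x0 (r x0)) x" by simp
          also have "\<dots> \<le> (\<Sum>x0\<in>F. ennreal (V x) * P x * indicator (ball x0 (r x0)) x)"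
            using x0(1) F(2) by (intro member_le_sum) auto
          finally show ?thesis .
        qed (simp add: V(3))
      qed
      also have "\<dots> = (\<Sum>x0\<in>F. \<integral>\<^sup>+x. ennreal (V x) * P x * indicator (ball x0 (r x0)) x \<partial>lborel)"
      proof (rule nn_integral_sum)
        fix x0
        have [measurable]: "ball x0 (r x0) \<in> sets borel" by simp
        show "(\<lambda>x. ennreal (V x) * P x * indicator (ball x0 (r x0)) x) \<in> borel_measurable lborel" by measurable
      qed
      also have "\<dots> \<le> (\<Sum>x0\<in>F. ennreal (l * A + M * (D * C / c x0) / l))"
        by (intro sum_mono piece)
      also have "\<dots> = ennreal (\<Sum>x0\<in>F. l * A + M * (D * C / c x0) / l)"
      proof (rule sum_ennreal)
        fix x0 assume "x0 \<in> F"
        then have "0 < c x0" using c F(1) by auto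
        then show "0 \<le> l * A + M * (D * C / c x0) / l" using l A(1) M D C by simp
      qed
      also have "(\<Sum>x0\<in>F. l * A + M * (D * C / c x0) / l) = l * (n * A) + (M * S) / l"
        by (simp add: sum.distrib n_def S_def sum_distrib_left sum_divide_distrib)
      finally show ?thesis .
    qed
    have "(\<integral>\<^sup>+x. ennreal (V x) * P x \<partial>lborel) \<le> ennreal (2 * sqrt ((n * A) * (M * S)))"
      by (rule ennreal_le_geometric_mean[OF _ _ bound]) (use A M S in \<open>auto simp: n_def\<close>)
    also have "2 * sqrt ((n * A) * (M * S)) = 2 * sqrt (n * S) * sqrt (M * A)"
      by (simp add: real_sqrt_mult)
    also have "\<dots> \<le> K * sqrt (M * A)" unfolding K_def using M A by (intro mult_right_mono) auto
    finally show "(\<integral>\<^sup>+x. ennreal (V x) * riesz_potential (d - \<alpha>) f x \<partial>lborel)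
       \<le> ennreal (K * sqrt (M * A))" by (simp add: P_def ennreal_leI)
  qed
qed

section \<open>The heat kernel and gamma densities\<close>

text \<open>
  The product form makes convolutions and Fourier transforms a matter of one variable. The closed
  formula is \<open>heat_explicit\<close>.
\<close>

definition heat :: "real \<Rightarrow> 'a::euclidean_space \<Rightarrow> real" where
  "heat t x = (\<Prod>b\<in>Basis. normal_density 0 (sqrt (2 * t)) (x \<bullet> b))"

lemma heat_nonneg [simp]: "0 \<le> heat t x"
  by (simp add: heat_def prod_nonneg)

lemma heat_measurable_pair [measurable]:
  "(\<lambda>(t, x). heat t x) \<in> borel_measurable (borel \<Otimes>\<^sub>M borel)"
  unfolding heat_def normal_density_def by measurable

lemma heat_measurable [measurable]: "heat t \<in> borel_measurable borel"
  unfolding heat_def[abs_def] by measurable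

lemma heat_uminus [simp]: "heat t (- x) = heat t x"
  by (simp add: heat_def normal_density_def)

lemma sum_inner_Basis_power2: "(\<Sum>b\<in>Basis. (x \<bullet> b)\<^sup>2) = (norm (x::'a::euclidean_space))\<^sup>2"
  unfolding power2_norm_eq_inner by (subst euclidean_inner) (simp add: power2_eq_square)

lemma heat_explicit:
  fixes x :: "'a::euclidean_space"
  assumes "0 < t"
  shows "heat t x = (4 * pi * t) powr - (real DIM('a) / 2) * exp (- (norm x)\<^sup>2 / (4 * t))"
proof -
  have n: "normal_density 0 (sqrt (2 * t)) s = (4 * pi * t) powr - (1 / 2) * exp (- s\<^sup>2 / (4 * t))" for s
  proof -
    have e: "2 * pi * (sqrt (2 * t))\<^sup>2 = 4 * pi * t" "2 * (sqrt (2 * t))\<^sup>2 = 4 * t"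
      using assms by auto
    show ?thesis
      unfolding normal_density_def e using assms by (simp add: powr_minus_divide powr_half_sqrt)
  qed
  have "heat t x = (\<Prod>b\<in>(Basis::'a set). (4 * pi * t) powr - (1 / 2) * exp (- (x \<bullet> b)\<^sup>2 / (4 * t)))"
    unfolding heat_def n ..
  also have "\<dots> = ((4 * pi * t) powr - (1 / 2)) ^ DIM('a) * (\<Prod>b\<in>(Basis::'a set). exp (- (x \<bullet> b)\<^sup>2 / (4 * t)))"
    by (simp add: prod.distrib)
  also have "((4 * pi * t) powr - (1 / 2)) ^ DIM('a) = (4 * pi * t) powr - (real DIM('a) / 2)"
    using assms by (simp add: powr_power)
  also have "(\<Prod>b\<in>(Basis::'a set). exp (- (x \<bullet> b)\<^sup>2 / (4 * t))) = exp (- (norm x)\<^sup>2 / (4 * t))"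
  proof -
    have "(\<Prod>b\<in>(Basis::'a set). exp (- (x \<bullet> b)\<^sup>2 / (4 * t))) = exp (\<Sum>b\<in>Basis. - (x \<bullet> b)\<^sup>2 / (4 * t))"
      by (rule exp_sum[symmetric]) simp
    also have "(\<Sum>b\<in>Basis. - (x \<bullet> b)\<^sup>2 / (4 * t)) = (\<Sum>b\<in>Basis. - (x \<bullet> b)\<^sup>2) / (4 * t)"
      by (rule sum_divide_distrib[symmetric])
    finally show ?thesis by (simp only: sum_negf sum_inner_Basis_power2)
  qed
  finally show ?thesis .
qed

lemma nn_integral_heat:
  assumes "0 < t"
  shows "(\<integral>\<^sup>+x. ennreal (heat t (x::'a::euclidean_space)) \<partial>lborel) = 1"
proof -
  have 1: "(\<integral>\<^sup>+s. ennreal (normal_density 0 (sqrt (2 * t)) s) \<partial>lborel) = 1"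
    using assms prob_space.emeasure_space_1[OF prob_space_normal_density[of "sqrt (2 * t)" 0]]
    by (simp add: emeasure_density)
  have "(\<integral>\<^sup>+x. ennreal (heat t (x::'a)) \<partial>lborel)
     = (\<integral>\<^sup>+x. (\<Prod>b\<in>(Basis::'a set). ennreal (normal_density 0 (sqrt (2 * t)) (x \<bullet> b))) \<partial>lborel)"
    by (simp add: heat_def prod_ennreal)
  also have "\<dots> = 1"
    by (subst nn_integral_lborel_prod) (auto simp: 1)
  finally show ?thesis .
qed

lemma integrable_heat: "0 < t \<Longrightarrow> integrable lborel (heat t)"
  by (intro integrableI_nonneg) (auto simp: nn_integral_heat)

lemma integral_heat: "0 < t \<Longrightarrow> (\<integral>x. heat t x \<partial>lborel) = 1"
  by (subst integral_eq_nn_integral) (auto simp: nn_integral_heat)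

lemma heat_convolution:
  fixes x :: "'a::euclidean_space"
  assumes "0 < s" "0 < t"
  shows "(\<integral>\<^sup>+y. ennreal (heat s (x - y) * heat t y) \<partial>lborel) = ennreal (heat (s + t) x)"
proof -
  let ?n = "\<lambda>t. normal_density 0 (sqrt (2 * t))"
  have 1: "(\<integral>\<^sup>+y. ennreal (?n s (u - y) * ?n t y) \<partial>lborel) = ennreal (?n (s + t) u)" for u
    using fun_cong[OF conv_normal_density_zero_mean[of "sqrt (2 * s)" "sqrt (2 * t)"], of u] assms
    by (simp add: ring_distribs)
  have "(\<integral>\<^sup>+y. ennreal (heat s (x - y) * heat t y) \<partial>lborel)
     = (\<integral>\<^sup>+y. (\<Prod>b\<in>(Basis::'a set). ennreal (?n s (x \<bullet> b - y \<bullet> b) * ?n t (y \<bullet> b))) \<partial>lborel)"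
    by (simp add: heat_def prod_ennreal prod.distrib inner_diff_left)
  also have "\<dots> = (\<Prod>b\<in>(Basis::'a set). ennreal (?n (s + t) (x \<bullet> b)))"
    by (subst nn_integral_lborel_prod) (auto simp: 1)
  also have "\<dots> = ennreal (heat (s + t) x)"
    by (simp add: heat_def prod_ennreal)
  finally show ?thesis .
qed

text \<open>
  This is the characteristic function of the standard normal distribution after rescaling.
\<close>

lemma normal_density_fourier:
  assumes \<sigma>: "0 < \<sigma>"
  shows "(LINT s|lborel. complex_of_real (normal_density 0 \<sigma> s) * exp (- \<i> * complex_of_real (\<xi> * s)))
     = complex_of_real (exp (- (\<sigma>\<^sup>2 * \<xi>\<^sup>2) / 2))"
proof -
  let ?f = "\<lambda>s. complex_of_real (normal_density 0 \<sigma> s) * exp (- \<i> * complex_of_real (\<xi> * s))"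
  have "(LINT s|lborel. ?f s) = \<bar>\<sigma>\<bar> *\<^sub>R (LINT u|lborel. ?f (0 + \<sigma> * u))"
    by (rule lborel_integral_real_affine) (use \<sigma> in auto)
  also have "\<dots> = (LINT u|lborel. \<bar>\<sigma>\<bar> *\<^sub>R ?f (0 + \<sigma> * u))"
    by simp
  also have "\<dots> = (LINT u|lborel. std_normal_density u *\<^sub>R iexp ((- \<sigma> * \<xi>) * u))"
  proof (intro Bochner_Integration.integral_cong refl)
    fix u :: real
    have e: "sqrt (2 * pi * \<sigma>\<^sup>2) = sqrt (2 * pi) * \<sigma>" "- (\<sigma> * u - 0)\<^sup>2 / (2 * \<sigma>\<^sup>2) = - u\<^sup>2 / 2"
      using \<sigma> by (simp_all add: real_sqrt_mult power_mult_distrib)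
    have n: "normal_density 0 \<sigma> (0 + \<sigma> * u) = std_normal_density u / \<sigma>"
      unfolding normal_density_def[of 0 \<sigma>] std_normal_density_def add_0 e by simp
    have x: "- \<i> * complex_of_real (\<xi> * (0 + \<sigma> * u)) = \<i> * complex_of_real ((- \<sigma> * \<xi>) * u)"
      by simp
    show "\<bar>\<sigma>\<bar> *\<^sub>R ?f (0 + \<sigma> * u) = std_normal_density u *\<^sub>R iexp ((- \<sigma> * \<xi>) * u)"
      unfolding n x using \<sigma> by (simp add: scaleR_conv_of_real)
  qed
  also have "\<dots> = char std_normal_distribution (- \<sigma> * \<xi>)"
    unfolding char_def by (subst integral_density) auto
  also have "\<dots> = complex_of_real (exp (- (\<sigma>\<^sup>2 * \<xi>\<^sup>2) / 2))"
    by (simp add: char_std_normal_distribution power_mult_distrib)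
  finally show ?thesis .
qed

lemma heat_fourier:
  fixes \<xi> :: "'a::euclidean_space"
  assumes t: "0 < t"
  shows "(LINT x|lborel. heat t x *\<^sub>R exp (- \<i> * complex_of_real (\<xi> \<bullet> x))) = complex_of_real (exp (- t * (norm \<xi>)\<^sup>2))"
proof -
  interpret product_sigma_finite "\<lambda>_::'a. lborel::real measure" by standard
  let ?n = "\<lambda>s. complex_of_real (normal_density 0 (sqrt (2 * t)) s)"
  have int: "integrable lborel (\<lambda>s. ?n s * exp (- \<i> * complex_of_real (a * s)))" for a
    using t by (intro Bochner_Integration.integrable_bound[OF integrable_normal_density[of "sqrt (2 * t)" 0]])
      (auto simp: norm_mult)
  have "(LINT x|lborel. heat t x *\<^sub>R exp (- \<i> * complex_of_real (\<xi> \<bullet> x)))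
     = (LINT f|(\<Pi>\<^sub>M b\<in>(Basis::'a set). lborel). heat t (\<Sum>b\<in>Basis. f b *\<^sub>R b) *\<^sub>R exp (- \<i> * complex_of_real (\<xi> \<bullet> (\<Sum>b\<in>Basis. f b *\<^sub>R b))))"
    by (subst lborel_eq, subst integral_distr) auto
  also have "\<dots> = (LINT f|(\<Pi>\<^sub>M b\<in>(Basis::'a set). lborel). (\<Prod>b\<in>Basis. ?n (f b) * exp (- \<i> * complex_of_real ((\<xi> \<bullet> b) * f b))))"
  proof (intro Bochner_Integration.integral_cong refl)
    fix f :: "'a \<Rightarrow> real"
    have "heat t (\<Sum>b\<in>Basis. f b *\<^sub>R b) = (\<Prod>b\<in>(Basis::'a set). normal_density 0 (sqrt (2 * t)) (f b))"
      unfolding heat_def by (intro prod.cong) auto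
    moreover have "\<xi> \<bullet> (\<Sum>b\<in>Basis. f b *\<^sub>R b) = (\<Sum>b\<in>Basis. (\<xi> \<bullet> b) * f b)"
      by (simp add: inner_sum_right mult.commute)
    ultimately show "heat t (\<Sum>b\<in>Basis. f b *\<^sub>R b) *\<^sub>R exp (- \<i> * complex_of_real (\<xi> \<bullet> (\<Sum>b\<in>Basis. f b *\<^sub>R b)))
       = (\<Prod>b\<in>Basis. ?n (f b) * exp (- \<i> * complex_of_real ((\<xi> \<bullet> b) * f b)))"
      by (simp add: scaleR_conv_of_real prod.distrib) (simp add: exp_sum[symmetric] sum_distrib_left sum_negf)
  qed
  also have "\<dots> = (\<Prod>b\<in>(Basis::'a set). complex_of_real (exp (- ((sqrt (2 * t))\<^sup>2 * (\<xi> \<bullet> b)\<^sup>2) / 2)))"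
  proof -
    have "(LINT f|(\<Pi>\<^sub>M b\<in>(Basis::'a set). lborel). (\<Prod>b\<in>Basis. ?n (f b) * exp (- \<i> * complex_of_real ((\<xi> \<bullet> b) * f b))))
       = (\<Prod>b\<in>(Basis::'a set). LINT s|lborel. ?n s * exp (- \<i> * complex_of_real ((\<xi> \<bullet> b) * s)))"
      by (rule product_integral_prod[OF _ int]) simp
    also have "\<dots> = (\<Prod>b\<in>(Basis::'a set). complex_of_real (exp (- ((sqrt (2 * t))\<^sup>2 * (\<xi> \<bullet> b)\<^sup>2) / 2)))"
      using t by (intro prod.cong refl normal_density_fourier) auto
    finally show ?thesis .
  qed
  also have "\<dots> = complex_of_real (exp (\<Sum>b\<in>(Basis::'a set). - t * (\<xi> \<bullet> b)\<^sup>2))"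
    using t by (simp add: exp_sum)
  also have "(\<Sum>b\<in>(Basis::'a set). - t * (\<xi> \<bullet> b)\<^sup>2) = - t * (norm \<xi>)\<^sup>2"
    by (simp only: sum_distrib_left[symmetric] sum_inner_Basis_power2)
  finally show ?thesis .
qed

text \<open>
  The density of the gamma distribution with shape \<open>a\<close> and rate one.
\<close>

definition gamma_weight :: "real \<Rightarrow> real \<Rightarrow> real" where
  "gamma_weight a t = indicator {0..} t * t powr (a - 1) / exp t / Gamma a"

lemma gamma_weight_measurable [measurable]: "gamma_weight a \<in> borel_measurable borel"
  unfolding gamma_weight_def[abs_def] by measurable

lemma gamma_weight_nonneg: "0 < a \<Longrightarrow> 0 \<le> gamma_weight a t"
  using Gamma_real_pos[of a] by (simp add: gamma_weight_def)

lemma gamma_weight_eq_0: "t \<le> 0 \<Longrightarrow> gamma_weight a t = 0"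
  by (cases "t = 0") (auto simp: gamma_weight_def)

lemma gamma_weight_laplace:
  assumes a: "0 < a" and k: "0 \<le> k"
  shows "(\<integral>\<^sup>+t. ennreal (gamma_weight a t * exp (- t * k)) \<partial>lborel) = ennreal ((1 + k) powr - a)"
proof -
  have G: "0 < Gamma a" using a by (rule Gamma_real_pos)
  have "(\<integral>\<^sup>+t. ennreal (gamma_weight a t * exp (- t * k)) \<partial>lborel)
     = ennreal (1 / (1 + k)) * (\<integral>\<^sup>+t. ennreal (gamma_weight a (t / (1 + k)) * exp (- (t / (1 + k)) * k)) \<partial>lborel)"
    using k by (subst nn_integral_real_affine[of _ "1 / (1 + k)" 0]) auto
  also have "(\<integral>\<^sup>+t. ennreal (gamma_weight a (t / (1 + k)) * exp (- (t / (1 + k)) * k)) \<partial>lborel)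
     = (\<integral>\<^sup>+t. ennreal ((1 + k) powr (1 - a) / Gamma a) * ennreal (indicator {0..} t * t powr (a - 1) / exp t) \<partial>lborel)"
  proof (intro nn_integral_cong)
    fix t :: real
    show "ennreal (gamma_weight a (t / (1 + k)) * exp (- (t / (1 + k)) * k))
       = ennreal ((1 + k) powr (1 - a) / Gamma a) * ennreal (indicator {0..} t * t powr (a - 1) / exp t)"
    proof (cases "0 \<le> t")
      case True
      have "exp (t / (1 + k)) * exp ((t / (1 + k)) * k) = exp t"
      proof -
        have "t / (1 + k) + t / (1 + k) * k = t / (1 + k) * (1 + k)" by (simp only: distrib_left mult_1_right)
        then show ?thesis using k by (simp add: exp_add[symmetric])
      qed
      moreover have "(t / (1 + k)) powr (a - 1) = t powr (a - 1) * (1 + k) powr (1 - a)"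
        using True k powr_minus_divide[of "1 + k" "a - 1"] by (simp add: powr_divide)
      ultimately show ?thesis using True k G
        by (simp add: gamma_weight_def ennreal_mult'[symmetric] exp_minus inverse_eq_divide zero_le_divide_iff ac_simps)
    next
      case False
      then show ?thesis using k by (simp add: gamma_weight_def zero_le_divide_iff)
    qed
  qed
  also have "\<dots> = ennreal ((1 + k) powr (1 - a) / Gamma a) * ennreal (Gamma a)"
    by (subst nn_integral_cmult) (auto simp: Gamma_conv_nn_integral_real[OF a])
  also have "ennreal (1 / (1 + k)) * (ennreal ((1 + k) powr (1 - a) / Gamma a) * ennreal (Gamma a)) = ennreal ((1 + k) powr - a)"
    using G k by (simp add: ennreal_mult'[symmetric] powr_diff powr_minus inverse_eq_divide)
  finally show ?thesis .
qed

lemma nn_integral_gamma_weight: "0 < a \<Longrightarrow> (\<integral>\<^sup>+t. ennreal (gamma_weight a t) \<partial>lborel) = 1"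
  using gamma_weight_laplace[of a 0] by simp

section \<open>The Bessel kernel as a mixture of heat kernels\<close>

text \<open>
  The Bessel kernel of order \<open>2 * a\<close>. The integral diverges at the origin for small \<open>a\<close>, where the
  value is then zero by convention.
\<close>

definition heat_mixture :: "real \<Rightarrow> 'a::euclidean_space \<Rightarrow> real" where
  "heat_mixture a x = (LINT t|lborel. gamma_weight a t * heat t x)"

lemma heat_mixture_nonneg: "0 < a \<Longrightarrow> 0 \<le> heat_mixture a x"
  unfolding heat_mixture_def by (intro integral_nonneg_AE AE_I2) (simp add: gamma_weight_nonneg)

lemma heat_mixture_uminus [simp]: "heat_mixture a (- x) = heat_mixture a x"
  by (simp add: heat_mixture_def)

lemma heat_mixture_measurable [measurable]: "heat_mixture a \<in> borel_measurable borel"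
  unfolding heat_mixture_def[abs_def] by measurable

lemma integrable_gamma_heat:
  fixes L :: "'a::euclidean_space \<Rightarrow> 'b::{banach, second_countable_topology}"
  assumes a: "0 < a" and [measurable]: "L \<in> borel_measurable borel" and B: "\<And>x. norm (L x) \<le> B"
  shows "integrable (lborel \<Otimes>\<^sub>M lborel) (\<lambda>(t, x). (gamma_weight a t * heat t x) *\<^sub>R L x)"
proof (rule integrableI_bounded)
  have B0: "0 \<le> B" using B[of undefined] norm_ge_zero[of "L undefined"] by linarith
  have "(\<integral>\<^sup>+z. ennreal (norm (case z of (t, x) \<Rightarrow> (gamma_weight a t * heat t x) *\<^sub>R L x)) \<partial>(lborel \<Otimes>\<^sub>M lborel))
    \<le> (\<integral>\<^sup>+z. (case z of (t, x) \<Rightarrow> ennreal B * (ennreal (gamma_weight a t) * ennreal (heat t (x::'a)))) \<partial>(lborel \<Otimes>\<^sub>M lborel))"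
  proof (intro nn_integral_mono, clarify)
    fix t :: real and x :: 'a
    have "norm ((gamma_weight a t * heat t x) *\<^sub>R L x) = (gamma_weight a t * heat t x) * norm (L x)"
      using a by (simp add: gamma_weight_nonneg abs_mult)
    also have "\<dots> \<le> (gamma_weight a t * heat t x) * B"
      using a B by (intro mult_left_mono) (simp_all add: gamma_weight_nonneg)
    finally show "ennreal (norm ((gamma_weight a t * heat t x) *\<^sub>R L x)) \<le> ennreal B * (ennreal (gamma_weight a t) * ennreal (heat t x))"
      using a B0 by (simp add: ennreal_mult'[symmetric] gamma_weight_nonneg mult.commute ennreal_leI)
  qed
  also have "\<dots> = (\<integral>\<^sup>+t. (\<integral>\<^sup>+x. ennreal B * (ennreal (gamma_weight a t) * ennreal (heat t (x::'a))) \<partial>lborel) \<partial>lborel)"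
    by (subst lborel.nn_integral_fst[symmetric]) auto
  also have "\<dots> = (\<integral>\<^sup>+t. ennreal B * (ennreal (gamma_weight a t) * (\<integral>\<^sup>+x. ennreal (heat t (x::'a)) \<partial>lborel)) \<partial>lborel)"
    by (simp add: nn_integral_cmult)
  also have "\<dots> = (\<integral>\<^sup>+t. ennreal B * ennreal (gamma_weight a t) \<partial>lborel)"
  proof (intro nn_integral_cong)
    fix t :: real
    show "ennreal B * (ennreal (gamma_weight a t) * (\<integral>\<^sup>+x. ennreal (heat t (x::'a)) \<partial>lborel)) = ennreal B * ennreal (gamma_weight a t)"
      by (cases "0 < t") (simp_all add: nn_integral_heat gamma_weight_eq_0)
  qed
  also have "\<dots> = ennreal B" by (simp add: nn_integral_cmult nn_integral_gamma_weight a)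
  finally show "(\<integral>\<^sup>+z. ennreal (norm (case z of (t, x) \<Rightarrow> (gamma_weight a t * heat t x) *\<^sub>R L x)) \<partial>(lborel \<Otimes>\<^sub>M lborel)) < \<infinity>"
    by (simp add: order_le_less_trans)
qed measurable

lemma integral_scaleR_const:
  fixes f :: "'a \<Rightarrow> real" and c :: "'b::{banach, second_countable_topology}"
  assumes f: "f \<in> borel_measurable M"
  shows "(LINT x|M. f x *\<^sub>R c) = (LINT x|M. f x) *\<^sub>R c"
proof (cases "c = 0 \<or> integrable M f")
  case False
  have "\<not> integrable M (\<lambda>x. f x *\<^sub>R c)"
  proof
    assume "integrable M (\<lambda>x. f x *\<^sub>R c)"
    then have "integrable M (\<lambda>x. norm (f x *\<^sub>R c) / norm c)" by (intro integrable_divide integrable_norm)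
    then have "integrable M (\<lambda>x. norm (f x))" using False by simp
    then show False using False f by (simp add: integrable_norm_iff del: real_norm_def)
  qed
  then show ?thesis using False by (simp add: not_integrable_integral_eq)
qed auto

lemma heat_mixture_integral:
  fixes L :: "'a::euclidean_space \<Rightarrow> 'b::{banach, second_countable_topology}"
  assumes a: "0 < a" and L [measurable]: "L \<in> borel_measurable borel" and B: "\<And>x. norm (L x) \<le> B"
  shows "integrable lborel (\<lambda>x. heat_mixture a x *\<^sub>R L x)" (is ?int)
    and "(LINT x|lborel. heat_mixture a x *\<^sub>R L x) = (LINT t|lborel. gamma_weight a t *\<^sub>R (LINT x|lborel. heat t x *\<^sub>R L x))" (is ?eq)
    and "integrable lborel (\<lambda>t. gamma_weight a t *\<^sub>R (LINT x|lborel. heat t x *\<^sub>R L x))" (is ?int2)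
proof -
  note J = integrable_gamma_heat[OF assms]
  have "integrable lborel (\<lambda>x. LINT t|lborel. (gamma_weight a t * heat t x) *\<^sub>R L x)"
    by (rule lborel_pair.integrable_snd[OF J])
  moreover have slice: "(LINT t|lborel. (gamma_weight a t * heat t x) *\<^sub>R L x) = heat_mixture a x *\<^sub>R L x" for x
    unfolding heat_mixture_def by (rule integral_scaleR_const) measurable
  ultimately show ?int by simp
  have slice2: "(LINT x|lborel. (gamma_weight a t * heat t x) *\<^sub>R L x) = gamma_weight a t *\<^sub>R (LINT x|lborel. heat t x *\<^sub>R L x)" for t
    by (simp add: scaleR_scaleR[symmetric] del: scaleR_scaleR)
  show ?int2 using lborel_pair.integrable_fst[OF J] by (simp only: slice2)
  have "(LINT x|lborel. LINT t|lborel. (gamma_weight a t * heat t x) *\<^sub>R L x) =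
     (LINT t|lborel. LINT x|lborel. (gamma_weight a t * heat t x) *\<^sub>R L x)"
    by (rule lborel_pair.Fubini_integral[OF J])
  then show ?eq by (simp only: slice slice2)
qed

lemma integrable_heat_mixture: "0 < a \<Longrightarrow> integrable lborel (heat_mixture a)"
  using heat_mixture_integral(1)[of a "\<lambda>_. 1::real" 1] by simp

text \<open>
  Mixing the Gaussians \<open>exp (- t * (norm \<xi>)\<^sup>2)\<close> with the gamma density is taking its Laplace transform at
  \<open>(norm \<xi>)\<^sup>2\<close>.
\<close>

lemma heat_mixture_fourier:
  fixes \<xi> :: "'a::euclidean_space"
  assumes a: "0 < a"
  shows "fourier (heat_mixture a) \<xi> = complex_of_real ((1 + (norm \<xi>)\<^sup>2) powr - a)"
proof -
  let ?E = "\<lambda>x. exp (- \<i> * complex_of_real (\<xi> \<bullet> x))"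
  have "fourier (heat_mixture a) \<xi> = (LINT x|lborel. heat_mixture a x *\<^sub>R ?E x)"
    unfolding fourier_def by (subst integral_completion) (auto simp: scaleR_conv_of_real)
  also have "\<dots> = (LINT t|lborel. gamma_weight a t *\<^sub>R (LINT x|lborel. heat t x *\<^sub>R ?E x))"
    using a by (intro heat_mixture_integral(2)[where B=1]) auto
  also have "\<dots> = (LINT t|lborel. complex_of_real (gamma_weight a t * exp (- t * (norm \<xi>)\<^sup>2)))"
  proof (intro Bochner_Integration.integral_cong refl)
    fix t :: real
    show "gamma_weight a t *\<^sub>R (LINT x|lborel. heat t x *\<^sub>R ?E x) = complex_of_real (gamma_weight a t * exp (- t * (norm \<xi>)\<^sup>2))"
      by (cases "0 < t") (simp_all only: heat_fourier gamma_weight_eq_0 not_less, simp_all add: scaleR_conv_of_real)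
  qed
  also have "\<dots> = complex_of_real (LINT t|lborel. gamma_weight a t * exp (- t * (norm \<xi>)\<^sup>2))"
    by (rule integral_complex_of_real)
  also have "(LINT t|lborel. gamma_weight a t * exp (- t * (norm \<xi>)\<^sup>2)) = (1 + (norm \<xi>)\<^sup>2) powr - a"
  proof (subst integral_eq_nn_integral)
    show "AE t in lborel. 0 \<le> gamma_weight a t * exp (- t * (norm \<xi>)\<^sup>2)"
      using a by (simp add: gamma_weight_nonneg)
    have "(\<integral>\<^sup>+t. ennreal (gamma_weight a t * exp (- t * (norm \<xi>)\<^sup>2)) \<partial>lborel) = ennreal ((1 + (norm \<xi>)\<^sup>2) powr - a)"
      by (rule gamma_weight_laplace[OF a]) simp
    then show "enn2real (\<integral>\<^sup>+t. ennreal (gamma_weight a t * exp (- t * (norm \<xi>)\<^sup>2)) \<partial>lborel) = (1 + (norm \<xi>)\<^sup>2) powr - a"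
      by (simp only: enn2real_ennreal powr_ge_zero)
  qed simp
  finally show ?thesis .
qed

lemma powr_le_exp:
  fixes s t :: real
  assumes "0 \<le> s" obtains C where "0 < C" "\<And>t. 0 < t \<Longrightarrow> t powr s \<le> C * exp t"
proof (cases "s = 0")
  case True
  then show ?thesis by (intro that[of 1]) auto
next
  case False
  then have s: "0 < s" using assms by simp
  show ?thesis
  proof (rule that[of "s powr s"])
    fix t :: real assume t: "0 < t"
    have "t / s \<le> exp (t / s)" using exp_ge_add_one_self[of "t / s"] by linarith
    then have "(t / s) powr s \<le> exp (t / s) powr s" using s t by (intro powr_mono2) auto
    also have "\<dots> = exp t" using s by (simp add: powr_def)
    finally show "t powr s \<le> s powr s * exp t" using s t by (simp add: powr_divide field_simps)
  qed (use s in auto)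
qed

text \<open>
  The factor \<open>exp (- t)\<close> of the gamma density is traded for a power of \<open>t\<close> so that \<open>t\<close> enters with the exponent
  \<open>- m / 2 - 1\<close>, which scales like \<open>norm x powr - m\<close>. For \<open>t\<close> below \<open>(norm x)\<^sup>2\<close> the Gaussian makes the
  integrand bounded, and above that value the power is integrable. The case \<open>m = DIM('a) - 2 * a\<close>
  of equality is the one that the critical exponent \<open>p\<close> requires.
\<close>

lemma heat_mixture_bound:
  fixes a m :: real
  assumes a: "0 < a" and m: "0 < m" "real DIM('a::euclidean_space) - 2 * a \<le> m"
  obtains C where "0 < C" "\<And>x::'a. x \<noteq> 0 \<Longrightarrow> heat_mixture a x \<le> C * norm x powr - m"
proof -
  define d where "d = real DIM('a)"
  have G: "0 < Gamma a" using a by (rule Gamma_real_pos)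
  obtain C1 where C1: "0 < C1" "\<And>t. 0 < t \<Longrightarrow> t powr (a - d / 2 + m / 2) \<le> C1 * exp t"
    using powr_le_exp[of "a - d / 2 + m / 2"] m by (auto simp: d_def field_simps)
  obtain C2 where C2: "0 < C2" "\<And>t. 0 < t \<Longrightarrow> t powr (m / 2 + 1) \<le> C2 * exp t"
    using powr_le_exp[of "m / 2 + 1"] m by auto
  define c where "c = (4 * pi) powr - (d / 2) * C1 / Gamma a"
  define c2 where "c2 = C2 * 4 powr (m / 2 + 1)"
  have c: "0 < c" "0 < c2" using C1 C2 G by (simp_all add: c_def c2_def)
  show thesis
  proof (rule that[of "c * (c2 + 2 / m)"])
    show "0 < c * (c2 + 2 / m)" using c m by (simp add: add_pos_pos)
    fix x :: 'a assume x: "x \<noteq> 0"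
    define r where "r = norm x"
    have r: "0 < r" using x by (simp add: r_def)
    have sq: "r\<^sup>2 powr s = r powr (2 * s)" for s
      unfolding powr_powr[symmetric] using r by simp
    have pw: "gamma_weight a t * heat t x \<le>
        c * (c2 * r powr - (m + 2) * indicator {0..r\<^sup>2} t + t powr (- (m / 2) - 1) * indicator {r\<^sup>2..} t)" for t
    proof (cases "0 < t")
      case t: True
      let ?K = "(4 * pi) powr - (d / 2) / Gamma a" and ?Z = "t powr (- (m / 2) - 1)" and ?Y = "exp (- r\<^sup>2 / (4 * t))"
      have "t powr (a - 1) * t powr - (d / 2) = t powr (a - d / 2 + m / 2) * ?Z"
        unfolding powr_add[symmetric] by (rule arg_cong[where f="\<lambda>s. t powr s"]) simp
      also have "\<dots> \<le> C1 * exp t * ?Z"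
        using C1(2)[OF t] by (intro mult_right_mono) auto
      finally have le: "t powr (a - 1) * t powr - (d / 2) / exp t \<le> C1 * ?Z"
        by (simp add: pos_divide_le_eq mult.assoc mult.left_commute mult.commute)
      have "gamma_weight a t * heat t x = ?K * (t powr (a - 1) * t powr - (d / 2) / exp t) * ?Y"
        using t G by (simp add: gamma_weight_def heat_explicit r_def d_def powr_mult field_simps)
      also have "\<dots> \<le> ?K * (C1 * ?Z) * ?Y"
        using G le by (intro mult_right_mono mult_left_mono) auto
      also have "\<dots> = c * (?Z * ?Y)" by (simp add: c_def)
      finally have "gamma_weight a t * heat t x \<le> c * (?Z * ?Y)" .
      also have "t powr (- (m / 2) - 1) * exp (- r\<^sup>2 / (4 * t)) \<le> c2 * r powr - (m + 2) * indicator {0..r\<^sup>2} t + t powr (- (m / 2) - 1) * indicator {r\<^sup>2..} t"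
      proof (cases "r\<^sup>2 \<le> t")
        case True
        have "t powr (- (m / 2) - 1) * exp (- r\<^sup>2 / (4 * t)) \<le> t powr (- (m / 2) - 1) * 1"
          using t by (intro mult_left_mono) (auto simp: field_simps)
        then show ?thesis using True c by (auto simp: indicator_def intro: add_increasing)
      next
        case False
        define e where "e = m / 2 + 1"
        have "(r\<^sup>2 / (4 * t)) powr e \<le> C2 * exp (r\<^sup>2 / (4 * t))" unfolding e_def using r t by (intro C2(2)) auto
        also have "(r\<^sup>2 / (4 * t)) powr e = r powr (m + 2) / (4 powr e * t powr e)"
          using r t sq[of e] by (simp add: powr_divide powr_mult) (simp add: e_def)
        finally have "r powr (m + 2) / (4 powr e * t powr e) * exp (- r\<^sup>2 / (4 * t)) \<le> C2 * exp (r\<^sup>2 / (4 * t)) * exp (- r\<^sup>2 / (4 * t))"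
          by (intro mult_right_mono) auto
        also have "\<dots> = C2" by (simp add: mult.assoc exp_add[symmetric])
        finally have "r powr (m + 2) / (4 powr e * t powr e) * exp (- r\<^sup>2 / (4 * t)) \<le> C2" .
        then have "r powr (m + 2) * (inverse (t powr e) * exp (- r\<^sup>2 / (4 * t))) \<le> C2 * 4 powr e"
          using t by (simp add: divide_simps mult.commute mult.left_commute)
        moreover have inv: "inverse (t powr e) = ?Z"
          unfolding powr_minus[symmetric] by (simp add: e_def)
        ultimately have H: "r powr (m + 2) * (?Z * ?Y) \<le> c2"
          unfolding c2_def e_def[symmetric] by (simp only: inv)
        have "?Z * ?Y = r powr (m + 2) * (?Z * ?Y) * inverse (r powr (m + 2))"
          using r by simp
        also have "\<dots> \<le> c2 * inverse (r powr (m + 2))"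
          by (intro mult_right_mono H) simp
        finally have "?Z * ?Y \<le> c2 * inverse (r powr (m + 2))" .
        then have "t powr (- (m / 2) - 1) * exp (- r\<^sup>2 / (4 * t)) \<le> c2 * r powr - (m + 2)"
          by (simp only: powr_minus)
        then show ?thesis using False t by (auto simp: indicator_def)
      qed
      finally show ?thesis using c by simp
    next
      case False
      then show ?thesis using c gamma_weight_eq_0[of t a] by (auto simp: indicator_def)
    qed
    have tail: "(\<integral>\<^sup>+t. ennreal (t powr (- (m / 2) - 1)) * indicator {r\<^sup>2..} t \<partial>lborel) = ennreal (2 / m * r powr - m)"
    proof -
      have "((\<lambda>t. t powr (- (m / 2) - 1)) has_integral - (r\<^sup>2 powr (- (m / 2) - 1 + 1)) / (- (m / 2) - 1 + 1)) {r\<^sup>2..}"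
        using r m by (intro has_integral_powr_to_inf) auto
      moreover have "r\<^sup>2 powr (- (m / 2)) = r powr - m"
        by (simp add: sq)
      ultimately have "((\<lambda>t. t powr (- (m / 2) - 1)) has_integral (2 / m * r powr - m)) {r\<^sup>2..}"
        by (simp add: mult.commute)
      then show ?thesis by (intro nn_integral_has_integral_lebesgue') auto
    qed
    have "ennreal (heat_mixture a x) \<le> (\<integral>\<^sup>+t. ennreal (gamma_weight a t * heat t x) \<partial>lborel)"
      unfolding heat_mixture_def using a
      by (cases "integrable lborel (\<lambda>t. gamma_weight a t * heat t x)")
        (simp_all add: nn_integral_eq_integral gamma_weight_nonneg not_integrable_integral_eq)
    also have "\<dots> \<le> (\<integral>\<^sup>+t. ennreal (c * (c2 * r powr - (m + 2) * indicator {0..r\<^sup>2} t + t powr (- (m / 2) - 1) * indicator {r\<^sup>2..} t)) \<partial>lborel)"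
      by (intro nn_integral_mono ennreal_leI pw)
    also have "\<dots> = (\<integral>\<^sup>+t. ennreal c * (ennreal (c2 * r powr - (m + 2)) * indicator {0..r\<^sup>2} t + ennreal (t powr (- (m / 2) - 1)) * indicator {r\<^sup>2..} t) \<partial>lborel)"
      using c by (intro nn_integral_cong) (auto simp: ennreal_mult'[symmetric] ennreal_plus[symmetric] simp del: ennreal_plus split: split_indicator)
    also have "\<dots> = ennreal c * (ennreal (c2 * r powr - (m + 2)) * ennreal (r\<^sup>2) + ennreal (2 / m * r powr - m))"
      by (simp add: nn_integral_cmult nn_integral_add tail)
    also have "\<dots> = ennreal (c * (c2 + 2 / m) * r powr - m)"
    proof -
      have "r powr - (m + 2) * r\<^sup>2 = r powr - m"
        using r powr_add[of r "- (m + 2)" 2] by simp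
      then show ?thesis using c m
        by (simp add: ennreal_mult'[symmetric] ennreal_plus[symmetric] ring_distribs mult.assoc del: ennreal_plus)
    qed
    finally show "heat_mixture a x \<le> c * (c2 + 2 / m) * norm x powr - m"
      using c m by (simp add: r_def)
  qed
qed

section \<open>Functions that vanish in the mean\<close>

text \<open>
  The positive and the negative part of \<open>f\<close> are densities of two finite measures that agree on a
  generator of the Borel sets.
\<close>

lemma AE_zero_if_zero_on_generator:
  fixes f :: "'a::euclidean_space \<Rightarrow> real"
  assumes f: "integrable lborel f" and E: "Int_stable E" "sets borel = sigma_sets UNIV E"
    and A: "range (A :: nat \<Rightarrow> 'a set) \<subseteq> E" "(\<Union>i. A i) = UNIV"
    and zero: "\<And>X. X \<in> E \<Longrightarrow> (LINT x|lborel. indicator X x * f x) = 0"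
  shows "AE x in lborel. f x = 0"
proof -
  have [measurable]: "f \<in> borel_measurable borel" using borel_measurable_integrable[OF f] by simp
  define p n where "p x = ennreal (f x)" and "n x = ennreal (- f x)" for x
  have [measurable]: "p \<in> borel_measurable borel" "n \<in> borel_measurable borel" unfolding p_def n_def by measurable
  have fin: "(\<integral>\<^sup>+x. p x \<partial>lborel) < \<infinity>" "(\<integral>\<^sup>+x. n x \<partial>lborel) < \<infinity>"
    using f by (auto simp: p_def n_def real_integrable_def top.not_eq_extremum)
  have "density lborel p = density lborel n"
  proof (rule measure_eqI_generator_eq[OF E(1) _ _ _ _ A])
    show "sets (density lborel p) = sigma_sets UNIV E" "sets (density lborel n) = sigma_sets UNIV E"
      using E by auto
    fix X assume X: "X \<in> E"
    then have [measurable]: "X \<in> sets borel" using E by auto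
    have I: "integrable lborel (\<lambda>x. indicator X x * f x)"
      using integrable_real_mult_indicator[OF _ f, of X] by (simp add: mult.commute)
    have "(\<integral>\<^sup>+x. ennreal (indicator X x * f x) \<partial>lborel) = (\<integral>\<^sup>+x. ennreal (- (indicator X x * f x)) \<partial>lborel)"
    proof -
      let ?P = "\<integral>\<^sup>+x. ennreal (indicator X x * f x) \<partial>lborel" and ?N = "\<integral>\<^sup>+x. ennreal (- (indicator X x * f x)) \<partial>lborel"
      have "enn2real ?P = enn2real ?N" using real_lebesgue_integral_def[OF I] zero[OF X] by simp
      moreover have "?P < \<infinity>" "?N < \<infinity>" using I by (auto simp: real_integrable_def top.not_eq_extremum)
      ultimately show ?thesis by (metis ennreal_enn2real infinity_ennreal_def)
    qed
    also have "(\<integral>\<^sup>+x. ennreal (indicator X x * f x) \<partial>lborel) = emeasure (density lborel p) X"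
      by (subst emeasure_density) (auto intro!: nn_integral_cong simp: p_def split: split_indicator)
    also have "(\<integral>\<^sup>+x. ennreal (- (indicator X x * f x)) \<partial>lborel) = emeasure (density lborel n) X"
      by (subst emeasure_density) (auto intro!: nn_integral_cong simp: n_def split: split_indicator)
    finally show "emeasure (density lborel p) X = emeasure (density lborel n) X" .
  next
    fix i
    have "A i \<in> sets borel" using A E by auto
    then have "emeasure (density lborel p) (A i) \<le> (\<integral>\<^sup>+x. p x \<partial>lborel)"
      by (subst emeasure_density) (auto intro!: nn_integral_mono split: split_indicator)
    then show "emeasure (density lborel p) (A i) \<noteq> \<infinity>" using fin by (auto simp: top.extremum_unique)
  qed auto
  then have "AE x in lborel. p x = n x" by (intro sigma_finite_measure.density_unique[OF lborel.sigma_finite_measure_axioms]) auto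
  then show ?thesis
  proof (rule eventually_mono)
    fix x assume "p x = n x"
    then show "f x = 0" by (cases "0 \<le> f x") (auto simp: p_def n_def ennreal_neg dest: sym)
  qed
qed

definition bump :: "('a::euclidean_space \<Rightarrow> real) \<Rightarrow> bool" where
  "bump \<psi> \<longleftrightarrow> continuous_on UNIV \<psi> \<and> (\<exists>r. \<forall>x. r \<le> norm x \<longrightarrow> \<psi> x = 0)"

lemma bump_measurable: "bump \<psi> \<Longrightarrow> \<psi> \<in> borel_measurable borel"
  by (simp add: bump_def borel_measurable_continuous_onI)

lemma bump_bounded:
  assumes "bump \<psi>" obtains B r where "0 < B" "0 < r" "\<And>x. \<bar>\<psi> x\<bar> \<le> B * indicator (ball 0 r) x"
proof -
  from assms obtain r where r: "\<And>x. r \<le> norm x \<Longrightarrow> \<psi> x = 0" and c: "continuous_on UNIV \<psi>"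
    by (auto simp: bump_def)
  have "compact (\<psi> ` cball 0 \<bar>r\<bar>)" by (intro compact_continuous_image continuous_on_subset[OF c]) auto
  then obtain B where B: "0 < B" "\<And>x. x \<in> cball 0 \<bar>r\<bar> \<Longrightarrow> \<bar>\<psi> x\<bar> \<le> B"
    using compact_imp_bounded bounded_pos by (metis (no_types, lifting) image_eqI real_norm_def)
  show ?thesis
  proof (rule that[of B "\<bar>r\<bar> + 1"])
    fix x
    show "\<bar>\<psi> x\<bar> \<le> B * indicator (ball 0 (\<bar>r\<bar> + 1)) x"
    proof (cases "norm x < \<bar>r\<bar>")
      case True
      then show ?thesis using B(2)[of x] by simp
    next
      case False
      then have "\<psi> x = 0" by (intro r) linarith
      then show ?thesis using B by simp
    qed
  qed (use B in auto)
qed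

text \<open>
  Indicators of bounded open sets are limits of truncated multiples of the distance to the complement.
\<close>

lemma AE_zero_if_zero_against_bumps:
  fixes f :: "'a::euclidean_space \<Rightarrow> real"
  assumes [measurable]: "f \<in> borel_measurable borel"
    and loc: "\<And>r. integrable lborel (\<lambda>x. indicator (ball 0 r) x * f x)"
    and zero: "\<And>\<psi>. bump \<psi> \<Longrightarrow> (LINT x|lborel. f x * \<psi> x) = 0"
  shows "AE x in lborel. f x = 0"
proof -
  have open_zero: "(LINT x|lborel. indicator V x * f x) = 0" if V: "open V" "V \<subseteq> ball 0 r" for V r
  proof -
    \<comment> \<open>The complement of \<open>V\<close> is nonempty, so that the distance to it is positive exactly on \<open>V\<close>.\<close>
    define \<psi> where "\<psi> n x = min 1 (real n * infdist x (- V))" for n :: nat and x :: 'a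
    have ne: "- V \<noteq> {}" using V(2) bounded_subset[OF bounded_ball[of 0 r] V(2)] not_bounded_UNIV[where 'a='a]
      by (metis Compl_UNIV_eq double_compl)
    have out: "\<psi> n x = 0" if "x \<notin> V" for n x using that by (simp add: \<psi>_def)
    have bump: "bump (\<psi> n)" for n
    proof -
      have "continuous_on UNIV (\<psi> n)" unfolding \<psi>_def[abs_def] by (intro continuous_intros)
      moreover have "\<forall>x. r \<le> norm x \<longrightarrow> \<psi> n x = 0" using V(2) by (auto intro!: out)
      ultimately show ?thesis unfolding bump_def by blast
    qed
    have [measurable]: "\<psi> n \<in> borel_measurable borel" for n by (rule bump_measurable[OF bump])
    have "(\<lambda>n. LINT x|lborel. f x * \<psi> n x) \<longlonglongrightarrow> (LINT x|lborel. f x * indicator V x)"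
    proof (rule integral_dominated_convergence[where w="\<lambda>x. \<bar>indicator (ball 0 r) x * f x\<bar>"])
      show "integrable lborel (\<lambda>x. \<bar>indicator (ball 0 r) x * f x\<bar>)" using loc by (rule integrable_abs)
      show "AE x in lborel. (\<lambda>n. f x * \<psi> n x) \<longlonglongrightarrow> f x * indicator V x"
      proof (rule AE_I2)
        fix x :: 'a
        have "(\<lambda>n. \<psi> n x) \<longlonglongrightarrow> indicator V x"
        proof (cases "x \<in> V")
          case True
          then have pos: "0 < infdist x (- V)"
            using V(1) ne in_closed_iff_infdist_zero[of "- V" x] infdist_nonneg[of x "- V"] by fastforce
          then obtain N where N: "1 < real N * infdist x (- V)" using reals_Archimedean3 by blast
          have "\<forall>\<^sub>F n in sequentially. \<psi> n x = 1"
            using eventually_ge_at_top[of N]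
          proof eventually_elim
            case (elim n)
            then have "real N * infdist x (- V) \<le> real n * infdist x (- V)" using pos by simp
            then show ?case using N by (simp add: \<psi>_def)
          qed
          then show ?thesis using True by (simp add: tendsto_eventually)
        qed (simp add: out)
        then show "(\<lambda>n. f x * \<psi> n x) \<longlonglongrightarrow> f x * indicator V x" by (rule tendsto_mult_left)
      qed
      fix n
      show "AE x in lborel. norm (f x * \<psi> n x) \<le> \<bar>indicator (ball 0 r) x * f x\<bar>"
      proof (rule AE_I2)
        fix x :: 'a
        have "\<bar>\<psi> n x\<bar> \<le> indicator (ball 0 r) x"
          using out[of x n] V(2) infdist_nonneg[of x "- V"] by (cases "x \<in> V") (auto simp: \<psi>_def)
        then show "norm (f x * \<psi> n x) \<le> \<bar>indicator (ball 0 r) x * f x\<bar>"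
          by (simp add: abs_mult mult.commute mult_left_mono)
      qed
    qed (use V in auto)
    then have "(\<lambda>n. 0 :: real) \<longlonglongrightarrow> (LINT x|lborel. f x * indicator V x)" by (simp add: zero[OF bump])
    from LIMSEQ_unique[OF tendsto_const this] show ?thesis by (simp add: mult.commute)
  qed
  have "AE x in lborel. indicator (ball 0 (real n)) x * f x = 0" for n
  proof (rule AE_zero_if_zero_on_generator[where E="{S. open S}" and A="\<lambda>_. UNIV"])
    fix X :: "'a set" assume "X \<in> {S. open S}"
    then have "(LINT x|lborel. indicator (X \<inter> ball 0 (real n)) x * f x) = 0"
      by (intro open_zero[of _ "real n"]) auto
    then show "(LINT x|lborel. indicator X x * (indicator (ball 0 (real n)) x * f x)) = 0"
      by (simp add: indicator_inter_arith mult.assoc)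
  qed (auto simp: loc sets_borel Int_stable_def)
  then have "AE x in lborel. \<forall>n. indicator (ball 0 (real n)) x * f x = 0" unfolding AE_all_countable by blast
  then show ?thesis
  proof (rule eventually_mono)
    fix x :: 'a assume *: "\<forall>n. indicator (ball 0 (real n)) x * f x = 0"
    obtain n where "norm x < real n" using reals_Archimedean2 by blast
    then show "f x = 0" using spec[OF *, of n] by simp
  qed
qed

section \<open>Correlations with compactly supported functions\<close>

text \<open>
  Testing \<open>f\<close> against all translates of \<open>\<psi>\<close> turns a function that is only integrable to some power into a
  bounded continuous one, and convolution with an integrable kernel is preserved
  (\<open>correlation_fubini\<close>).
\<close>

definition correlation :: "('a::euclidean_space \<Rightarrow> real) \<Rightarrow> ('a \<Rightarrow> real) \<Rightarrow> 'a \<Rightarrow> real" where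
  "correlation f \<psi> w = (LINT y|lborel. f y * \<psi> (y - w))"

lemma correlation_shift:
  assumes [measurable]: "f \<in> borel_measurable borel" "\<psi> \<in> borel_measurable borel"
  shows "correlation f \<psi> w = (LINT x|lborel. f (x + w) * \<psi> x)"
  unfolding correlation_def
  by (subst (2) lborel_distr_plus[of "-w", symmetric], subst integral_distr) (auto simp: add.commute)

text \<open>
  This replaces Hoelder's inequality wherever only finiteness matters.
\<close>

lemma abs_le_one_plus_powr:
  assumes "1 \<le> (p::real)" shows "\<bar>t\<bar> \<le> 1 + \<bar>t\<bar> powr p"
proof (cases "\<bar>t\<bar> \<le> 1")
  case False
  then have "\<bar>t\<bar> powr 1 \<le> \<bar>t\<bar> powr p" using assms by (intro powr_mono) auto
  then show ?thesis using False by simp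
qed (simp add: add_increasing2)

lemma integrable_powr_imp_locally_integrable:
  fixes f :: "'a::euclidean_space \<Rightarrow> real"
  assumes p: "1 \<le> p" and [measurable]: "f \<in> borel_measurable borel" and f: "integrable lborel (\<lambda>x. \<bar>f x\<bar> powr p)"
  shows "integrable lborel (\<lambda>x. indicator (ball 0 r) x * f x)"
proof (rule Bochner_Integration.integrable_bound)
  have [measurable]: "ball (0::'a) r \<in> sets borel" by simp
  show "(\<lambda>x. indicator (ball 0 r) x * f x) \<in> borel_measurable lborel" by measurable
  show "integrable lborel (\<lambda>x. indicator (ball 0 r) x + \<bar>f x\<bar> powr p)"
    using f emeasure_lborel_ball_finite[of "0::'a" r] by (intro Bochner_Integration.integrable_add) auto
  show "AE x in lborel. norm (indicator (ball 0 r) x * f x) \<le> norm (indicator (ball 0 r) x + \<bar>f x\<bar> powr p)"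
    using abs_le_one_plus_powr[OF p] by (auto simp: indicator_def)
qed

context
  fixes f \<psi> :: "'a::euclidean_space \<Rightarrow> real" and p :: real
  assumes p: "1 \<le> p" and f_meas [measurable]: "f \<in> borel_measurable borel"
    and f: "integrable lborel (\<lambda>x. \<bar>f x\<bar> powr p)" and \<psi>: "bump \<psi>"
begin

lemma correlation_kernel_bound:
  obtains B where "0 \<le> B"
    "\<And>w. (\<integral>\<^sup>+x. ennreal \<bar>f (x + w) * \<psi> x\<bar> \<partial>lborel) \<le> ennreal B"
proof -
  note [measurable] = bump_measurable[OF \<psi>]
  obtain A r where A: "0 < A" "\<And>x. \<bar>\<psi> x\<bar> \<le> A * indicator (ball 0 r) x" using bump_bounded[OF \<psi>] by blast
  have [measurable]: "ball (0::'a) r \<in> sets borel" by simp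
  define m where "m = measure lborel (ball (0::'a) r)"
  define F where "F = (LINT x|lborel. \<bar>f x\<bar> powr p)"
  have F: "0 \<le> F" unfolding F_def by simp
  show ?thesis
  proof (rule that[of "A * m + A * F"])
    show "0 \<le> A * m + A * F" using A F by (simp add: m_def)
    fix w :: 'a
    have "\<bar>f (x + w) * \<psi> x\<bar> \<le> A * indicator (ball 0 r) x + A * \<bar>f (x + w)\<bar> powr p" for x
    proof -
      have "\<bar>f (x + w) * \<psi> x\<bar> \<le> (1 + \<bar>f (x + w)\<bar> powr p) * (A * indicator (ball 0 r) x)"
        unfolding abs_mult using abs_le_one_plus_powr[OF p] A(2) by (intro mult_mono) auto
      also have "\<dots> \<le> A * indicator (ball 0 r) x + A * \<bar>f (x + w)\<bar> powr p"
        using A(1) by (auto simp: indicator_def algebra_simps)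
      finally show ?thesis .
    qed
    then have "(\<integral>\<^sup>+x. ennreal \<bar>f (x + w) * \<psi> x\<bar> \<partial>lborel) \<le> (\<integral>\<^sup>+x. ennreal A * indicator (ball 0 r) x + ennreal A * ennreal (\<bar>f (x + w)\<bar> powr p) \<partial>lborel)"
      using A(1) by (intro nn_integral_mono)
        (auto simp: ennreal_mult'[symmetric] ennreal_plus[symmetric] ennreal_indicator[symmetric] intro!: ennreal_leI simp del: ennreal_plus)
    also have "\<dots> = ennreal A * emeasure lborel (ball (0::'a) r) + ennreal A * (\<integral>\<^sup>+x. ennreal (\<bar>f (x + w)\<bar> powr p) \<partial>lborel)"
      by (subst nn_integral_add) (simp_all add: nn_integral_cmult nn_integral_cmult_indicator)
    also have "(\<integral>\<^sup>+x. ennreal (\<bar>f (x + w)\<bar> powr p) \<partial>lborel) = (\<integral>\<^sup>+x. ennreal (\<bar>f x\<bar> powr p) \<partial>lborel)"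
      by (subst (2) lborel_distr_plus[of w, symmetric], subst nn_integral_distr) (auto simp: add.commute)
    also have "\<dots> = ennreal F" unfolding F_def by (rule nn_integral_eq_integral[OF f]) simp
    also have "emeasure lborel (ball (0::'a) r) = ennreal m"
      unfolding m_def using emeasure_lborel_ball_finite[of "0::'a" r] by (simp add: emeasure_eq_ennreal_measure)
    also have "ennreal A * ennreal m + ennreal A * ennreal F = ennreal (A * m + A * F)"
      using A F by (simp add: m_def ennreal_mult'[symmetric] ennreal_plus[symmetric] del: ennreal_plus)
    finally show "(\<integral>\<^sup>+x. ennreal \<bar>f (x + w) * \<psi> x\<bar> \<partial>lborel) \<le> ennreal (A * m + A * F)" .
  qed
qed

lemma correlation_bounded: obtains B where "\<And>w. \<bar>correlation f \<psi> w\<bar> \<le> B"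
proof -
  note [measurable] = bump_measurable[OF \<psi>]
  obtain B where B: "0 \<le> B" "\<And>w. (\<integral>\<^sup>+x. ennreal \<bar>f (x + w) * \<psi> x\<bar> \<partial>lborel) \<le> ennreal B"
    using correlation_kernel_bound by blast
  have "\<bar>correlation f \<psi> w\<bar> \<le> B" for w
  proof -
    have "ennreal \<bar>correlation f \<psi> w\<bar> \<le> (\<integral>\<^sup>+x. ennreal \<bar>f (x + w) * \<psi> x\<bar> \<partial>lborel)"
      using integral_norm_bound_ennreal[of lborel "\<lambda>x. f (x + w) * \<psi> x"]
      by (cases "integrable lborel (\<lambda>x. f (x + w) * \<psi> x)") (simp_all add: correlation_shift not_integrable_integral_eq)
    also note B(2)
    finally show ?thesis using B(1) by simp
  qed
  then show ?thesis by (rule that)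
qed

lemma correlation_continuous: "continuous_on UNIV (correlation f \<psi>)"
  unfolding continuous_on_sequentially
proof safe
  fix x :: "nat \<Rightarrow> 'a" and w :: 'a
  assume x: "x \<longlonglongrightarrow> w"
  note [measurable] = bump_measurable[OF \<psi>]
  obtain A r where A: "0 < A" "\<And>x. \<bar>\<psi> x\<bar> \<le> A * indicator (ball 0 r) x" using bump_bounded[OF \<psi>] by blast
  obtain M where M: "\<And>n. norm (x n) \<le> M"
    using Bseq_eq_bounded[of x] convergent_imp_Bseq[OF convergentI[OF x]] by (auto simp: Bseq_def)
  show "(correlation f \<psi> \<circ> x) \<longlonglongrightarrow> correlation f \<psi> w"
    unfolding correlation_def o_def
  proof (rule integral_dominated_convergence[where w="\<lambda>y. A * \<bar>indicator (ball 0 (r + M)) y * f y\<bar>"])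
    show "integrable lborel (\<lambda>y. A * \<bar>indicator (ball 0 (r + M)) y * f y\<bar>)"
      using integrable_powr_imp_locally_integrable[OF p f_meas f] by auto
    show "AE y in lborel. (\<lambda>n. f y * \<psi> (y - x n)) \<longlonglongrightarrow> f y * \<psi> (y - w)"
    proof (intro AE_I2 tendsto_mult_left)
      fix y
      have "isCont \<psi> (y - w)" using \<psi> by (simp add: bump_def continuous_on_eq_continuous_at)
      moreover have "(\<lambda>n. y - x n) \<longlonglongrightarrow> y - w" using x by (intro tendsto_intros)
      ultimately show "(\<lambda>n. \<psi> (y - x n)) \<longlonglongrightarrow> \<psi> (y - w)" by (rule isCont_tendsto_compose)
    qed
    fix n
    show "AE y in lborel. norm (f y * \<psi> (y - x n)) \<le> A * \<bar>indicator (ball 0 (r + M)) y * f y\<bar>"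
    proof (rule AE_I2)
      fix y
      have "\<bar>\<psi> (y - x n)\<bar> \<le> A * indicator (ball 0 r) (y - x n)" by (rule A(2))
      also have "\<dots> \<le> A * indicator (ball 0 (r + M)) y"
        using M[of n] norm_triangle_sub[of y "x n"] A(1) by (auto simp: indicator_def)
      finally have "\<bar>f y\<bar> * \<bar>\<psi> (y - x n)\<bar> \<le> \<bar>f y\<bar> * (A * indicator (ball 0 (r + M)) y)"
        by (intro mult_left_mono) auto
      then show "norm (f y * \<psi> (y - x n)) \<le> A * \<bar>indicator (ball 0 (r + M)) y * f y\<bar>"
        by (simp add: abs_mult ac_simps)
    qed
  qed measurable
qed

lemma correlation_fubini:
  fixes k :: "'a \<Rightarrow> real"
  assumes k: "integrable lborel k"
  shows "(LINT w|lborel. k w * correlation f \<psi> (v + w)) = (LINT x|lborel. (LINT w|lborel. k w * f (x + v + w)) * \<psi> x)"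
proof -
  note [measurable] = bump_measurable[OF \<psi>]
  have [measurable]: "k \<in> borel_measurable borel" using borel_measurable_integrable[OF k] by simp
  obtain B where B: "0 \<le> B" "\<And>w. (\<integral>\<^sup>+x. ennreal \<bar>f (x + w) * \<psi> x\<bar> \<partial>lborel) \<le> ennreal B"
    using correlation_kernel_bound by blast
  have J: "integrable (lborel \<Otimes>\<^sub>M lborel) (\<lambda>(w, x). k w * (f (x + v + w) * \<psi> x))"
  proof (rule integrableI_bounded)
    have "(\<integral>\<^sup>+z. ennreal (norm (case z of (w, x) \<Rightarrow> k w * (f (x + v + w) * \<psi> x))) \<partial>(lborel \<Otimes>\<^sub>M lborel))
      = (\<integral>\<^sup>+w. (\<integral>\<^sup>+x. ennreal \<bar>k w\<bar> * ennreal \<bar>f (x + (v + w)) * \<psi> x\<bar> \<partial>lborel) \<partial>lborel)"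
      by (subst lborel.nn_integral_fst[symmetric]) (auto simp: abs_mult ennreal_mult'[symmetric] add.assoc)
    also have "\<dots> = (\<integral>\<^sup>+w. ennreal \<bar>k w\<bar> * (\<integral>\<^sup>+x. ennreal \<bar>f (x + (v + w)) * \<psi> x\<bar> \<partial>lborel) \<partial>lborel)"
      by (simp add: nn_integral_cmult)
    also have "\<dots> \<le> (\<integral>\<^sup>+w. ennreal \<bar>k w\<bar> * ennreal B \<partial>lborel)"
      by (intro nn_integral_mono mult_left_mono B) auto
    also have "\<dots> = (\<integral>\<^sup>+w. ennreal \<bar>k w\<bar> \<partial>lborel) * ennreal B" by (simp add: nn_integral_multc)
    also have "\<dots> < \<infinity>" using k by (auto simp: integrable_iff_bounded ennreal_mult_less_top)
    finally show "(\<integral>\<^sup>+z. ennreal (norm (case z of (w, x) \<Rightarrow> k w * (f (x + v + w) * \<psi> x))) \<partial>(lborel \<Otimes>\<^sub>M lborel)) < \<infinity>" .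
  qed measurable
  have "(LINT w|lborel. k w * correlation f \<psi> (v + w)) = (LINT w|lborel. LINT x|lborel. k w * (f (x + v + w) * \<psi> x))"
    by (simp add: correlation_shift add.assoc)
  also have "\<dots> = (LINT x|lborel. LINT w|lborel. k w * (f (x + v + w) * \<psi> x))"
    using lborel_pair.Fubini_integral[OF J] by simp
  also have "\<dots> = (LINT x|lborel. (LINT w|lborel. k w * f (x + v + w)) * \<psi> x)"
    by (simp add: mult.assoc[symmetric])
  finally show ?thesis .
qed

end

text \<open>
  Substituting \<open>w = sqrt t *\<^sub>R z\<close> fixes the Gaussian and moves \<open>t\<close> into the argument of \<open>L\<close>.
\<close>

lemma heat_approximation:
  fixes L :: "'a::euclidean_space \<Rightarrow> real"
  assumes L: "continuous_on UNIV L" "\<And>x. \<bar>L x\<bar> \<le> B" and u: "\<And>n. 0 < u n" "u \<longlonglongrightarrow> 0"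
  shows "(\<lambda>n. LINT w|lborel. heat (u n) w * L w) \<longlonglongrightarrow> L 0"
proof -
  have [measurable]: "L \<in> borel_measurable borel" using L(1) by (rule borel_measurable_continuous_onI)
  have scale: "(LINT w|lborel. heat t w * L w) = (LINT z|lborel. heat 1 z * L (sqrt t *\<^sub>R z))" if t: "0 < t" for t
  proof -
    have h: "\<bar>sqrt t\<bar> ^ DIM('a) * heat t (sqrt t *\<^sub>R z) = heat 1 z" for z :: 'a
    proof -
      have n: "sqrt t * normal_density 0 (sqrt (2 * t)) (sqrt t * s) = normal_density 0 (sqrt 2) s" for s
      proof -
        have e: "sqrt (2 * pi * (sqrt (2 * t))\<^sup>2) = sqrt (2 * pi * (sqrt 2)\<^sup>2) * sqrt t" 
          "- (sqrt t * s - 0)\<^sup>2 / (2 * (sqrt (2 * t))\<^sup>2) = - (s - 0)\<^sup>2 / (2 * (sqrt 2)\<^sup>2)"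
          using t by (simp_all add: real_sqrt_mult power_mult_distrib)
        show ?thesis unfolding normal_density_def e using t by simp
      qed
      have "\<bar>sqrt t\<bar> ^ DIM('a) * heat t (sqrt t *\<^sub>R z) = (\<Prod>b\<in>(Basis::'a set). sqrt t) * (\<Prod>b\<in>Basis. normal_density 0 (sqrt (2 * t)) (sqrt t * (z \<bullet> b)))"
        using t by (simp add: heat_def)
      also have "\<dots> = heat 1 z" unfolding heat_def prod.distrib[symmetric] n by simp
      finally show ?thesis .
    qed
    have "(LINT w|lborel. heat t w * L w) = (LINT w|density (distr lborel borel (\<lambda>x. 0 + sqrt t *\<^sub>R x)) (\<lambda>_. \<bar>sqrt t\<bar> ^ DIM('a)). heat t w * L w)"
      using lborel_affine[of "sqrt t" "0::'a"] t by simp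
    also have "\<dots> = (LINT z|lborel. \<bar>sqrt t\<bar> ^ DIM('a) * (heat t (sqrt t *\<^sub>R z) * L (sqrt t *\<^sub>R z)))"
      by (subst integral_density, measurable, simp, subst integral_distr) auto
    also have "\<dots> = (LINT z|lborel. heat 1 z * L (sqrt t *\<^sub>R z))"
      by (simp only: mult.assoc[symmetric] h)
    finally show ?thesis .
  qed
  have "(\<lambda>n. LINT z|lborel. heat 1 z * L (sqrt (u n) *\<^sub>R z)) \<longlonglongrightarrow> (LINT z|lborel. heat 1 (z::'a) * L 0)"
  proof (rule integral_dominated_convergence[where w="\<lambda>z::'a. heat 1 z * B"])
    show "integrable lborel (\<lambda>z. heat 1 (z::'a) * B)" using integrable_heat[of 1, where 'a='a] by simp
    show "AE z in lborel. (\<lambda>n. heat 1 z * L (sqrt (u n) *\<^sub>R z)) \<longlonglongrightarrow> heat 1 z * L 0"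
    proof (intro AE_I2 tendsto_mult_left)
      fix z :: 'a
      have "(\<lambda>n. sqrt (u n) *\<^sub>R z) \<longlonglongrightarrow> sqrt 0 *\<^sub>R z" using u by (intro tendsto_intros)
      moreover have "isCont L 0" using L(1) by (simp add: continuous_on_eq_continuous_at)
      ultimately show "(\<lambda>n. L (sqrt (u n) *\<^sub>R z)) \<longlonglongrightarrow> L 0" using isCont_tendsto_compose by fastforce
    qed
    fix n
    show "AE z in lborel. norm (heat 1 z * L (sqrt (u n) *\<^sub>R z)) \<le> heat 1 z * B"
      using L(2) by (auto simp: abs_mult intro!: mult_left_mono)
  qed measurable
  then show ?thesis using integral_heat[of 1, where 'a='a] by (simp add: scale u)
qed

section \<open>Averages against gamma densities\<close>

text \<open>
  Up to the factor \<open>exp t / Gamma a\<close> this is the fractional integral of order \<open>a\<close> on the half-line above \<open>t\<close>, applied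
  to \<open>k r * exp (- r)\<close>.
\<close>

definition gamma_mean :: "real \<Rightarrow> (real \<Rightarrow> real) \<Rightarrow> real \<Rightarrow> real" where
  "gamma_mean a k t = (LINT r|lborel. gamma_weight a r * k (r + t))"

lemma integral_gamma_weight: "0 < a \<Longrightarrow> (LINT r|lborel. gamma_weight a r) = 1"
  by (subst integral_eq_nn_integral) (auto simp: gamma_weight_nonneg nn_integral_gamma_weight)

lemma integrable_gamma_weight: "0 < a \<Longrightarrow> integrable lborel (gamma_weight a)"
  by (intro integrableI_nonneg) (auto simp: gamma_weight_nonneg nn_integral_gamma_weight)

lemma integrable_gamma_weight_mult:
  assumes "0 < a" "k \<in> borel_measurable borel" "\<And>x. \<bar>k x\<bar> \<le> (B::real)"
  shows "integrable lborel (\<lambda>r. gamma_weight a r * k (r + t))"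
proof (rule Bochner_Integration.integrable_bound[where f="\<lambda>r. gamma_weight a r * B"])
  show "integrable lborel (\<lambda>r. gamma_weight a r * B)" using integrable_gamma_weight assms by simp
  have "norm (gamma_weight a r * k (r + t)) \<le> norm (gamma_weight a r * B)" for r
    using assms(3)[of "r + t"] assms(1) by (auto simp: abs_mult gamma_weight_nonneg intro!: mult_left_mono)
  then show "AE r in lborel. norm (gamma_weight a r * k (r + t)) \<le> norm (gamma_weight a r * B)" by simp
qed (use assms in measurable)

lemma gamma_mean_measurable [measurable]:
  assumes [measurable]: "k \<in> borel_measurable borel"
  shows "gamma_mean a k \<in> borel_measurable borel"
  unfolding gamma_mean_def[abs_def] by measurable

lemma gamma_mean_bounded:
  assumes "0 < a" and [measurable]: "k \<in> borel_measurable borel" and "\<And>x. \<bar>k x\<bar> \<le> B"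
  shows "\<bar>gamma_mean a k t\<bar> \<le> B"
proof -
  have "\<bar>gamma_mean a k t\<bar> \<le> (LINT r|lborel. \<bar>gamma_weight a r * k (r + t)\<bar>)"
    unfolding gamma_mean_def by (rule integral_abs_bound)
  also have "\<dots> \<le> (LINT r|lborel. gamma_weight a r * B)"
  proof (rule integral_mono)
    show "integrable lborel (\<lambda>r. \<bar>gamma_weight a r * k (r + t)\<bar>)"
      by (intro integrable_abs integrable_gamma_weight_mult[OF assms])
    show "integrable lborel (\<lambda>r. gamma_weight a r * B)"
      using integrable_gamma_weight assms(1) by simp
  qed (use assms in \<open>auto simp: abs_mult gamma_weight_nonneg intro!: mult_left_mono\<close>)
  finally show ?thesis using assms by (simp add: integral_gamma_weight)
qed

text \<open>
  This is the Beta integral after rescaling to the unit interval.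
\<close>

lemma gamma_weight_convolution:
  assumes a: "0 < a" and b: "0 < b"
  shows "(\<integral>\<^sup>+s. ennreal (gamma_weight b s * gamma_weight a (w - s)) \<partial>lborel) = ennreal (gamma_weight (a + b) w)"
proof (cases "0 < w")
  case w: True
  have G: "0 < Gamma a" "0 < Gamma b" "0 < Gamma (a + b)" using a b by (auto intro: Gamma_real_pos)
  define c where "c = w powr (a + b - 2) / exp w / (Gamma a * Gamma b)"
  have c: "0 \<le> c" using G by (simp add: c_def)
  have "(\<integral>\<^sup>+s. ennreal (gamma_weight b s * gamma_weight a (w - s)) \<partial>lborel)
     = ennreal w * (\<integral>\<^sup>+u. ennreal (gamma_weight b (w * u) * gamma_weight a (w - w * u)) \<partial>lborel)"
    using w by (subst nn_integral_real_affine[of _ w 0]) auto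
  also have "(\<integral>\<^sup>+u. ennreal (gamma_weight b (w * u) * gamma_weight a (w - w * u)) \<partial>lborel)
     = (\<integral>\<^sup>+u. ennreal c * (ennreal (u powr (b - 1) * (1 - u) powr (a - 1)) * indicator {0..1} u) \<partial>lborel)"
  proof (intro nn_integral_cong)
    fix u :: real
    show "ennreal (gamma_weight b (w * u) * gamma_weight a (w - w * u))
       = ennreal c * (ennreal (u powr (b - 1) * (1 - u) powr (a - 1)) * indicator {0..1} u)"
    proof (cases "u \<in> {0..1}")
      case True
      have e: "exp (w * u) * exp (w - w * u) = exp w" by (simp add: exp_add[symmetric])
      have p: "w powr (b - 1) * w powr (a - 1) = w powr (a + b - 2)"
        unfolding powr_add[symmetric] by (rule arg_cong[where f="\<lambda>s. w powr s"]) simp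
      have m: "w - w * u = w * (1 - u)" by (simp add: algebra_simps)
      have "gamma_weight b (w * u) * gamma_weight a (w - w * u) =
         (w powr (b - 1) * w powr (a - 1)) * (u powr (b - 1) * (1 - u) powr (a - 1)) / (exp (w * u) * exp (w - w * u)) / (Gamma a * Gamma b)"
        using True w by (simp add: gamma_weight_def powr_mult m) (simp add: ac_simps)
      also have "\<dots> = c * (u powr (b - 1) * (1 - u) powr (a - 1))" unfolding e p c_def by simp
      finally show ?thesis using True c by (simp add: ennreal_mult'[symmetric])
    next
      case False
      then have "w * u < 0 \<or> w - w * u < 0" using w by (auto simp: mult_less_0_iff)
      then have z: "gamma_weight b (w * u) * gamma_weight a (w - w * u) = 0"
        using gamma_weight_eq_0 by (metis less_imp_le mult_eq_0_iff)
      show ?thesis unfolding z using False by simp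
    qed
  qed
  also have "\<dots> = ennreal c * ennreal (Beta b a)"
    using has_integral_Beta_real[OF b a] 
    by (subst nn_integral_cmult) (auto intro!: arg_cong2[where f="(*)"] nn_integral_has_integral_lebesgue')
  also have "ennreal w * (ennreal c * ennreal (Beta b a)) = ennreal (w * c * Beta b a)"
    using w c by (simp add: ennreal_mult'[symmetric] mult.assoc)
  also have "w * c * Beta b a = gamma_weight (a + b) w"
  proof -
    have "w powr 1 * w powr (a + b - 2) = w powr (a + b - 1)" unfolding powr_add[symmetric] by simp
    then have "w * w powr (a + b - 2) = w powr (a + b - 1)" using w by simp
    then show ?thesis using w G by (simp add: c_def gamma_weight_def Beta_def add.commute)
  qed
  finally show ?thesis .
next
  case False
  have z: "gamma_weight b s * gamma_weight a (w - s) = 0" for s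
    using False gamma_weight_eq_0[of s b] gamma_weight_eq_0[of "w - s" a] by (cases "s \<le> 0") auto
  show ?thesis unfolding z using False by (simp add: gamma_weight_eq_0)
qed

lemma gamma_mean_add:
  assumes a: "0 < a" and b: "0 < b" and [measurable]: "k \<in> borel_measurable borel" and B: "\<And>x. \<bar>k x\<bar> \<le> B"
  shows "gamma_mean b (gamma_mean a k) t = gamma_mean (a + b) k t"
proof -
  have B0: "0 \<le> B" using B[of 0] by linarith
  have J: "integrable (lborel \<Otimes>\<^sub>M lborel) (\<lambda>(s, w). gamma_weight b s * gamma_weight a (w - s) * k (w + t))"
  proof (rule integrableI_bounded)
    have "(\<integral>\<^sup>+z. ennreal (norm (case z of (s, w) \<Rightarrow> gamma_weight b s * gamma_weight a (w - s) * k (w + t))) \<partial>(lborel \<Otimes>\<^sub>M lborel))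
      \<le> (\<integral>\<^sup>+z. (case z of (s, w) \<Rightarrow> ennreal (gamma_weight b s * gamma_weight a (w - s)) * ennreal B) \<partial>(lborel \<Otimes>\<^sub>M lborel))"
      using B a b B0 by (intro nn_integral_mono)
        (auto simp: ennreal_mult'[symmetric] abs_mult gamma_weight_nonneg intro!: ennreal_leI mult_left_mono)
    also have "\<dots> = (\<integral>\<^sup>+w. (\<integral>\<^sup>+s. ennreal (gamma_weight b s * gamma_weight a (w - s)) * ennreal B \<partial>lborel) \<partial>lborel)"
      by (subst lborel_pair.nn_integral_snd[symmetric]) auto
    also have "\<dots> = (\<integral>\<^sup>+w. ennreal (gamma_weight (a + b) w) \<partial>lborel) * ennreal B"
      using a b by (simp add: nn_integral_multc gamma_weight_convolution)
    also have "\<dots> < \<infinity>" using a b by (simp add: nn_integral_gamma_weight)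
    finally show "(\<integral>\<^sup>+z. ennreal (norm (case z of (s, w) \<Rightarrow> gamma_weight b s * gamma_weight a (w - s) * k (w + t))) \<partial>(lborel \<Otimes>\<^sub>M lborel)) < \<infinity>" .
  qed measurable
  have "gamma_mean b (gamma_mean a k) t = (LINT s|lborel. LINT w|lborel. gamma_weight b s * gamma_weight a (w - s) * k (w + t))"
    unfolding gamma_mean_def
  proof (intro Bochner_Integration.integral_cong refl)
    fix s :: real
    have "(LINT r|lborel. gamma_weight a r * k (r + (s + t))) = (LINT w|lborel. gamma_weight a (w - s) * k (w + t))"
      by (subst lborel_integral_real_affine[of 1 _ "- s"]) auto
    then show "gamma_weight b s * (LINT r|lborel. gamma_weight a r * k (r + (s + t)))
       = (LINT w|lborel. gamma_weight b s * gamma_weight a (w - s) * k (w + t))"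
      by (simp add: mult.assoc)
  qed
  also have "\<dots> = (LINT w|lborel. LINT s|lborel. gamma_weight b s * gamma_weight a (w - s) * k (w + t))"
    using lborel_pair.Fubini_integral[OF J] by simp
  also have "\<dots> = gamma_mean (a + b) k t"
    unfolding gamma_mean_def
  proof (intro Bochner_Integration.integral_cong refl)
    fix w :: real
    have "(LINT s|lborel. gamma_weight b s * gamma_weight a (w - s)) = gamma_weight (a + b) w"
      using a b by (subst integral_eq_nn_integral) (auto simp: gamma_weight_nonneg gamma_weight_convolution)
    then show "(LINT s|lborel. gamma_weight b s * gamma_weight a (w - s) * k (w + t)) = gamma_weight (a + b) w * k (w + t)"
      by simp
  qed
  finally show ?thesis .
qed

lemma AE_imp_sequence_from_right:
  fixes t :: real
  assumes t: "0 \<le> t" and AE: "AE u in lborel. 0 < u \<longrightarrow> P u"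
  obtains u :: "nat \<Rightarrow> real" where "\<And>n. t < u n" "\<And>n. P (u n)" "u \<longlonglongrightarrow> t"
proof -
  have "\<exists>u. u \<in> {t<..<t + 1 / real (Suc n)} \<and> P u" for n
  proof (rule ccontr)
    assume "\<not> ?thesis"
    then have "AE u in lborel. u \<notin> {t<..<t + 1 / real (Suc n)}"
      using AE t by (auto elim!: eventually_mono)
    then have "{t<..<t + 1 / real (Suc n)} \<in> null_sets lborel"
      by (subst AE_iff_null_sets) auto
    then have "emeasure lborel {t<..<t + 1 / real (Suc n)} = 0" by (rule null_setsD1)
    then show False by simp
  qed
  then obtain u where u: "\<And>n. u n \<in> {t<..<t + 1 / real (Suc n)}" "\<And>n. P (u n)" by metis
  have "(\<lambda>n. t + 1 / real (Suc n)) \<longlonglongrightarrow> t + 0" by (intro tendsto_intros LIMSEQ_Suc lim_1_over_n)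
  then have "(\<lambda>n. t + 1 / real (Suc n)) \<longlonglongrightarrow> t" by simp
  then have "u \<longlonglongrightarrow> t"
    by (rule tendsto_sandwich[rotated 2, OF tendsto_const])
      (use u(1) in \<open>auto intro!: always_eventually simp: less_imp_le\<close>)
  with u show thesis by (intro that[of u]) auto
qed

text \<open>
  For order one the mean is \<open>exp t\<close> times the integral of \<open>exp (- s) * k s\<close> over \<open>s > t\<close>. If it vanishes for
  almost all \<open>t\<close>, then it vanishes for all \<open>t\<close> by continuity, and half-lines generate the Borel sets.
\<close>

lemma gamma_mean_1_injective:
  assumes [measurable]: "k \<in> borel_measurable borel" and B: "\<And>x. \<bar>k x\<bar> \<le> B"
    and zero: "AE t in lborel. 0 < t \<longrightarrow> gamma_mean 1 k t = 0"
  shows "AE t in lborel. 0 < t \<longrightarrow> k t = 0"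
proof -
  define H where "H s = indicator {0<..} s * exp (- s) * k s" for s
  have [measurable]: "H \<in> borel_measurable borel" unfolding H_def by measurable
  have g1: "gamma_weight 1 r = indicator {0<..} r * exp (- r)" if "r \<noteq> 0" for r
    using that by (auto simp: gamma_weight_def indicator_def exp_minus inverse_eq_divide)
  have H_int: "integrable lborel H"
  proof (rule integrable_cong_AE_imp[OF integrable_gamma_weight_mult[of 1 k B 0]])
    show "AE x in lborel. gamma_weight 1 x * k (x + 0) = H x"
      using AE_lborel_singleton[of 0] by (rule eventually_mono) (simp add: g1 H_def)
  qed (use assms in auto)
  have tail: "(LINT s|lborel. indicator {t<..} s * H s) = exp (- t) * gamma_mean 1 k t" if t: "0 < t" for t
  proof -
    have "(LINT s|lborel. indicator {t<..} s * H s) = (LINT r|lborel. indicator {t<..} (t + r) * H (t + r))"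
      by (subst lborel_integral_real_affine[of 1 _ t]) auto
    also have "\<dots> = (LINT r|lborel. exp (- t) * (gamma_weight 1 r * k (r + t)))"
    proof (rule integral_cong_AE)
      show "AE r in lborel. indicator {t<..} (t + r) * H (t + r) = exp (- t) * (gamma_weight 1 r * k (r + t))"
        using AE_lborel_singleton[of 0]
        by (rule eventually_mono) (use t in \<open>auto simp: g1 H_def exp_add[symmetric] add.commute split: split_indicator\<close>)
    qed measurable
    finally show ?thesis by (simp add: gamma_mean_def)
  qed
  have zero_tail: "(LINT s|lborel. indicator {t<..} s * H s) = 0" if t: "0 \<le> t" for t
  proof -
    obtain u where u: "\<And>n. t < u n" "\<And>n. gamma_mean 1 k (u n) = 0" and lim: "u \<longlonglongrightarrow> t"
      using AE_imp_sequence_from_right[OF t zero] by blast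
    have "(\<lambda>n. LINT s|lborel. indicator {u n<..} s * H s) \<longlonglongrightarrow> (LINT s|lborel. indicator {t<..} s * H s)"
    proof (rule integral_dominated_convergence[where w="\<lambda>s. \<bar>H s\<bar>"])
      show "AE s in lborel. (\<lambda>n. indicator {u n<..} s * H s) \<longlonglongrightarrow> indicator {t<..} s * H s"
      proof (intro AE_I2 tendsto_mult_right tendsto_eventually)
        fix s
        show "\<forall>\<^sub>F n in sequentially. indicat_real {u n<..} s = indicat_real {t<..} s"
        proof (cases "t < s")
          case True
          then have "\<forall>\<^sub>F n in sequentially. u n < s" using order_tendstoD(2)[OF lim] by blast
          then show ?thesis using True by (auto elim!: eventually_mono simp: indicator_def)
        next
          case False
          have "\<not> u n < s" for n using False u(1)[of n] by auto
          then show ?thesis using False by simp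
        qed
      qed
    qed (use H_int in \<open>auto simp: indicator_def\<close>)
    moreover have "(LINT s|lborel. indicator {u n<..} s * H s) = 0" for n
      using u[of n] t by (subst tail) (auto intro: order_le_less_trans)
    ultimately have "(\<lambda>n. 0 :: real) \<longlonglongrightarrow> (LINT s|lborel. indicator {t<..} s * H s)" by simp
    from LIMSEQ_unique[OF tendsto_const this] show ?thesis by simp
  qed
  have "AE s in lborel. H s = 0"
  proof (rule AE_zero_if_zero_on_generator[OF H_int, where E="range greaterThan" and A="\<lambda>i. {- real i<..}"])
    fix X assume "X \<in> range (greaterThan :: real \<Rightarrow> _)"
    then obtain t where X: "X = {t<..}" by auto
    have "(LINT s|lborel. indicator {t<..} s * H s) = (LINT s|lborel. indicator {max t 0<..} s * H s)"
      by (intro Bochner_Integration.integral_cong) (auto simp: H_def indicator_def)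
    then show "(LINT s|lborel. indicator X s * H s) = 0" unfolding X by (simp add: zero_tail)
  next
    show "(\<Union>i. {- real i<..}) = UNIV"
    proof -
      have "\<exists>i. - real i < x" for x using reals_Archimedean2[of "- x"] by (auto simp: minus_less_iff)
      then show ?thesis by auto
    qed
    have "greaterThan s \<inter> greaterThan t = greaterThan (max s t)" for s t :: real by auto
    then show "Int_stable (range (greaterThan :: real \<Rightarrow> _))" by (auto simp: Int_stable_def)
    show "sets borel = sigma_sets UNIV (range (greaterThan :: real \<Rightarrow> _))"
      by (subst borel_Ioi) (simp add: sets_measure_of)
  qed auto
  then show ?thesis by (rule eventually_mono) (auto simp: H_def)
qed

text \<open>
  A further mean raises the order from \<open>a\<close> to the next larger integer, and the orders that are integers
  are peeled off one by one.
\<close>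

lemma gamma_mean_injective:
  assumes a: "0 < a" and [measurable]: "k \<in> borel_measurable borel" and B: "\<And>x. \<bar>k x\<bar> \<le> B"
    and zero: "\<And>t. 0 < t \<Longrightarrow> gamma_mean a k t = 0"
  shows "AE t in lborel. 0 < t \<longrightarrow> k t = 0"
proof -
  have nat: "(AE t in lborel. 0 < t \<longrightarrow> gamma_mean (real (Suc n)) k t = 0) \<Longrightarrow> AE t in lborel. 0 < t \<longrightarrow> k t = 0" for n
  proof (induction n)
    case 0
    then show ?case using gamma_mean_1_injective[of k B] B by simp
  next
    case (Suc n)
    have "AE t in lborel. 0 < t \<longrightarrow> gamma_mean (real (Suc n)) k t = 0"
    proof (rule gamma_mean_1_injective[where B=B])
      show "AE t in lborel. 0 < t \<longrightarrow> gamma_mean 1 (gamma_mean (real (Suc n)) k) t = 0"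
        using Suc.prems by (subst gamma_mean_add[where B=B]) (auto simp: B add.commute)
    qed (use B in \<open>auto intro!: gamma_mean_bounded\<close>)
    then show ?case by (rule Suc.IH)
  qed
  \<comment> \<open>The order \<open>real (Suc n) - a\<close> of the additional mean has to be positive.\<close>
  obtain n where n: "a < real (Suc n)" using reals_Archimedean2[of a] by (metis lessI less_trans of_nat_less_iff)
  show ?thesis
  proof (rule nat[of n])
    have "gamma_mean (real (Suc n)) k t = 0" if t: "0 < t" for t
    proof -
      have "gamma_mean (real (Suc n)) k t = gamma_mean (real (Suc n) - a) (gamma_mean a k) t"
        using a n B by (subst gamma_mean_add[where B=B]) auto
      also have "\<dots> = (LINT r|(lborel :: real measure). 0)"
        unfolding gamma_mean_def[of "real (Suc n) - a"]
      proof (intro Bochner_Integration.integral_cong refl)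
        fix r show "gamma_weight (real (Suc n) - a) r * gamma_mean a k (r + t) = 0"
          using t zero[of "r + t"] by (cases "r \<le> 0") (auto simp: gamma_weight_eq_0)
      qed
      finally show ?thesis by simp
    qed
    then show "AE t in lborel. 0 < t \<longrightarrow> gamma_mean (real (Suc n)) k t = 0" by simp
  qed
qed

section \<open>Injectivity of heat mixtures and of the Fourier transform\<close>

lemma heat_semigroup:
  fixes L :: "'a::euclidean_space \<Rightarrow> real"
  assumes s: "0 < s" and t: "0 < t" and [measurable]: "L \<in> borel_measurable borel" and B: "\<And>x. \<bar>L x\<bar> \<le> B"
  shows "(LINT v|lborel. heat t v * (LINT w|lborel. heat s w * L (v + w))) = (LINT w|lborel. heat (s + t) w * L w)"
proof -
  have B0: "0 \<le> B" using B[of 0] by linarith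
  have J: "integrable (lborel \<Otimes>\<^sub>M lborel) (\<lambda>(v, z). heat s (z - v) * heat t v * L z)"
  proof (rule integrableI_bounded)
    have "(\<integral>\<^sup>+x. ennreal (norm (case x of (v, z) \<Rightarrow> heat s (z - v) * heat t v * L z)) \<partial>(lborel \<Otimes>\<^sub>M lborel))
      \<le> (\<integral>\<^sup>+x. (case x of (v, z) \<Rightarrow> ennreal (heat s (z - v) * heat t v) * ennreal B) \<partial>(lborel \<Otimes>\<^sub>M (lborel :: 'a measure)))"
      using B B0 by (intro nn_integral_mono)
        (auto simp: ennreal_mult'[symmetric] abs_mult intro!: ennreal_leI mult_left_mono)
    also have "\<dots> = (\<integral>\<^sup>+z. (\<integral>\<^sup>+v. ennreal (heat s (z - v) * heat t v) * ennreal B \<partial>lborel) \<partial>(lborel :: 'a measure))"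
      by (subst lborel_pair.nn_integral_snd[symmetric]) auto
    also have "\<dots> = (\<integral>\<^sup>+z. ennreal (heat (s + t) z) \<partial>(lborel :: 'a measure)) * ennreal B"
      using s t by (simp add: nn_integral_multc heat_convolution)
    also have "\<dots> < \<infinity>" using s t by (simp add: nn_integral_heat)
    finally show "(\<integral>\<^sup>+x. ennreal (norm (case x of (v, z) \<Rightarrow> heat s (z - v) * heat t v * L z)) \<partial>(lborel \<Otimes>\<^sub>M lborel)) < \<infinity>" .
  qed measurable
  have "(LINT v|lborel. heat t v * (LINT w|lborel. heat s w * L (v + w))) = (LINT v|lborel. LINT z|lborel. heat s (z - v) * heat t v * L z)"
  proof (intro Bochner_Integration.integral_cong refl)
    fix v :: 'a
    have "(LINT w|lborel. heat s w * L (v + w)) = (LINT z|lborel. heat s (z - v) * L z)"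
      by (subst (2) lborel_distr_plus[of v, symmetric], subst integral_distr) auto
    then show "heat t v * (LINT w|lborel. heat s w * L (v + w)) = (LINT z|lborel. heat s (z - v) * heat t v * L z)"
      by (simp add: mult.assoc mult.left_commute[of _ "heat t v"])
  qed
  also have "\<dots> = (LINT z|lborel. LINT v|lborel. heat s (z - v) * heat t v * L z)"
    using lborel_pair.Fubini_integral[OF J] by simp
  also have "\<dots> = (LINT z|lborel. heat (s + t) z * L z)"
  proof (intro Bochner_Integration.integral_cong refl)
    fix z :: 'a
    have "(LINT v|lborel. heat s (z - v) * heat t v) = heat (s + t) z"
      using s t by (subst integral_eq_nn_integral) (auto simp: heat_convolution)
    then show "(LINT v|lborel. heat s (z - v) * heat t v * L z) = heat (s + t) z * L z" by simp
  qed
  finally show ?thesis .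
qed

lemma heat_average_bounded:
  fixes L :: "'a::euclidean_space \<Rightarrow> real"
  assumes s: "0 < s" and [measurable]: "L \<in> borel_measurable borel" and B: "\<And>x. \<bar>L x\<bar> \<le> B"
  shows "\<bar>LINT w|lborel. heat s w * L (v + w)\<bar> \<le> B"
proof -
  have I: "integrable lborel (\<lambda>w::'a. heat s w * B)" using integrable_heat[OF s, where 'a='a] by simp
  have le: "norm (heat s w * L (v + w)) \<le> norm (heat s w * B)" for w
    using B[of "v + w"] by (auto simp: abs_mult intro!: mult_left_mono)
  have "integrable lborel (\<lambda>w. heat s w * L (v + w))"
    by (rule Bochner_Integration.integrable_bound[OF I _ AE_I2[OF le]]) measurable
  then have "\<bar>LINT w|lborel. heat s w * L (v + w)\<bar> \<le> (LINT w|lborel. norm (heat s w * L (v + w)))"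
    using integral_norm_bound by (metis real_norm_def)
  also have "\<dots> \<le> (LINT w|lborel. heat s (w::'a) * B)"
    using I \<open>integrable lborel (\<lambda>w. heat s w * L (v + w))\<close> B
    by (intro integral_mono integrable_norm) (auto simp: abs_mult intro!: mult_left_mono)
  also have "\<dots> = B" using integral_heat[OF s, where 'a='a] by simp
  finally show ?thesis .
qed

text \<open>
  Averaging the hypothesis over \<open>v\<close> with the heat kernel at time \<open>t\<close> shifts the time by \<open>t\<close>, by the semigroup
  law. Thus the function \<open>K\<close> that maps \<open>u\<close> to the heat average of \<open>L\<close> at time \<open>u\<close> has vanishing gamma
  means and is zero at almost all times. Letting the time tend to zero recovers \<open>L 0\<close>.
\<close>

lemma heat_mixture_annihilates:
  fixes L :: "'a::euclidean_space \<Rightarrow> real"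
  assumes a: "0 < a" and cont: "continuous_on UNIV L" and B: "\<And>x. \<bar>L x\<bar> \<le> B"
    and zero: "\<And>v. (LINT w|lborel. heat_mixture a w * L (v + w)) = 0"
  shows "L 0 = 0"
proof -
  have [measurable]: "L \<in> borel_measurable borel" using cont by (rule borel_measurable_continuous_onI)
  have B0: "0 \<le> B" using B[of 0] by linarith
  define K where "K u = (if 0 < u then LINT w|lborel. heat u w * L w else 0)" for u
  have [measurable]: "K \<in> borel_measurable borel" unfolding K_def by measurable
  have KB: "\<bar>K u\<bar> \<le> B" for u using heat_average_bounded[of u L B 0] B B0 by (auto simp: K_def)
  have "gamma_mean a K t = 0" if t: "0 < t" for t
  proof -
    define h where "h r v = (LINT w|lborel. heat r w * L (v + w))" for r and v :: 'a
    have h_meas[measurable]: "(\<lambda>(v, r). h r v) \<in> borel_measurable (borel \<Otimes>\<^sub>M borel)"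
      unfolding h_def by measurable
    have J: "integrable (lborel \<Otimes>\<^sub>M lborel) (\<lambda>(v, r). heat t v * (gamma_weight a r * h r v))"
    proof (rule integrableI_bounded)
      have "(\<integral>\<^sup>+x. ennreal (norm (case x of (v, r) \<Rightarrow> heat t v * (gamma_weight a r * h r v))) \<partial>(lborel \<Otimes>\<^sub>M lborel))
        \<le> (\<integral>\<^sup>+x. (case x of (v, r) \<Rightarrow> ennreal (heat t v) * (ennreal (gamma_weight a r) * ennreal B)) \<partial>((lborel :: 'a measure) \<Otimes>\<^sub>M lborel))"
      proof (intro nn_integral_mono, clarify)
        fix v :: 'a and r :: real
        have "\<bar>gamma_weight a r * h r v\<bar> \<le> gamma_weight a r * B"
          using heat_average_bounded[of r L B v] B a
          by (cases "0 < r") (auto simp: h_def abs_mult gamma_weight_nonneg gamma_weight_eq_0 intro!: mult_left_mono)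
        then have "norm (heat t v * (gamma_weight a r * h r v)) \<le> heat t v * (gamma_weight a r * B)"
          by (simp add: abs_mult[of "heat t v"] mult_left_mono)
        then show "ennreal (norm (heat t v * (gamma_weight a r * h r v))) \<le> ennreal (heat t v) * (ennreal (gamma_weight a r) * ennreal B)"
          using a B0 by (simp add: ennreal_mult'[symmetric] gamma_weight_nonneg ennreal_leI del: real_norm_def)
      qed
      also have "\<dots> = (\<integral>\<^sup>+v. ennreal (heat t v) * ((\<integral>\<^sup>+r. ennreal (gamma_weight a r) \<partial>lborel) * ennreal B) \<partial>(lborel :: 'a measure))"
        by (subst lborel.nn_integral_fst[symmetric]) (auto simp: nn_integral_cmult nn_integral_multc)
      also have "\<dots> < \<infinity>" using a t by (simp add: nn_integral_gamma_weight nn_integral_multc nn_integral_heat)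
      finally show "(\<integral>\<^sup>+x. ennreal (norm (case x of (v, r) \<Rightarrow> heat t v * (gamma_weight a r * h r v))) \<partial>(lborel \<Otimes>\<^sub>M lborel)) < \<infinity>" .
    qed measurable
    have inner: "(LINT r|lborel. gamma_weight a r * h r v) = 0" for v
      using heat_mixture_integral(2)[OF a, of "\<lambda>w. L (v + w)" B] B zero[of v] by (simp add: h_def)
    have "0 = (LINT v|lborel. LINT r|lborel. heat t v * (gamma_weight a r * h r v))"
      by (simp add: inner)
    also have "\<dots> = (LINT r|lborel. LINT v|lborel. heat t v * (gamma_weight a r * h r v))"
      using lborel_pair.Fubini_integral[OF J] by simp
    also have "\<dots> = (LINT r|lborel. gamma_weight a r * (LINT v|lborel. heat t v * h r v))"
      by (simp add: mult.left_commute[of "heat t _"])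
    also have "\<dots> = gamma_mean a K t"
      unfolding gamma_mean_def
    proof (intro Bochner_Integration.integral_cong refl)
      fix r :: real
      show "gamma_weight a r * (LINT v|lborel. heat t v * h r v) = gamma_weight a r * K (r + t)"
        using heat_semigroup[of r t L B] B t by (cases "0 < r") (simp_all add: gamma_weight_eq_0 h_def K_def)
    qed
    finally show ?thesis by simp
  qed
  then have AE: "AE u in lborel. 0 < u \<longrightarrow> K u = 0"
    using gamma_mean_injective[OF a, of K B] KB by simp
  obtain u where u: "\<And>n. 0 < u n" "\<And>n. K (u n) = 0" and lim: "u \<longlonglongrightarrow> 0"
    using AE_imp_sequence_from_right[OF order_refl AE] by blast
  have "(\<lambda>n. LINT w|lborel. heat (u n) w * L w) \<longlonglongrightarrow> L 0"
    using u(1) lim by (intro heat_approximation[OF cont B]) auto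
  moreover have "(LINT w|lborel. heat (u n) w * L w) = 0" for n
    using u[of n] by (simp add: K_def)
  ultimately have "(\<lambda>n. 0 :: real) \<longlonglongrightarrow> L 0" by simp
  from LIMSEQ_unique[OF tendsto_const this] show ?thesis by simp
qed

lemma heat_mixture_convolution_injective:
  fixes f :: "'a::euclidean_space \<Rightarrow> real"
  assumes a: "0 < a" and p: "1 \<le> p" and f_meas[measurable]: "f \<in> borel_measurable borel"
    and f: "integrable lborel (\<lambda>x. \<bar>f x\<bar> powr p)"
    and zero: "AE x in lborel. (LINT y|lborel. heat_mixture a (x - y) * f y) = 0"
  shows "AE x in lborel. f x = 0"
proof (rule AE_zero_if_zero_against_bumps[OF f_meas])
  show "integrable lborel (\<lambda>x. indicator (ball 0 r) x * f x)" for r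
    by (rule integrable_powr_imp_locally_integrable[OF p f_meas f])
  fix \<psi> :: "'a \<Rightarrow> real" assume \<psi>: "bump \<psi>"
  note [measurable] = bump_measurable[OF \<psi>]
  define c where "c x = (LINT y|lborel. heat_mixture a (x - y) * f y)" for x
  have [measurable]: "c \<in> borel_measurable borel" unfolding c_def by measurable
  obtain B where B: "\<And>w. \<bar>correlation f \<psi> w\<bar> \<le> B" using correlation_bounded[OF p f_meas f \<psi>] by blast
  have "correlation f \<psi> 0 = 0"
  proof (rule heat_mixture_annihilates[OF a correlation_continuous[OF p f_meas f \<psi>] B])
    fix v :: 'a
    have inner: "(LINT w|lborel. heat_mixture a w * f (x + v + w)) = c (x + v)" for x
    proof -
      have "c (x + v) = (LINT w|lborel. heat_mixture a (x + v - (x + v + w)) * f (x + v + w))"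
        unfolding c_def by (subst lborel_distr_plus[of "x + v", symmetric], subst integral_distr) auto
      also have "(\<lambda>w. heat_mixture a (x + v - (x + v + w))) = heat_mixture a"
        by (rule ext) (metis add_diff_cancel_left' diff_add_cancel heat_mixture_uminus minus_diff_eq)
      finally show ?thesis by (metis (no_types, lifting))
    qed
    have "AE x in distr lborel borel (\<lambda>x. v + x). c x = 0" unfolding lborel_distr_plus using zero by (simp add: c_def)
    then have "AE x in lborel. c (x + v) = 0" by (subst (asm) AE_distr_iff) (auto simp: add.commute)
    then have "(LINT x|lborel. c (x + v) * \<psi> x) = (LINT x|(lborel :: 'a measure). 0)"
      by (intro integral_cong_AE) auto
    then show "(LINT w|lborel. heat_mixture a w * correlation f \<psi> (v + w)) = 0"
      by (subst correlation_fubini[OF p f_meas f \<psi> integrable_heat_mixture[OF a]]) (simp add: inner)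
  qed
  then show "(LINT x|lborel. f x * \<psi> x) = 0" by (simp add: correlation_def)
qed

text \<open>
  Gaussians are Fourier transforms of Gaussians, hence all heat averages of \<open>f\<close> vanish, and so do those
  of its correlations.
\<close>

lemma fourier_unique:
  fixes f :: "'a::euclidean_space \<Rightarrow> real"
  assumes f: "integrable lborel f"
    and zero: "\<And>\<xi>. (LINT x|lborel. f x *\<^sub>R exp (- \<i> * complex_of_real (\<xi> \<bullet> x))) = 0"
  shows "AE x in lborel. f x = 0"
proof -
  have f_meas[measurable]: "f \<in> borel_measurable borel" using borel_measurable_integrable[OF f] by simp
  have f1: "integrable lborel (\<lambda>x. \<bar>f x\<bar> powr 1)" using f by simp
  have gauss: "(LINT x|lborel. f x * heat u (x - y)) = 0" if u: "0 < u" for u and y :: 'a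
  proof -
    define t where "t = 1 / (4 * u)"
    have t: "0 < t" using u by (simp add: t_def)
    let ?e = "\<lambda>x \<xi>::'a. exp (- \<i> * complex_of_real (x \<bullet> \<xi>))"
    have J: "integrable (lborel \<Otimes>\<^sub>M lborel) (\<lambda>(x, \<xi>). (f x * heat t \<xi>) *\<^sub>R ?e (x - y) \<xi>)"
    proof (rule integrableI_bounded)
      have "(\<integral>\<^sup>+z. ennreal (norm (case z of (x, \<xi>) \<Rightarrow> (f x * heat t \<xi>) *\<^sub>R ?e (x - y) \<xi>)) \<partial>(lborel \<Otimes>\<^sub>M lborel))
        = (\<integral>\<^sup>+x. (\<integral>\<^sup>+\<xi>. ennreal \<bar>f x\<bar> * ennreal (heat t (\<xi>::'a)) \<partial>lborel) \<partial>lborel)"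
        by (subst lborel.nn_integral_fst[symmetric]) (auto simp: abs_mult ennreal_mult'[symmetric])
      also have "\<dots> < \<infinity>" using t f by (auto simp: nn_integral_cmult nn_integral_heat integrable_iff_bounded)
      finally show "(\<integral>\<^sup>+z. ennreal (norm (case z of (x, \<xi>) \<Rightarrow> (f x * heat t \<xi>) *\<^sub>R ?e (x - y) \<xi>)) \<partial>(lborel \<Otimes>\<^sub>M lborel)) < \<infinity>" .
    qed measurable
    have "complex_of_real (LINT x|lborel. f x * exp (- t * (norm (x - y))\<^sup>2)) = (LINT x|lborel. f x *\<^sub>R (LINT \<xi>|lborel. heat t \<xi> *\<^sub>R ?e (x - y) \<xi>))"
      unfolding heat_fourier[OF t] by (simp add: scaleR_conv_of_real flip: integral_complex_of_real)
    also have "\<dots> = (LINT x|lborel. LINT \<xi>|lborel. (f x * heat t \<xi>) *\<^sub>R ?e (x - y) \<xi>)"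
      by (simp add: scaleR_scaleR[symmetric] del: scaleR_scaleR)
    also have "\<dots> = (LINT \<xi>|lborel. LINT x|lborel. (f x * heat t \<xi>) *\<^sub>R ?e (x - y) \<xi>)"
      using lborel_pair.Fubini_integral[OF J] by simp
    also have "\<dots> = (LINT \<xi>|(lborel :: 'a measure). 0)"
    proof (intro Bochner_Integration.integral_cong refl)
      fix \<xi> :: 'a
      have "(f x * heat t \<xi>) *\<^sub>R ?e (x - y) \<xi> = (heat t \<xi> *\<^sub>R exp (\<i> * complex_of_real (y \<bullet> \<xi>))) * (f x *\<^sub>R exp (- \<i> * complex_of_real (\<xi> \<bullet> x)))" for x
        by (simp add: scaleR_conv_of_real exp_add[symmetric] inner_diff_left inner_commute[of x] algebra_simps)
      then have "(LINT x|lborel. (f x * heat t \<xi>) *\<^sub>R ?e (x - y) \<xi>) = (heat t \<xi> *\<^sub>R exp (\<i> * complex_of_real (y \<bullet> \<xi>))) * (LINT x|lborel. f x *\<^sub>R exp (- \<i> * complex_of_real (\<xi> \<bullet> x)))"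
        by (simp only: integral_mult_right_zero)
      then show "(LINT x|lborel. (f x * heat t \<xi>) *\<^sub>R ?e (x - y) \<xi>) = 0" by (simp only: zero mult_zero_right)
    qed
    finally have z: "(LINT x|lborel. f x * exp (- t * (norm (x - y))\<^sup>2)) = 0" by simp
    have "f x * heat u (x - y) = (4 * pi * u) powr - (real DIM('a) / 2) * (f x * exp (- t * (norm (x - y))\<^sup>2))" for x
      using u by (simp add: heat_explicit t_def)
    then show ?thesis by (simp only: integral_mult_right_zero z mult_zero_right)
  qed
  show ?thesis
  proof (rule AE_zero_if_zero_against_bumps[OF f_meas])
    show "integrable lborel (\<lambda>x. indicator (ball 0 r) x * f x)" for r
      by (rule integrable_powr_imp_locally_integrable[OF _ f_meas f1]) simp
    fix \<psi> :: "'a \<Rightarrow> real" assume \<psi>: "bump \<psi>"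
    obtain B where B: "\<And>w. \<bar>correlation f \<psi> w\<bar> \<le> B" using correlation_bounded[OF order_refl f_meas f1 \<psi>] by blast
    have c0: "(LINT w|lborel. heat u w * correlation f \<psi> w) = 0" if u: "0 < u" for u
    proof -
      have inner: "(LINT w|lborel. heat u w * f (x + w)) = 0" for x
      proof -
        have "(LINT y|lborel. f y * heat u (y - x)) = (LINT w|lborel. f (x + w) * heat u (x + w - x))"
          by (subst lborel_distr_plus[of x, symmetric], subst integral_distr) auto
        then show ?thesis using gauss[OF u, of x] by (simp add: mult.commute)
      qed
      have "(LINT w|lborel. heat u w * correlation f \<psi> (0 + w)) = 0"
        by (subst correlation_fubini[OF order_refl f_meas f1 \<psi> integrable_heat[OF u]]) (simp add: inner)
      then show ?thesis by simp
    qed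
    have "(\<lambda>n. LINT w|lborel. heat (1 / real (Suc n)) w * correlation f \<psi> w) \<longlonglongrightarrow> correlation f \<psi> 0"
      by (intro heat_approximation[OF correlation_continuous[OF order_refl f_meas f1 \<psi>] B] LIMSEQ_Suc lim_1_over_n) simp
    then have "(\<lambda>n. 0 :: real) \<longlonglongrightarrow> correlation f \<psi> 0" by (simp add: c0 del: of_nat_Suc)
    from LIMSEQ_unique[OF tendsto_const this] show "(LINT x|lborel. f x * \<psi> x) = 0" by (simp add: correlation_def)
  qed
qed

section \<open>Bessel potentials of Lebesgue functions\<close>

lemma AE_lebesgue_iff_lborel: "(AE x in lebesgue. P x) \<longleftrightarrow> (AE x in lborel. P x)"
proof
  assume "AE x in lebesgue. P x"
  then obtain N where "N \<in> null_sets lebesgue" "{x. \<not> P x} \<subseteq> N" by (auto simp: eventually_ae_filter)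
  then obtain N' where "N' \<in> null_sets lborel" "{x. \<not> P x} \<subseteq> N'"
    unfolding null_sets_completion_iff2 by blast
  then show "AE x in lborel. P x" by (auto simp: eventually_ae_filter)
qed (rule AE_completion)

lemma AE_lborel_reflect:
  fixes x :: "'a::euclidean_space"
  assumes "AE y in lborel. P y"
  shows "AE y in lborel. P (x - y)"
proof -
  from assms obtain N where N: "N \<in> null_sets lborel" "{y. \<not> P y} \<subseteq> N" by (auto simp: eventually_ae_filter)
  then have [measurable]: "N \<in> sets borel" by auto
  have "distr lborel borel (\<lambda>y. x - y) = lborel"
    using lborel_affine[of "-1" x] by (simp add: density_1)
  moreover have "AE y in lborel. y \<notin> N" using N(1) by (rule AE_not_in)
  ultimately have "AE y in distr lborel borel (\<lambda>y. x - y). y \<notin> N" by (simp only:)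
  then have "AE y in lborel. x - y \<notin> N" by (subst (asm) AE_distr_iff) auto
  then show ?thesis by (rule eventually_mono) (use N(2) in blast)
qed

lemma integral_lebesgue_eq_lborel:
  fixes f g :: "'a::euclidean_space \<Rightarrow> real"
  assumes g: "g \<in> borel_measurable borel" and AE: "AE x in lborel. f x = g x"
  shows "(LINT x|lebesgue. f x) = (LINT x|lborel. g x)"
proof -
  have g': "g \<in> borel_measurable lebesgue" using g by (simp add: measurable_completion)
  have AE': "AE x in lebesgue. g x = f x" using AE_completion[OF AE] by (rule eventually_mono) simp
  have f': "f \<in> borel_measurable lebesgue" by (rule borel_measurable_AE[OF g' AE'])
  have "(LINT x|lebesgue. f x) = (LINT x|lebesgue. g x)"
    using AE_completion[OF AE] by (intro integral_cong_AE f' g')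
  also have "\<dots> = (LINT x|lborel. g x)" by (rule integral_completion) (use g in simp)
  finally show ?thesis .
qed

text \<open>
  The kernel was selected by its Fourier transform, which the mixture shares.
\<close>

lemma bessel_kernel_eq_heat_mixture:
  assumes \<alpha>: "0 < \<alpha>"
  shows "AE x::'a::euclidean_space in lborel. bessel_kernel \<alpha> x = heat_mixture (\<alpha> / 2) x"
proof -
  let ?G = "heat_mixture (\<alpha> / 2) :: 'a \<Rightarrow> real"
  have a: "0 < \<alpha> / 2" using \<alpha> by simp
  have G: "integrable lborel ?G" by (rule integrable_heat_mixture[OF a])
  have "integrable lebesgue ?G \<and> (\<forall>\<xi>. fourier ?G \<xi> = complex_of_real ((1 + (norm \<xi>)\<^sup>2) powr (- \<alpha> / 2)))"
    using G by (simp add: integrable_completion heat_mixture_fourier[OF a])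
  then have bk: "integrable lebesgue (bessel_kernel \<alpha> :: 'a \<Rightarrow> real) \<and>
      (\<forall>\<xi>::'a. fourier (bessel_kernel \<alpha>) \<xi> = complex_of_real ((1 + (norm \<xi>)\<^sup>2) powr (- \<alpha> / 2)))"
    unfolding bessel_kernel_def
    by (rule someI[where P="\<lambda>g. integrable lebesgue g \<and> (\<forall>\<xi>. fourier g \<xi> = complex_of_real ((1 + (norm \<xi>)\<^sup>2) powr (- \<alpha> / 2)))"])
  obtain g where g[measurable]: "g \<in> borel_measurable lborel" and gAE: "AE x in lborel. bessel_kernel \<alpha> (x::'a) = g x"
    using completion_ex_borel_measurable_real[of "bessel_kernel \<alpha> :: 'a \<Rightarrow> real" lborel] bk by auto
  have gAE': "AE x in lebesgue. bessel_kernel \<alpha> (x::'a) = g x" using gAE by (rule AE_completion)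
  have "integrable lebesgue g"
    by (rule integrable_cong_AE_imp[OF conjunct1[OF bk]])
      (use gAE' measurable_completion[OF g] in \<open>auto elim!: eventually_mono\<close>)
  then have gi: "integrable lborel g" by (simp add: integrable_completion)
  have "AE x in lborel. g x - ?G x = 0"
  proof (rule fourier_unique)
    show "integrable lborel (\<lambda>x. g x - ?G x)" using gi G by simp
    fix \<xi> :: 'a
    let ?e = "\<lambda>x. exp (- \<i> * complex_of_real (\<xi> \<bullet> x))"
    have int: "integrable lborel (\<lambda>x. h x *\<^sub>R ?e x)" if "integrable lborel h" for h :: "'a \<Rightarrow> real"
      by (rule Bochner_Integration.integrable_bound[OF that]) (use borel_measurable_integrable[OF that] in auto)
    have "fourier (bessel_kernel \<alpha>) \<xi> = (LINT x|lebesgue. g x *\<^sub>R ?e x)"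
      unfolding fourier_def
    proof (rule integral_cong_AE)
      show "(\<lambda>x. complex_of_real (bessel_kernel \<alpha> x) * ?e x) \<in> borel_measurable lebesgue"
      proof -
        have "bessel_kernel \<alpha> \<in> borel_measurable (lebesgue :: 'a measure)" using bk by auto
        moreover have "?e \<in> borel_measurable lebesgue" by (rule measurable_completion) measurable
        ultimately show ?thesis by measurable
      qed
      show "(\<lambda>x. g x *\<^sub>R ?e x) \<in> borel_measurable lebesgue" by (rule measurable_completion) measurable
      show "AE x in lebesgue. complex_of_real (bessel_kernel \<alpha> x) * ?e x = g x *\<^sub>R ?e x"
        using gAE' by (rule eventually_mono) (simp add: scaleR_conv_of_real)
    qed
    also have "\<dots> = (LINT x|lborel. g x *\<^sub>R ?e x)" by (rule integral_completion) measurable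
    finally have 1: "(LINT x|lborel. g x *\<^sub>R ?e x) = complex_of_real ((1 + (norm \<xi>)\<^sup>2) powr (- \<alpha> / 2))" using bk by simp
    have "fourier ?G \<xi> = (LINT x|lborel. ?G x *\<^sub>R ?e x)"
      unfolding fourier_def by (subst integral_completion) (auto simp: scaleR_conv_of_real)
    then have 2: "(LINT x|lborel. ?G x *\<^sub>R ?e x) = complex_of_real ((1 + (norm \<xi>)\<^sup>2) powr (- \<alpha> / 2))"
      by (simp add: heat_mixture_fourier[OF a])
    show "(LINT x|lborel. (g x - ?G x) *\<^sub>R ?e x) = 0"
      unfolding scaleR_diff_left using 1 2 by (subst Bochner_Integration.integral_diff[OF int[OF gi] int[OF G]]) simp
  qed
  with gAE show ?thesis by eventually_elim simp
qed

lemma Lp_space_borel_version: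
  assumes f: "f \<in> Lp_space p"
  obtains f' where "f' \<in> borel_measurable borel" "AE y in lborel. f y = f' y"
    "integrable lborel (\<lambda>y. \<bar>f' y\<bar> powr p)" "Lp_norm p f = (LINT y|lborel. \<bar>f' y\<bar> powr p) powr (1 / p)"
proof -
  from f have fm: "f \<in> borel_measurable lebesgue" and fi: "integrable lebesgue (\<lambda>x. \<bar>f x\<bar> powr p)"
    by (auto simp: Lp_space_def)
  obtain f' where f'[measurable]: "f' \<in> borel_measurable lborel" and AE: "AE y in lborel. f y = f' y"
    using completion_ex_borel_measurable_real[OF fm] by auto
  have "integrable lebesgue (\<lambda>y. \<bar>f' y\<bar> powr p)"
    by (rule integrable_cong_AE_imp[OF fi])
      (use AE_completion[OF AE] in \<open>auto elim!: eventually_mono intro!: measurable_completion\<close>)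
  then have fi': "integrable lborel (\<lambda>y. \<bar>f' y\<bar> powr p)" by (simp add: integrable_completion)
  have "(LINT x|lebesgue. \<bar>f x\<bar> powr p) = (LINT y|lborel. \<bar>f' y\<bar> powr p)"
    using AE by (intro integral_lebesgue_eq_lborel) (auto elim!: eventually_mono)
  then show thesis using that[OF _ AE fi'] f' by (simp add: Lp_norm_def)
qed

lemma convol_bessel_kernel:
  fixes f f' :: "'a::euclidean_space \<Rightarrow> real"
  assumes \<alpha>: "0 < \<alpha>" and [measurable]: "f' \<in> borel_measurable borel" and AE: "AE y in lborel. f y = f' y"
  shows "convol (bessel_kernel \<alpha>) f x = (LINT y|lborel. heat_mixture (\<alpha> / 2) (x - y) * f' y)"
  unfolding convol_def
proof (rule integral_lebesgue_eq_lborel)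
  show "AE y in lborel. bessel_kernel \<alpha> (x - y) * f y = heat_mixture (\<alpha> / 2) (x - y) * f' y"
    using AE AE_lborel_reflect[OF bessel_kernel_eq_heat_mixture[OF \<alpha>, where 'a='a], of x] by eventually_elim simp
qed measurable

text \<open>
  The density selected for the potential zero has to be zero almost everywhere, by injectivity. This
  shows that the unit ball of the Bessel potential space is nonempty.
\<close>

lemma bessel_norm_zero:
  assumes \<alpha>: "0 < \<alpha>" and p: "1 \<le> p"
  shows "(\<lambda>_::'a::euclidean_space. 0) \<in> bessel_space \<alpha> p" and "bessel_norm \<alpha> p (\<lambda>_::'a. 0) = 0"
proof -
  let ?z = "\<lambda>_::'a. 0 :: real"
  have z: "bessel_density \<alpha> p ?z ?z"
    using p by (simp add: bessel_density_def Lp_space_def convol_def)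
  then show "?z \<in> bessel_space \<alpha> p" by (auto simp: bessel_space_def)
  define f where "f = (SOME f. bessel_density \<alpha> p ?z f)"
  have f: "bessel_density \<alpha> p ?z f" unfolding f_def using z by (rule someI[of "bessel_density \<alpha> p ?z"])
  then have "f \<in> Lp_space p" by (simp add: bessel_density_def)
  then obtain f' where [measurable]: "f' \<in> borel_measurable borel" and AE: "AE y in lborel. f y = f' y"
    and fi: "integrable lborel (\<lambda>y. \<bar>f' y\<bar> powr p)" and norm: "Lp_norm p f = (LINT y|lborel. \<bar>f' y\<bar> powr p) powr (1 / p)"
    by (rule Lp_space_borel_version)
  have "AE x in lborel. ?z x = convol (bessel_kernel \<alpha>) f x"
    using conjunct2[OF f[unfolded bessel_density_def]] by (simp only: AE_lebesgue_iff_lborel)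
  then have z': "AE x in lborel. (LINT y|lborel. heat_mixture (\<alpha> / 2) (x - y) * f' y) = 0"
    by (rule eventually_mono) (simp only: convol_bessel_kernel[OF \<alpha> \<open>f' \<in> borel_measurable borel\<close> AE])
  have "0 < \<alpha> / 2" using \<alpha> by simp
  then have "AE y in lborel. f' y = 0"
    by (rule heat_mixture_convolution_injective[OF _ p \<open>f' \<in> borel_measurable borel\<close> fi z'])
  then have "AE y in lborel. \<bar>f' y\<bar> powr p = 0"
    by (rule eventually_mono) simp
  then have "(LINT y|lborel. \<bar>f' y\<bar> powr p) = 0" by (rule integral_eq_zero_AE)
  then show "bessel_norm \<alpha> p ?z = 0" by (simp add: bessel_norm_def f_def[symmetric] norm)
qed

section \<open>The duality inequality\<close>

text \<open>
  The functions \<open>v\<close> and \<open>f\<close> are replaced by Borel representatives, \<open>v\<close> is truncated at its norm, and \<open>f\<close> is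
  divided by a number \<open>e\<close> slightly larger than its norm, which avoids a case distinction for norm zero.
  The exponent \<open>\<beta>\<close> is free below \<open>\<alpha>\<close> because the Bessel kernel decays rapidly.
\<close>

lemma bessel_pairing_estimate:
  fixes \<Omega> :: "'a::euclidean_space set" and \<phi> :: "'a \<Rightarrow> real" and grad\<phi> :: "'a \<Rightarrow> 'a" and \<alpha> \<beta> p :: real
  assumes \<Omega>: "open \<Omega>" "bounded \<Omega>" and grad: "\<And>x. GDERIV \<phi> x :> grad\<phi> x" and cont: "continuous_on UNIV grad\<phi>"
    and nondeg: "\<And>x. x \<in> closure \<Omega> \<Longrightarrow> \<phi> x = 0 \<Longrightarrow> grad\<phi> x \<noteq> 0"
    and dim: "2 \<le> DIM('a)" and p: "1 < p" and \<alpha>: "0 < \<alpha>"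
    and \<beta>: "\<beta> \<le> \<alpha>" "1 / p < \<beta>" "\<beta> < real DIM('a) / p"
    and trace: "2 * real DIM('a) \<le> p * (real DIM('a) - 1 + 2 * \<beta>)"
  obtains K where "0 < K"
    "\<And>v f u. \<lbrakk>v \<in> Linf_space \<Omega>; bessel_density \<alpha> p u f\<rbrakk> \<Longrightarrow>
      (\<integral>\<^sup>+x. ennreal \<bar>indicator \<Omega> x * (v x * u x)\<bar> \<partial>lebesgue)
       \<le> ennreal (Lp_norm p f * K * sqrt (Linf_norm \<Omega> v * (LINT x:\<Omega>|lebesgue. \<bar>\<phi> x * v x\<bar>)))"
proof -
  define d where "d = real DIM('a)"
  obtain K0 where K0: "0 < K0" and est:
    "\<And>f V M A. \<lbrakk>f \<in> borel_measurable borel; \<And>y. 0 \<le> f y; (\<integral>\<^sup>+y. ennreal (f y powr p) \<partial>lborel) \<le> 1;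
       V \<in> borel_measurable borel; \<And>x. 0 \<le> V x; \<And>x. V x \<le> M; \<And>x. x \<notin> \<Omega> \<Longrightarrow> V x = 0;
       0 \<le> A; (\<integral>\<^sup>+x. ennreal (V x * \<bar>\<phi> x\<bar>) \<partial>lborel) = ennreal A\<rbrakk> \<Longrightarrow>
     (\<integral>\<^sup>+x. ennreal (V x) * riesz_potential (d - \<beta>) f x \<partial>lborel)
       \<le> ennreal (K0 * sqrt (M * A))"
    unfolding d_def
    by (rule weighted_potential_estimate[OF \<Omega>(2) grad cont nondeg dim p \<beta>(2,3) trace]) blast+
  have "d / p < d" using p by (simp add: d_def field_simps)
  then have m: "0 < d - \<beta>" "d - 2 * (\<alpha> / 2) \<le> d - \<beta>" using \<beta> by (auto simp: d_def)
  have a: "0 < \<alpha> / 2" using \<alpha> by simp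
  obtain Cg where Cg: "0 < Cg" "\<And>x::'a. x \<noteq> 0 \<Longrightarrow> heat_mixture (\<alpha> / 2) x \<le> Cg * norm x powr - (d - \<beta>)"
    using heat_mixture_bound[OF a m[unfolded d_def]] unfolding d_def by blast
  have \<phi>_cont: "continuous_on UNIV \<phi>" using grad by (rule GDERIV_imp_continuous_on)
  have \<phi>_meas [measurable]: "\<phi> \<in> borel_measurable borel" using \<phi>_cont by (rule borel_measurable_continuous_onI)
  have [measurable]: "\<Omega> \<in> sets borel" using \<Omega> by simp
  have \<Omega>_leb: "\<Omega> \<inter> space lebesgue \<in> sets (lebesgue :: 'a measure)" using \<Omega> by (simp add: lmeasurable_open fmeasurableD)
  have "compact (\<phi> ` closure \<Omega>)" using \<Omega> by (intro compact_continuous_image continuous_on_subset[OF \<phi>_cont]) (auto simp: compact_closure)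
  then obtain B where B: "0 < B" "\<And>x. x \<in> \<Omega> \<Longrightarrow> \<bar>\<phi> x\<bar> \<le> B"
    using compact_imp_bounded bounded_pos closure_subset by (metis (no_types, lifting) image_eqI real_norm_def subsetD)
  show thesis
  proof (rule that[of "Cg * K0"])
    show "0 < Cg * K0" using Cg K0 by simp
    fix v f u :: "'a \<Rightarrow> real"
    assume v: "v \<in> Linf_space \<Omega>" and u: "bessel_density \<alpha> p u f"
    define M where "M = Linf_norm \<Omega> v"
    define A where "A = (LINT x:\<Omega>|lebesgue. \<bar>\<phi> x * v x\<bar>)"
    have M: "0 \<le> M" by (simp add: M_def Linf_norm_def)
    let ?w = "\<lambda>x. indicator \<Omega> x *\<^sub>R v x"
    have w_meas: "?w \<in> borel_measurable lebesgue"
      using v borel_measurable_restrict_space_iff[OF \<Omega>_leb, of v] by (simp add: Linf_space_def)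
    have "AE x in lebesgue_on \<Omega>. ennreal \<bar>v x\<bar> \<le> Linf_ess \<Omega> v"
      unfolding Linf_ess_def by (rule esssup_AE)
    then have "AE x in lebesgue. x \<in> \<Omega> \<longrightarrow> ennreal \<bar>v x\<bar> \<le> Linf_ess \<Omega> v"
      by (subst (asm) AE_restrict_space_iff[OF \<Omega>_leb])
    moreover have "Linf_ess \<Omega> v = ennreal M"
      using v by (simp add: M_def Linf_norm_def Linf_space_def)
    ultimately have vM: "AE x in lborel. x \<in> \<Omega> \<longrightarrow> \<bar>v x\<bar> \<le> M"
      using M by (simp add: AE_lebesgue_iff_lborel)
    obtain w' where [measurable]: "w' \<in> borel_measurable lborel" and w': "AE x in lborel. ?w x = w' x"
      using completion_ex_borel_measurable_real[OF w_meas] by auto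
    define V where "V x = indicator \<Omega> x * min M \<bar>w' x\<bar>" for x
    have V_meas: "V \<in> borel_measurable borel" unfolding V_def by measurable
    note [measurable] = V_meas
    have V: "\<And>x. 0 \<le> V x" "\<And>x. V x \<le> M" "\<And>x. x \<notin> \<Omega> \<Longrightarrow> V x = 0"
      using M by (auto simp: V_def indicator_def)
    have Vv: "AE x in lborel. indicator \<Omega> x * \<bar>v x\<bar> = V x"
      using vM w' by eventually_elim (auto simp: V_def indicator_def)
    have A_eq: "A = (LINT x|lborel. V x * \<bar>\<phi> x\<bar>)"
      unfolding A_def set_lebesgue_integral_def
      by (rule integral_lebesgue_eq_lborel) (use Vv in \<open>auto elim!: eventually_mono simp: abs_mult\<close>)
    have "integrable lborel (\<lambda>x. V x * \<bar>\<phi> x\<bar>)"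
    proof (rule Bochner_Integration.integrable_bound)
      show "integrable lborel (\<lambda>x. indicator \<Omega> x * (M * B))"
        using emeasure_bounded_finite[OF \<Omega>(2)] by (intro integrable_mult_left) (simp add: less_top)
      show "AE x in lborel. norm (V x * \<bar>\<phi> x\<bar>) \<le> norm (indicator \<Omega> x * (M * B))"
      proof (rule AE_I2)
        fix x show "norm (V x * \<bar>\<phi> x\<bar>) \<le> norm (indicator \<Omega> x * (M * B))"
          using V B M by (cases "x \<in> \<Omega>") (auto simp: abs_mult intro!: mult_mono)
      qed
    qed measurable
    then have A_nn: "(\<integral>\<^sup>+x. ennreal (V x * \<bar>\<phi> x\<bar>) \<partial>lborel) = ennreal A"
      unfolding A_eq using V(1) by (intro nn_integral_eq_integral) auto
    have A0: "0 \<le> A" unfolding A_eq using V(1) by (intro integral_nonneg_AE) auto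
    from u have fLp: "f \<in> Lp_space p" and u_eq: "AE x in lborel. u x = convol (bessel_kernel \<alpha>) f x"
      by (auto simp: bessel_density_def AE_lebesgue_iff_lborel)
    obtain f' where f'_meas[measurable]: "f' \<in> borel_measurable borel" and f'AE: "AE y in lborel. f y = f' y"
      and fi: "integrable lborel (\<lambda>y. \<bar>f' y\<bar> powr p)" and norm: "Lp_norm p f = (LINT y|lborel. \<bar>f' y\<bar> powr p) powr (1 / p)"
      using Lp_space_borel_version[OF fLp] by blast
    have bound: "(\<integral>\<^sup>+x. ennreal \<bar>indicator \<Omega> x * (v x * u x)\<bar> \<partial>lebesgue) \<le> ennreal (e * (Cg * K0) * sqrt (M * A))"
      if e: "Lp_norm p f < e" for e
    proof -
      have N0: "0 \<le> Lp_norm p f" by (simp add: norm)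
      then have e0: "0 < e" using e by simp
      define F where "F y = \<bar>f' y\<bar> / e" for y
      have [measurable]: "F \<in> borel_measurable borel" unfolding F_def by measurable
      have F0: "0 \<le> F y" for y using e0 by (simp add: F_def)
      define P where "P = riesz_potential (d - \<beta>) F"
      have [measurable]: "P \<in> borel_measurable borel" unfolding P_def by measurable
      have "(\<integral>\<^sup>+y. ennreal (F y powr p) \<partial>lborel) = (\<integral>\<^sup>+y. ennreal (\<bar>f' y\<bar> powr p / e powr p) \<partial>lborel)"
        using e0 by (simp add: F_def powr_divide)
      also have "\<dots> = ennreal ((LINT y|lborel. \<bar>f' y\<bar> powr p) / e powr p)"
        using fi by (subst nn_integral_eq_integral) auto
      also have "\<dots> \<le> 1"
      proof -
        have "(LINT y|lborel. \<bar>f' y\<bar> powr p) = Lp_norm p f powr p"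
          using p by (simp add: norm powr_powr)
        also have "\<dots> \<le> e powr p" using N0 e p by (intro powr_mono2) auto
        finally show ?thesis using e0 by simp
      qed
      finally have F_norm: "(\<integral>\<^sup>+y. ennreal (F y powr p) \<partial>lborel) \<le> 1" .
      have VP: "(\<integral>\<^sup>+x. ennreal (V x) * P x \<partial>lborel) \<le> ennreal (K0 * sqrt (M * A))"
        unfolding P_def using F0 F_norm V A0 A_nn by (intro est) auto
      have conv: "ennreal \<bar>convol (bessel_kernel \<alpha>) f x\<bar> \<le> ennreal (e * Cg) * P x" for x
      proof -
        have "ennreal \<bar>convol (bessel_kernel \<alpha>) f x\<bar> \<le> (\<integral>\<^sup>+y. ennreal \<bar>heat_mixture (\<alpha> / 2) (x - y) * f' y\<bar> \<partial>lborel)"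
          unfolding convol_bessel_kernel[OF \<alpha> f'_meas f'AE]
          using integral_norm_bound_ennreal[of lborel "\<lambda>y. heat_mixture (\<alpha> / 2) (x - y) * f' y"]
          by (cases "integrable lborel (\<lambda>y. heat_mixture (\<alpha> / 2) (x - y) * f' y)") (simp_all add: not_integrable_integral_eq)
        also have "\<dots> \<le> (\<integral>\<^sup>+y. ennreal (e * Cg) * ennreal (norm (x - y) powr - (d - \<beta>) * F y) \<partial>lborel)"
        proof (rule nn_integral_mono_AE, rule AE_mp[OF AE_lborel_singleton[of x]], rule AE_I2, rule impI)
          fix y assume "y \<noteq> x"
          then have "\<bar>heat_mixture (\<alpha> / 2) (x - y)\<bar> \<le> Cg * norm (x - y) powr - (d - \<beta>)"
            using Cg(2)[of "x - y"] heat_mixture_nonneg[OF a, of "x - y"] by simp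
          then have "\<bar>heat_mixture (\<alpha> / 2) (x - y)\<bar> * \<bar>f' y\<bar> \<le> (Cg * norm (x - y) powr - (d - \<beta>)) * \<bar>f' y\<bar>"
            by (intro mult_right_mono) auto
          also have "\<dots> = (e * Cg) * (norm (x - y) powr - (d - \<beta>) * F y)" using e0 by (simp add: F_def)
          finally show "ennreal \<bar>heat_mixture (\<alpha> / 2) (x - y) * f' y\<bar> \<le> ennreal (e * Cg) * ennreal (norm (x - y) powr - (d - \<beta>) * F y)"
            using e0 Cg(1) by (simp add: ennreal_mult'[symmetric] abs_mult ennreal_leI)
        qed
        also have "\<dots> = ennreal (e * Cg) * P x" unfolding P_def riesz_potential_def by (rule nn_integral_cmult) measurable
        finally show ?thesis .
      qed
      have "(\<integral>\<^sup>+x. ennreal \<bar>indicator \<Omega> x * (v x * u x)\<bar> \<partial>lebesgue) = (\<integral>\<^sup>+x. ennreal \<bar>indicator \<Omega> x * (v x * u x)\<bar> \<partial>lborel)"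
        by (rule nn_integral_completion)
      also have "\<dots> \<le> (\<integral>\<^sup>+x. ennreal (e * Cg) * (ennreal (V x) * P x) \<partial>lborel)"
      proof (rule nn_integral_mono_AE)
        show "AE x in lborel. ennreal \<bar>indicator \<Omega> x * (v x * u x)\<bar> \<le> ennreal (e * Cg) * (ennreal (V x) * P x)"
          using Vv u_eq
        proof eventually_elim
          case (elim x)
          have "\<bar>indicator \<Omega> x * (v x * u x)\<bar> = V x * \<bar>convol (bessel_kernel \<alpha>) f x\<bar>"
            using elim by (simp add: abs_mult flip: elim(1))
          then have "ennreal \<bar>indicator \<Omega> x * (v x * u x)\<bar> = ennreal (V x) * ennreal \<bar>convol (bessel_kernel \<alpha>) f x\<bar>"
            using V(1) by (simp add: ennreal_mult')
          also have "\<dots> \<le> ennreal (V x) * (ennreal (e * Cg) * P x)" by (intro mult_left_mono conv) simp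
          finally show ?case by (simp add: ac_simps)
        qed
      qed
      also have "\<dots> = ennreal (e * Cg) * (\<integral>\<^sup>+x. ennreal (V x) * P x \<partial>lborel)"
        by (rule nn_integral_cmult) measurable
      also have "\<dots> \<le> ennreal (e * Cg) * ennreal (K0 * sqrt (M * A))" by (intro mult_left_mono VP) simp
      also have "\<dots> = ennreal (e * (Cg * K0) * sqrt (M * A))"
        using e0 Cg(1) by (simp add: ennreal_mult'[symmetric] mult.assoc)
      finally show ?thesis .
    qed
    have "(\<lambda>n. ennreal ((Lp_norm p f + 1 / real (Suc n)) * (Cg * K0) * sqrt (M * A)))
       \<longlonglongrightarrow> ennreal ((Lp_norm p f + 0) * (Cg * K0) * sqrt (M * A))"
      by (intro tendsto_ennrealI tendsto_intros LIMSEQ_Suc lim_1_over_n)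
    moreover have "(\<integral>\<^sup>+x. ennreal \<bar>indicator \<Omega> x * (v x * u x)\<bar> \<partial>lebesgue)
       \<le> ennreal ((Lp_norm p f + 1 / real (Suc n)) * (Cg * K0) * sqrt (M * A))" for n
      by (rule bound) simp
    ultimately have "(\<integral>\<^sup>+x. ennreal \<bar>indicator \<Omega> x * (v x * u x)\<bar> \<partial>lebesgue) \<le> ennreal ((Lp_norm p f + 0) * (Cg * K0) * sqrt (M * A))"
      by (intro LIMSEQ_le_const) auto
    then show "(\<integral>\<^sup>+x. ennreal \<bar>indicator \<Omega> x * (v x * u x)\<bar> \<partial>lebesgue)
       \<le> ennreal (Lp_norm p f * (Cg * K0) * sqrt (Linf_norm \<Omega> v * (LINT x:\<Omega>|lebesgue. \<bar>\<phi> x * v x\<bar>)))"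
      by (simp add: M_def A_def)
  qed
qed

theorem theorem3p3:
  fixes \<Omega> :: "'a::euclidean_space set"
    and \<phi> :: "'a \<Rightarrow> real" and grad\<phi> :: "'a \<Rightarrow> 'a"
    and \<alpha> p :: real
  assumes "open \<Omega>" and "bounded \<Omega>"
    and "\<And>x. GDERIV \<phi> x :> grad\<phi> x" and "continuous_on UNIV grad\<phi>"
    and "\<And>x. x \<in> {x. \<phi> x = 0} \<inter> closure \<Omega> \<Longrightarrow> grad\<phi> x \<noteq> 0"
    and "\<alpha> > 0" and "1 < p" and "p \<le> real DIM('a) / \<alpha>"
    and "p \<ge> 2 * real DIM('a) / (real DIM('a) - 1 + 2 * \<alpha>)"
    and "\<alpha> > 1 / p"
  shows "\<exists>c>0. \<forall>v \<in> Linf_space \<Omega>. \<exists>T. identified_with \<alpha> p \<Omega> v T \<and>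
           Linf_norm \<Omega> v * (LINT x:\<Omega>|lebesgue. \<bar>\<phi> x * v x\<bar>) \<ge> c * (bessel_dual_norm \<alpha> p T)\<^sup>2"
proof -
  define d where "d = real DIM('a)"
  have \<alpha>: "0 < \<alpha>" "1 / p < \<alpha>" and p: "1 < p" by fact+
  have \<alpha>p: "\<alpha> * p \<le> d" "1 < \<alpha> * p"
    using assms(8) \<alpha> p by (auto simp: d_def field_simps)
  have "1 < DIM('a)" using \<alpha>p by (simp add: d_def)
  then have dim: "2 \<le> DIM('a)" by simp
  then have d2: "2 \<le> d" by (simp add: d_def)
  have trace: "2 * d \<le> p * (d - 1 + 2 * \<alpha>)"
    using assms(9) \<alpha> d2 by (simp add: d_def pos_divide_le_eq)
  \<comment> \<open>Only if \<open>\<alpha> * p = d\<close> the order has to be lowered. The trace condition is strict in this case.\<close>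
  obtain \<beta> where \<beta>: "\<beta> \<le> \<alpha>" "1 / p < \<beta>" "\<beta> < d / p" "2 * d \<le> p * (d - 1 + 2 * \<beta>)"
  proof (cases "\<alpha> < d / p")
    case True
    then show ?thesis using \<alpha> trace by (intro that[of \<alpha>]) auto
  next
    case False
    then have eq: "\<alpha> = d / p" using \<alpha>p p by (simp add: field_simps)
    have "max (1 / p) (d / p - (d - 1) / 2) < \<alpha>" using \<alpha> d2 by (simp add: eq)
    then obtain \<beta> where \<beta>: "1 / p < \<beta>" "d / p - (d - 1) / 2 < \<beta>" "\<beta> < \<alpha>"
      using dense by (metis max_less_iff_conj)
    define q where "q = d / p"
    have "q - (d - 1) / 2 < \<beta>" using \<beta>(2) by (simp add: q_def)
    then have "2 * q \<le> d - 1 + 2 * \<beta>" by (simp add: field_simps)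
    then have "p * (2 * q) \<le> p * (d - 1 + 2 * \<beta>)" using p by (intro mult_left_mono) auto
    moreover have "p * (2 * q) = 2 * d" using p by (simp add: q_def)
    ultimately show ?thesis using \<beta> eq by (intro that[of \<beta>]) auto
  qed
  have nondeg: "\<And>x. x \<in> closure \<Omega> \<Longrightarrow> \<phi> x = 0 \<Longrightarrow> grad\<phi> x \<noteq> 0" using assms(5) by blast
  obtain K where K: "0 < K" and est:
    "\<And>v f u. \<lbrakk>v \<in> Linf_space \<Omega>; bessel_density \<alpha> p u f\<rbrakk> \<Longrightarrow>
      (\<integral>\<^sup>+x. ennreal \<bar>indicator \<Omega> x * (v x * u x)\<bar> \<partial>lebesgue)
       \<le> ennreal (Lp_norm p f * K * sqrt (Linf_norm \<Omega> v * (LINT x:\<Omega>|lebesgue. \<bar>\<phi> x * v x\<bar>)))"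
    by (rule bessel_pairing_estimate[OF assms(1-4) nondeg dim p \<alpha>(1) \<beta>(1-3)[unfolded d_def] \<beta>(4)[unfolded d_def]]) blast+
  have \<Omega>_leb: "\<Omega> \<inter> space lebesgue \<in> sets (lebesgue :: 'a measure)"
    using assms(1) by (simp add: lmeasurable_open fmeasurableD)
  show ?thesis
  proof (intro exI[of _ "1 / K\<^sup>2"] conjI ballI)
    show "0 < 1 / K\<^sup>2" using K by simp
    fix v assume v: "v \<in> Linf_space \<Omega>"
    define E where "E = Linf_norm \<Omega> v * (LINT x:\<Omega>|lebesgue. \<bar>\<phi> x * v x\<bar>)"
    have E: "0 \<le> E" unfolding E_def set_lebesgue_integral_def
      by (intro mult_nonneg_nonneg integral_nonneg_AE) (auto simp: Linf_norm_def)
    define T where "T u = (LINT x:\<Omega>|lebesgue. v x * u x)" for u :: "'a \<Rightarrow> real"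
    have w_meas: "(\<lambda>x. indicator \<Omega> x *\<^sub>R v x) \<in> borel_measurable lebesgue"
      using v borel_measurable_restrict_space_iff[OF \<Omega>_leb, of v] by (simp add: Linf_space_def)
    have key: "integrable lebesgue (\<lambda>x. indicator \<Omega> x *\<^sub>R (v x * u x)) \<and> \<bar>T u\<bar> \<le> K * sqrt E * bessel_norm \<alpha> p u"
      if u: "u \<in> bessel_space \<alpha> p" for u
    proof -
      have "\<exists>f. bessel_density \<alpha> p u f" using u by (simp add: bessel_space_def)
      then have "bessel_density \<alpha> p u (SOME f. bessel_density \<alpha> p u f)" by (rule someI_ex)
      from est[OF v this] have le: "(\<integral>\<^sup>+x. ennreal \<bar>indicator \<Omega> x * (v x * u x)\<bar> \<partial>lebesgue)
          \<le> ennreal (K * sqrt E * bessel_norm \<alpha> p u)"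
        by (simp add: E_def bessel_norm_def ac_simps)
      have "(\<lambda>x. (indicator \<Omega> x *\<^sub>R v x) * u x) \<in> borel_measurable lebesgue"
        using u by (intro borel_measurable_times w_meas) (simp add: bessel_space_def)
      then have meas: "(\<lambda>x. indicator \<Omega> x *\<^sub>R (v x * u x)) \<in> borel_measurable lebesgue"
        by (simp add: mult.assoc)
      have int: "integrable lebesgue (\<lambda>x. indicator \<Omega> x *\<^sub>R (v x * u x))"
        using le by (intro integrableI_bounded meas) (auto simp: order_le_less_trans)
      have "ennreal \<bar>T u\<bar> \<le> ennreal (K * sqrt E * bessel_norm \<alpha> p u)"
        using integral_norm_bound_ennreal[OF int] le by (simp add: T_def set_lebesgue_integral_def)
      moreover have "0 \<le> K * sqrt E * bessel_norm \<alpha> p u"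
        using K E by (simp add: bessel_norm_def Lp_norm_def)
      ultimately show ?thesis using int by simp
    qed
    have dual: "T \<in> bessel_dual \<alpha> p"
      unfolding bessel_dual_def
    proof (intro CollectI conjI ballI allI exI[of _ "K * sqrt E"])
      fix u w :: "'a \<Rightarrow> real" assume u: "u \<in> bessel_space \<alpha> p" and w: "w \<in> bessel_space \<alpha> p"
      show "T (\<lambda>x. u x + w x) = T u + T w"
        unfolding T_def set_lebesgue_integral_def distrib_left scaleR_add_right
        using key[OF u] key[OF w] by (intro Bochner_Integration.integral_add) auto
    next
      fix u :: "'a \<Rightarrow> real" and a :: real
      show "T (\<lambda>x. a * u x) = a * T u"
        unfolding T_def set_lebesgue_integral_def integral_mult_right_zero[symmetric]
        by (intro Bochner_Integration.integral_cong) auto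
    next
      fix u :: "'a \<Rightarrow> real" assume "u \<in> bessel_space \<alpha> p"
      then show "\<bar>T u\<bar> \<le> K * sqrt E * bessel_norm \<alpha> p u" using key by blast
    qed
    then have "identified_with \<alpha> p \<Omega> v T" by (simp add: identified_with_def T_def)
    moreover have "(bessel_dual_norm \<alpha> p T)\<^sup>2 \<le> K\<^sup>2 * E"
    proof -
      \<comment> \<open>Here \<open>bessel_norm_zero\<close> is essential: the supremum of the empty set of reals is unspecified.\<close>
      let ?B = "{u \<in> bessel_space \<alpha> p. bessel_norm \<alpha> p u \<le> 1}"
      have zero: "(\<lambda>_::'a. 0) \<in> ?B" using bessel_norm_zero[OF \<alpha>(1), of p, where 'a='a] p by simp
      have le: "\<bar>T u\<bar> \<le> K * sqrt E" if "u \<in> ?B" for u :: "'a \<Rightarrow> real"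
      proof -
        have "\<bar>T u\<bar> \<le> K * sqrt E * bessel_norm \<alpha> p u" using that key by blast
        also have "\<dots> \<le> K * sqrt E * 1" using that K E by (intro mult_left_mono) auto
        finally show ?thesis by simp
      qed
      have "bessel_dual_norm \<alpha> p T \<le> K * sqrt E"
        unfolding bessel_dual_norm_def using zero le by (intro cSUP_least) auto
      moreover have "0 \<le> bessel_dual_norm \<alpha> p T"
      proof -
        have "\<bar>T (\<lambda>_::'a. 0)\<bar> \<le> bessel_dual_norm \<alpha> p T"
          unfolding bessel_dual_norm_def using le zero by (intro cSUP_upper bdd_aboveI2) auto
        then show ?thesis using abs_ge_zero order_trans by blast
      qed
      ultimately have "(bessel_dual_norm \<alpha> p T)\<^sup>2 \<le> (K * sqrt E)\<^sup>2" by (intro power_mono)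
      then show ?thesis using E by (simp add: power_mult_distrib)
    qed
    ultimately show "\<exists>T. identified_with \<alpha> p \<Omega> v T \<and>
       1 / K\<^sup>2 * (bessel_dual_norm \<alpha> p T)\<^sup>2 \<le> Linf_norm \<Omega> v * (LINT x:\<Omega>|lebesgue. \<bar>\<phi> x * v x\<bar>)"
      using K by (intro exI[of _ T]) (simp add: E_def[symmetric] pos_divide_le_eq mult.commute)
  qed
qed

end
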